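(* Let $D\subset\mathbb{C}$ be a bounded domain, $E$ a holomorphic vector bundle over $D$ and $h$ a continuous Hermitian metric on $E$. If $(D,E,h)$ is $L^2$-optimal, then for any $w\in D$ and any $s\in E_w$ there exists $f\in H^0(D,E)$ with $f(w)=s$ satisfying $$\int_D |f|_h^2\,d\lambda_1\le \frac{\pi\,|s|^2_{h(w)}}{c_D(w)^2},$$ where $d\lambda_1$ is the Lebesgue measure of $\mathbb{C}$ and $c_D$ is the logarithmic capacity of $D$.
   Context: $L^2$-optimal triples. Let $D\subset\mathbb{C}^n$ be a domain, $E$ a trivial holomorphic vector bundle on $D$ (every holomorphic vector bundle on a planar domain is holomorphically trivial) and $h$ a singular Hermitian metric on $E$, i.e. a measurable map from $D$ to the space of non-negative Hermitian forms on the fibers with $0<\det h<+\infty$ almost everywhere (continuous Hermitian metrics are a special case). The triple $(D,E,h)$ is called $L^2$-optimal if for every $\bar\partial$-closed $E$-valued $(n,1)$-form $f\in L^2_{(n,1)}(D,E;\mathrm{loc})$ (locally square integrable), every smooth strictly plurisubharmonic function $\phi$ on $D$ and every Kähler metric $\omega$ on $D$, the equation $\bar\partial u=f$ admits a solution $u$ (an $E$-valued $(n,0)$-form) satisfying $$\int_D|u|^2_{\omega,h}e^{-\phi}\,dV_\omega\le\int_D\langle B_{\omega,\phi}^{-1}f,f\rangle_{\omega,h}e^{-\phi}\,dV_\omega,$$ provided the right-hand side is finite. Here $B_{\omega,\phi}:=[i\partial\bar\partial\phi\otimes \mathrm{Id}_E,\Lambda_\omega]$ acting on $E$-valued $(n,1)$-forms,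 $\Lambda_\omega$ is the adjoint of $\omega\wedge\cdot$, $dV_\omega$ is the volume form of $\omega$, and $|\cdot|_{\omega,h}$, $\langle\cdot,\cdot\rangle_{\omega,h}$ are the pointwise norm and inner product induced by $\omega$ and $h$. In the claim this is used with $n=1$. Logarithmic capacity. For a domain $D\subset\mathbb{C}$ and $w\in D$, the complex Green function $g_D(\cdot,w)$ of $D$ with pole at $w$ is the function satisfying: (1) $g_D(\cdot,w)$ is harmonic on $D\setminus\{w\}$; (2) $g_D(z,w)\sim\log|z-w|$ as $z\to w$ (logarithmic singularity); (3) $g_D(z,w)=0$ for $z\in\partial D$ (Dirichlet boundary condition). For bounded $D$ it is taken to exist and be unique, and $g_D(z,w)-\log|z-w|$ is then a bounded harmonic function of $z$ on $D$. The logarithmic capacity at $w$ is $$c_D(w):=\exp\Big(\lim_{z\to w}\big(g_D(z,w)-\log|z-w|\big)\Big).$$ $E_w$ denotes the fiber of $E$ at $w$, and $H^0(D,E)$ denotes the space of holomorphic sections of $E$ over $D$. *)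

theory Defs
  imports "HOL-Analysis.Analysis" "HOL-Library.Landau_Symbols"
begin

section \<open>Smooth functions and Wirtinger derivatives on open subsets of the plane\<close>

text \<open>Here \<open>\<complex>\<close> is regarded as the real plane; \<open>S\<close> is always an open set.\<close>

abbreviation dirderiv :: "complex \<Rightarrow> (complex \<Rightarrow> 'b::real_normed_vector) \<Rightarrow> complex \<Rightarrow> 'b" where
  "dirderiv v f z \<equiv> frechet_derivative f (at z) v"

fun Ck_on :: "nat \<Rightarrow> complex set \<Rightarrow> (complex \<Rightarrow> 'b::real_normed_vector) \<Rightarrow> bool" where
  "Ck_on 0 S f \<longleftrightarrow> continuous_on S f"
| "Ck_on (Suc k) S f \<longleftrightarrow>
     (\<forall>z\<in>S. f differentiable (at z)) \<and> (\<forall>v. Ck_on k S (dirderiv v f))"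

definition smooth_on :: "complex set \<Rightarrow> (complex \<Rightarrow> 'b::real_normed_vector) \<Rightarrow> bool" where
  "smooth_on S f \<longleftrightarrow> (\<forall>k. Ck_on k S f)"

definition d_z :: "(complex \<Rightarrow> complex) \<Rightarrow> complex \<Rightarrow> complex" where
  "d_z f z = (dirderiv 1 f z - \<i> * dirderiv \<i> f z) / 2"

definition d_zbar :: "(complex \<Rightarrow> complex) \<Rightarrow> complex \<Rightarrow> complex" where
  "d_zbar f z = (dirderiv 1 f z + \<i> * dirderiv \<i> f z) / 2"

section \<open>Harmonic and subharmonic functions, polar sets\<close>

definition harmonic_on :: "complex set \<Rightarrow> (complex \<Rightarrow> real) \<Rightarrow> bool" where
  "harmonic_on S f \<longleftrightarrow> Ck_on 2 S f \<and>
     (\<forall>z\<in>S. dirderiv 1 (dirderiv 1 f) z + dirderiv \<i> (dirderiv \<i> f) z = 0)"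

text \<open>Upper semicontinuous functions with values in \<open>[-\<infinity>, \<infinity>)\<close> lying below harmonic majorants;
  the function \<open>-\<infinity>\<close> is allowed.\<close>

definition subharmonic_on :: "complex set \<Rightarrow> (complex \<Rightarrow> ereal) \<Rightarrow> bool" where
  "subharmonic_on S u \<longleftrightarrow>
     (\<forall>z\<in>S. u z < \<infinity>) \<and>
     (\<forall>z\<in>S. \<forall>c. u z < c \<longrightarrow> (\<forall>\<^sub>F y in nhds z. u y < c)) \<and>
     (\<forall>K H. compact K \<and> K \<subseteq> S \<and> continuous_on K H \<and> harmonic_on (interior K) H \<and>
        (\<forall>z\<in>frontier K. u z \<le> ereal (H z)) \<longrightarrow> (\<forall>z\<in>K. u z \<le> ereal (H z)))"

definition polar :: "complex set \<Rightarrow> bool" where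
  "polar N \<longleftrightarrow>
     (\<exists>u. subharmonic_on UNIV u \<and> (\<exists>z. u z \<noteq> -\<infinity>) \<and> N \<subseteq> {z. u z = -\<infinity>})"

section \<open>Green function and logarithmic capacity\<close>

text \<open>The boundary condition is imposed outside a polar set of boundary points. With the exceptional
  set empty this is the classical Dirichlet condition at every boundary point; that form has no
  solution when \<open>D\<close> has irregular boundary points (e.g. a punctured disc), whereas in the present form
  every bounded domain has exactly one Green function for each pole. The requirement that
  \<open>g - log |z - w|\<close> extends to a bounded harmonic function on \<open>D\<close> is automatic in the classical case and
  is what makes the Green function unique in the presence of exceptional points.
  Only the values of \<open>g\<close> on \<open>D - {w}\<close> are constrained.\<close>

definition green_function :: "complex set \<Rightarrow> complex \<Rightarrow> (complex \<Rightarrow> real) \<Rightarrow> bool" where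
  "green_function D w g \<longleftrightarrow>
     harmonic_on (D - {w}) g \<and>
     g \<sim>[at w] (\<lambda>z. ln (cmod (z - w))) \<and>
     (\<exists>H. harmonic_on D H \<and> bounded (H ` D) \<and> (\<forall>z\<in>D - {w}. g z - ln (cmod (z - w)) = H z)) \<and>
     (\<exists>N. polar N \<and> (\<forall>\<zeta>\<in>frontier D - N. (g \<longlongrightarrow> 0) (at \<zeta> within D)))"

definition log_capacity :: "complex set \<Rightarrow> complex \<Rightarrow> real" where
  "log_capacity D w =
     (let g = (SOME g. green_function D w g) in exp (Lim (at w) (\<lambda>z. g z - ln (cmod (z - w)))))"

section \<open>Hermitian metrics on a trivial bundle\<close>

text \<open>The bundle is \<open>D \<times> \<complex>\<^sup>r\<close>; in the global frame a Hermitian form on the fibre is a matrix,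
  \<open>\<langle>a, b\<rangle>\<^sub>h = \<Sum>\<^sub>i\<^sub>j h\<^sub>i\<^sub>j a\<^sub>i cnj b\<^sub>j\<close>.\<close>

definition hprod :: "complex^'r^'r \<Rightarrow> complex^'r \<Rightarrow> complex^'r \<Rightarrow> complex" where
  "hprod h a b = (\<Sum>i\<in>UNIV. \<Sum>j\<in>UNIV. h $ i $ j * a $ i * cnj (b $ j))"

definition hnorm_sq :: "complex^'r^'r \<Rightarrow> complex^'r \<Rightarrow> real" where
  "hnorm_sq h a = Re (hprod h a a)"

definition pos_def_hermitian :: "complex^'r^'r \<Rightarrow> bool" where
  "pos_def_hermitian h \<longleftrightarrow> (\<forall>i j. h $ j $ i = cnj (h $ i $ j)) \<and> (\<forall>a. a \<noteq> 0 \<longrightarrow> 0 < hnorm_sq h a)"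

definition continuous_hermitian_metric :: "complex set \<Rightarrow> (complex \<Rightarrow> complex^'r^'r) \<Rightarrow> bool" where
  "continuous_hermitian_metric D h \<longleftrightarrow> continuous_on D h \<and> (\<forall>z\<in>D. pos_def_hermitian (h z))"

section \<open>Bundle-valued forms in complex dimension one\<close>

text \<open>An \<open>E\<close>-valued (1,0)-form \<open>U dz\<close> is represented by its coefficient \<open>U\<close>, a (1,1)-form
  \<open>F i dz \<and> dz\<^sup>-\<close> by its coefficient \<open>F\<close> (\<open>z\<^sup>-\<close> stands for the conjugate variable). Accordingly a
  Hermitian metric \<open>\<omega> = g i dz \<and> dz\<^sup>-\<close> is a positive function \<open>g\<close>; it is Kaehler automatically, as
  \<open>d\<omega>\<close> has degree 3. For the same reason every (1,1)-form is closed under the Cauchy-Riemann operator.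

  Since \<open>i dz \<and> dz\<^sup>-\<close> is twice Lebesgue measure, \<open>dV\<^sub>\<omega> = \<omega> = 2 g d\<lambda>\<close>. Pointwise
  \<open>|dz|\<^sup>2 = 1 / g\<close> and \<open>|i dz \<and> dz\<^sup>-|\<^sup>2 = 1 / g\<^sup>2\<close>, i.e. \<open>|\<omega>| = 1\<close>.\<close>

definition kaehler_metric :: "complex set \<Rightarrow> (complex \<Rightarrow> real) \<Rightarrow> bool" where
  "kaehler_metric D g \<longleftrightarrow> smooth_on D g \<and> (\<forall>z\<in>D. 0 < g z)"

definition vol_density :: "real \<Rightarrow> real" where
  "vol_density g = 2 * g"

definition norm10_sq :: "real \<Rightarrow> complex^'r^'r \<Rightarrow> complex^'r \<Rightarrow> real" where
  "norm10_sq g h U = hnorm_sq h U / g"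

definition inner11 :: "real \<Rightarrow> complex^'r^'r \<Rightarrow> complex^'r \<Rightarrow> complex^'r \<Rightarrow> complex" where
  "inner11 g h F G = hprod h F G / of_real (g\<^sup>2)"

text \<open>\<open>a i dz \<and> dz\<^sup>-\<close> wedged with a function.\<close>

definition wedge11 :: "real \<Rightarrow> complex^'r \<Rightarrow> complex^'r" where
  "wedge11 a v = a *\<^sub>R v"

definition Lam :: "real \<Rightarrow> complex^'r \<Rightarrow> complex^'r" where
  "Lam g F = (1 / g) *\<^sub>R F"

lemma Lam_adjoint:
  assumes "g > 0"
  shows "inner11 g h (wedge11 g v) F = hprod h v (Lam g F)"
  using assms unfolding inner11_def wedge11_def Lam_def hprod_def sum_divide_distrib
  by (intro sum.cong refl)
    (simp add: vector_scaleR_component power2_eq_square scaleR_conv_of_real[where 'a = complex])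

text \<open>The coefficient of \<open>i \<partial>\<partial>\<^sup>-\<phi>\<close> with respect to \<open>i dz \<and> dz\<^sup>-\<close> (real when \<open>\<phi>\<close> is smooth).\<close>

definition levi :: "(complex \<Rightarrow> real) \<Rightarrow> complex \<Rightarrow> real" where
  "levi \<phi> z = Re (d_z (d_zbar (\<lambda>x. of_real (\<phi> x))) z)"

definition smooth_strictly_psh :: "complex set \<Rightarrow> (complex \<Rightarrow> real) \<Rightarrow> bool" where
  "smooth_strictly_psh D \<phi> \<longleftrightarrow> smooth_on D \<phi> \<and> (\<forall>z\<in>D. 0 < levi \<phi> z)"

text \<open>\<open>[A, \<Lambda>] F = A \<and> \<Lambda>F - \<Lambda>(A \<and> F)\<close> for \<open>A = i \<partial>\<partial>\<^sup>-\<phi>\<close>; the second term vanishes because \<open>A \<and> F\<close> has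
  bidegree (2,2).\<close>

definition B_op :: "real \<Rightarrow> real \<Rightarrow> complex^'r \<Rightarrow> complex^'r" where
  "B_op g a F = wedge11 a (Lam g F)"

section \<open>The \<open>L\<^sup>2\<close>-optimality condition in complex dimension one\<close>

definition loc_integrable :: "complex set \<Rightarrow> (complex \<Rightarrow> complex^'r) \<Rightarrow> bool" where
  "loc_integrable D U \<longleftrightarrow> U \<in> borel_measurable (lebesgue_on D) \<and>
     (\<forall>K. compact K \<and> K \<subseteq> D \<longrightarrow> integrable (lebesgue_on K) U)"

definition loc_L2 :: "complex set \<Rightarrow> (complex \<Rightarrow> complex^'r) \<Rightarrow> bool" where
  "loc_L2 D F \<longleftrightarrow> F \<in> borel_measurable (lebesgue_on D) \<and>
     (\<forall>K. compact K \<and> K \<subseteq> D \<longrightarrow> integrable (lebesgue_on K) (\<lambda>z. (norm (F z))\<^sup>2))"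

definition test_function :: "complex set \<Rightarrow> (complex \<Rightarrow> complex) \<Rightarrow> bool" where
  "test_function D \<psi> \<longleftrightarrow> smooth_on UNIV \<psi> \<and>
     (\<exists>K. compact K \<and> K \<subseteq> D \<and> (\<forall>z. z \<notin> K \<longrightarrow> \<psi> z = 0))"

text \<open>The Cauchy-Riemann equation \<open>\<partial>\<^sup>-(U dz) = F i dz \<and> dz\<^sup>-\<close> in the sense of distributions: as
  \<open>\<partial>\<^sup>-(U dz) = U\<^sub>z\<^sub>- dz\<^sup>- \<and> dz = i U\<^sub>z\<^sub>- (i dz \<and> dz\<^sup>-)\<close>, it says \<open>U\<^sub>z\<^sub>- = - i F\<close>.\<close>

definition dbar_solution ::
    "complex set \<Rightarrow> (complex \<Rightarrow> complex^'r) \<Rightarrow> (complex \<Rightarrow> complex^'r) \<Rightarrow> bool" where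
  "dbar_solution D U F \<longleftrightarrow> loc_integrable D U \<and>
     (\<forall>\<psi>. test_function D \<psi> \<longrightarrow>
        - (\<integral>z. d_zbar \<psi> z *s U z \<partial>lebesgue_on D) = (\<integral>z. \<psi> z *s (- \<i> *s F z) \<partial>lebesgue_on D))"

definition L2_optimal :: "complex set \<Rightarrow> (complex \<Rightarrow> complex^'r^'r) \<Rightarrow> bool" where
  "L2_optimal D h \<longleftrightarrow>
     (\<forall>F \<phi> g. loc_L2 D F \<and> smooth_strictly_psh D \<phi> \<and> kaehler_metric D g \<longrightarrow>
       (let rhs = (\<integral>\<^sup>+z. ennreal (Re (inner11 (g z) (h z) (inv (B_op (g z) (levi \<phi> z)) (F z)) (F z))
                            * exp (- \<phi> z) * vol_density (g z)) \<partial>lebesgue_on D)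
        in rhs < \<infinity> \<longrightarrow>
          (\<exists>U. dbar_solution D U F \<and>
             (\<integral>\<^sup>+z. ennreal (norm10_sq (g z) (h z) (U z) * exp (- \<phi> z) * vol_density (g z))
                \<partial>lebesgue_on D) \<le> rhs)))"

end

theory Submission
  imports Defs "HOL-Complex_Analysis.Complex_Analysis" "HOL-Real_Asymp.Real_Asymp"
begin

text \<open>
  Write the Green function as \<open>G = H + log |z - w|\<close> and put \<open>x = |z - w|\<^sup>2 exp (2 H) + a\<close>, a regularization
  of \<open>exp (2 G)\<close>, and \<open>Q = x - 1 - log x\<close>. The function \<open>\<phi> = 2 H - log Q + \<epsilon> |z - w|\<^sup>2\<close> is
  strictly plurisubharmonic and smooth across \<open>w\<close>. Let \<open>F\<close> have minimal norm among the holomorphic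
  sections with \<open>F w = s\<close>, with respect to the weight \<open>1 / x - 1\<close>. Then \<open>F\<close> is orthogonal to all
  \<open>(z - w) k\<close> with \<open>k\<close> holomorphic, which says that a suitable multiple
  \<open>v = (1 / x - 1) / Q \<sqdot> exp (2 H) \<sqdot> conj (z - w) \<sqdot> F\<close> is the minimal solution of its own Cauchy-Riemann
  equation in the weight \<open>exp (- \<phi>)\<close>. So the solution provided by \<open>L\<^sup>2\<close>-optimality has at least the
  norm of \<open>v\<close>, and the resulting inequality is, up to \<open>\<epsilon>\<close>,
  \<open>\<integral> |F|\<^sup>2 \<le> \<integral> |F|\<^sup>2 a / x\<^sup>2\<close>. As \<open>a \<rightarrow> 0\<close> the kernel \<open>a / x\<^sup>2\<close> concentrates at \<open>w\<close> with total mass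
  \<open>\<pi> exp (- 2 H w)\<close>, the inverse square of the capacity times \<open>\<pi>\<close>. The choice of \<open>Q\<close> is the solution of
  the differential equation that appears in Blocki's proof of the Ohsawa-Takegoshi theorem with optimal
  constant.
\<close>

section \<open>Calculus of smooth functions on plane domains\<close>

text \<open>The metric \<open>h\<close> is merely continuous, so there is no curvature and no
  twisted Bochner formula: only the plain estimate of \<open>L2_optimal\<close>, for weights smooth
  and strictly plurisubharmonic on all of \<open>D\<close>. Hence the pole of \<open>G\<close> is
  regularized inside the weight. Origin of \<open>Q\<close>: put \<omega> = - Q'. In the weight exp
  (- \<phi>), the squared norm of \<open>v\<close> minus its L^2 bound is, up to \<epsilon>, the
  integral of - ((x - a) \<omega>)' |F|^2; the terms with \<omega>^2 / Q cancel because
  \<open>v\<close> and \<phi> share the logarithmic derivative \<omega> / Q. For a = 0 the demand -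
  (x \<omega>)' = 1 gives \<omega> = C / x - 1. C = 1 makes \<omega> vanish at x = 1, the value
  where G = 0, and Q is the integral of \<omega> from x to 1. For a > 0 the same \<omega> yields 1 -
  a / x^2. \<open>F\<close> depends on \<open>a\<close>, so the concentration of a / x^2 at
  \<open>w\<close> must be controlled uniformly in \<open>F\<close>; the error is a small multiple
  of the norm of \<open>F\<close> and is absorbed. Two further ingredients: Weyl's lemma, as
  optimality gives only weak solutions, and G \<le> 0, by a maximum principle with a polar
  exceptional set.\<close>

lemma dirderiv_eq:
  "(f has_derivative f') (at z) \<Longrightarrow> dirderiv v f z = f' v"
  by (simp add: frechet_derivative_at[symmetric])

text \<open>Derivatives at points of an open set see only the values on that set.\<close>

lemma Ck_on_cong:
  assumes "open S" "\<And>z. z \<in> S \<Longrightarrow> f z = g z"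
  shows "Ck_on k S f \<longleftrightarrow> Ck_on k S g"
  using assms(2)
proof (induction k arbitrary: f g)
  case 0
  then show ?case by (simp cong: continuous_on_cong)
next
  case (Suc k)
  have *: "(f has_derivative f') (at z) \<longleftrightarrow> (g has_derivative f') (at z)" if "z \<in> S" for z f'
    using has_derivative_transform_within_open[OF _ \<open>open S\<close> that, of f f' UNIV g]
      has_derivative_transform_within_open[OF _ \<open>open S\<close> that, of g f' UNIV f] Suc.prems by auto
  have "(\<forall>z\<in>S. f differentiable (at z)) \<longleftrightarrow> (\<forall>z\<in>S. g differentiable (at z))"
    using * by (simp add: differentiable_def)
  moreover have "Ck_on k S (dirderiv v f) \<longleftrightarrow> Ck_on k S (dirderiv v g)" for v
    by (rule Suc.IH) (simp add: * frechet_derivative_def)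
  ultimately show ?case by simp
qed

text \<open>Replaces the total \<open>frechet_derivative\<close> by a derivative known only on
  \<open>S\<close>; the closure properties below are inductions through this rule.\<close>

lemma Ck_on_SucI:
  assumes "open S" "\<And>z. z \<in> S \<Longrightarrow> (f has_derivative f' z) (at z)" "\<And>v. Ck_on k S (\<lambda>z. f' z v)"
  shows "Ck_on (Suc k) S f"
proof -
  have "Ck_on k S (dirderiv v f)" for v
    using assms(3)[of v] by (rule Ck_on_cong[THEN iffD1, rotated 2, OF _ \<open>open S\<close>])
      (simp add: dirderiv_eq[OF assms(2)])
  then show ?thesis using assms(2) by (auto simp: differentiable_def)
qed

lemma Ck_on_has_derivative:
  assumes "Ck_on (Suc k) S f" "z \<in> S"
  shows "(f has_derivative (\<lambda>v. dirderiv v f z)) (at z)"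
  using assms by (simp add: frechet_derivative_works)

lemma Ck_on_Suc_imp: "Ck_on (Suc k) S f \<Longrightarrow> Ck_on k S f"
proof (induction k arbitrary: f)
  case 0
  then show ?case
    by (auto intro!: continuous_at_imp_continuous_on differentiable_imp_continuous_within)
next
  case (Suc k)
  then show ?case by (metis Ck_on.simps(2))
qed

lemma Ck_on_imp_continuous: "Ck_on k S f \<Longrightarrow> continuous_on S f"
  by (induction k) (use Ck_on_Suc_imp in auto)

lemma Ck_on_const: "open S \<Longrightarrow> Ck_on k S (\<lambda>_. c)"
proof (induction k arbitrary: c)
  case (Suc k)
  show ?case by (rule Ck_on_SucI[where f'="\<lambda>_ _. 0"]) (use Suc in auto)
qed auto

lemma Ck_on_bounded_linear:
  assumes "open S" "bounded_linear L" "Ck_on k S f"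
  shows "Ck_on k S (\<lambda>z. L (f z))"
  using assms(3)
proof (induction k arbitrary: f)
  case 0
  then show ?case by (auto intro: bounded_linear.continuous_on assms)
next
  case (Suc k)
  show ?case
  proof (rule Ck_on_SucI[OF \<open>open S\<close>])
    show "((\<lambda>z. L (f z)) has_derivative (\<lambda>v. L (dirderiv v f z))) (at z)" if "z \<in> S" for z
      using bounded_linear.has_derivative[OF assms(2) Ck_on_has_derivative[OF Suc.prems that]] .
    show "Ck_on k S (\<lambda>z. L (dirderiv v f z))" for v
      using Suc by auto
  qed
qed

lemma Ck_on_add:
  assumes "open S" "Ck_on k S f" "Ck_on k S g"
  shows "Ck_on k S (\<lambda>z. f z + g z)"
  using assms(2,3)
proof (induction k arbitrary: f g)
  case 0
  then show ?case by (auto intro: continuous_intros)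
next
  case (Suc k)
  show ?case
  proof (rule Ck_on_SucI[OF \<open>open S\<close>])
    show "((\<lambda>z. f z + g z) has_derivative (\<lambda>v. dirderiv v f z + dirderiv v g z)) (at z)"
      if "z \<in> S" for z
      by (intro has_derivative_add Ck_on_has_derivative[OF _ that]) (rule Suc)+
  qed (use Suc in auto)
qed

lemma Ck_on_mult:
  fixes f g :: "complex \<Rightarrow> 'a::real_normed_algebra"
  assumes "open S" "Ck_on k S f" "Ck_on k S g"
  shows "Ck_on k S (\<lambda>z. f z * g z)"
  using assms(2,3)
proof (induction k arbitrary: f g)
  case 0
  then show ?case by (auto intro: continuous_intros)
next
  case (Suc k)
  show ?case
  proof (rule Ck_on_SucI[OF \<open>open S\<close>])
    show "((\<lambda>z. f z * g z) has_derivative (\<lambda>v. f z * dirderiv v g z + dirderiv v f z * g z)) (at z)"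
      if "z \<in> S" for z
      by (intro has_derivative_mult Ck_on_has_derivative[OF _ that]) (rule Suc)+
    show "Ck_on k S (\<lambda>z. f z * dirderiv v g z + dirderiv v f z * g z)" for v
      using Suc.prems by (intro Ck_on_add[OF \<open>open S\<close>] Suc.IH) (auto intro: Ck_on_Suc_imp)
  qed
qed

text \<open>A whole sequence of successive derivatives is carried along because the chain rule turns
  \<open>f n\<close> into \<open>f (Suc n)\<close>; the induction on \<open>k\<close> therefore runs
  over all \<open>n\<close> at once.\<close>

lemma Ck_on_compose_real:
  fixes f :: "nat \<Rightarrow> real \<Rightarrow> real"
  assumes "open S" "\<And>n x. x \<in> I \<Longrightarrow> (f n has_real_derivative f (Suc n) x) (at x)"
    and "u ` S \<subseteq> I" "Ck_on k S u"
  shows "Ck_on k S (\<lambda>z. f n (u z))"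
  using assms(4)
proof (induction k arbitrary: n)
  case 0
  have "continuous_on I (f n)"
    by (intro continuous_at_imp_continuous_on ballI DERIV_isCont[OF assms(2)])
  then show ?case using 0 continuous_on_compose2 assms(3) by auto
next
  case (Suc k)
  show ?case
  proof (rule Ck_on_SucI[OF \<open>open S\<close>])
    show "((\<lambda>z. f n (u z)) has_derivative (\<lambda>v. dirderiv v u z * f (Suc n) (u z))) (at z)"
      if "z \<in> S" for z
    proof -
      have "(f n has_derivative (\<lambda>x. x * f (Suc n) (u z))) (at (u z))"
        using assms(2)[of "u z" n] assms(3) that
        by (simp add: has_field_derivative_def mult_commute_abs image_subset_iff)
      from has_derivative_compose[OF Ck_on_has_derivative[OF Suc.prems that] this]
      show ?thesis .
    qed
    show "Ck_on k S (\<lambda>z. dirderiv v u z * f (Suc n) (u z))" for v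
      using Suc.prems by (intro Ck_on_mult[OF \<open>open S\<close>] Suc.IH) (auto intro: Ck_on_Suc_imp)
  qed
qed

lemma Ck_on_exp:
  assumes "open S" "Ck_on k S u"
  shows "Ck_on k S (\<lambda>z. exp (u z :: real))"
  using Ck_on_compose_real[of S UNIV "\<lambda>_. exp" u k] assms by (auto intro: DERIV_exp)

lemma Ck_on_ln:
  assumes "open S" "Ck_on k S u" "\<And>z. z \<in> S \<Longrightarrow> 0 < u z"
  shows "Ck_on k S (\<lambda>z. ln (u z :: real))"
proof -
  \<comment> \<open>The derivatives of ln: order m + 1 is (-1)^m m! / x^(m + 1).\<close>
  define f :: "nat \<Rightarrow> real \<Rightarrow> real" where
    "f n x = (case n of 0 \<Rightarrow> ln x | Suc m \<Rightarrow> (-1) ^ m * fact m * inverse x ^ Suc m)" for n x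
  have "(f n has_real_derivative f (Suc n) x) (at x)" if "x \<in> {0<..}" for n x
  proof (cases n)
    case 0
    then show ?thesis using that
      by (auto simp: f_def[abs_def] inverse_eq_divide intro!: derivative_eq_intros)
  next
    case (Suc m)
    have "((\<lambda>x. (-1) ^ m * fact m * inverse x ^ Suc m) has_real_derivative
        (-1) ^ m * fact m * (real (Suc m) * inverse x ^ m * - (inverse x ^ 2))) (at x)"
      using that by (auto intro!: derivative_eq_intros simp: power2_eq_square simp del: power_Suc)
    also have "(-1) ^ m * fact m * (real (Suc m) * inverse x ^ m * - (inverse x ^ 2))
        = (-1) ^ Suc m * fact (Suc m) * inverse x ^ Suc (Suc m)"
      by (simp add: power2_eq_square algebra_simps)
    finally show ?thesis by (simp add: f_def[abs_def] Suc)
  qed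
  then have "Ck_on k S (\<lambda>z. f 0 (u z))"
    using assms(3) by (intro Ck_on_compose_real[where I="{0<..}" and f=f and u=u] assms(1,2)) auto
  then show ?thesis by (simp add: f_def)
qed

lemma Ck_on_holomorphic:
  assumes "open S" "f holomorphic_on S"
  shows "Ck_on k S f"
  using assms(2)
proof (induction k arbitrary: f)
  case 0
  then show ?case by (simp add: holomorphic_on_imp_continuous_on)
next
  case (Suc k)
  show ?case
  proof (rule Ck_on_SucI[OF \<open>open S\<close>])
    show "(f has_derivative (\<lambda>v. deriv f z * v)) (at z)" if "z \<in> S" for z
      using holomorphic_derivI[OF Suc.prems \<open>open S\<close> that]
      by (simp add: has_field_derivative_def)
    show "Ck_on k S (\<lambda>z. deriv f z * v)" for v
      using Suc by (intro Suc.IH holomorphic_intros) (auto intro: \<open>open S\<close>)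
  qed
qed

lemma Ck_on_cmod_sq: "open S \<Longrightarrow> Ck_on k S (\<lambda>z. (cmod (z - c))\<^sup>2)"
proof -
  assume S: "open S"
  have "Ck_on k S (\<lambda>z. (z - c))"
    by (intro Ck_on_holomorphic[OF S] holomorphic_intros)
  then have "Ck_on k S (\<lambda>z. Re (z - c))" "Ck_on k S (\<lambda>z. Im (z - c))"
    by (auto intro: Ck_on_bounded_linear[OF S bounded_linear_Re]
        Ck_on_bounded_linear[OF S bounded_linear_Im] simp del: minus_complex.sel)
  then have "Ck_on k S (\<lambda>z. Re (z - c) * Re (z - c) + Im (z - c) * Im (z - c))"
    by (intro Ck_on_add Ck_on_mult S)
  then show ?thesis unfolding cmod_power2 power2_eq_square[of "Re _"] power2_eq_square[of "Im _"] .
qed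

section \<open>Harmonic functions\<close>

text \<open>The mean value theorem in direction \<open>u\<close>, applied to the increment of
  \<open>H\<close> in direction \<open>v\<close>, turns the quotient into an increment of the
  \<open>u\<close>-derivative, which the differential \<open>L\<close> at \<open>z\<close>
  evaluates. The quotient is symmetric in \<open>u\<close> and \<open>v\<close>, so its limit yields
  the equality of mixed derivatives.\<close>

lemma second_difference_limit:
  fixes H :: "complex \<Rightarrow> real" and S :: "complex set"
  assumes "open S" "z \<in> S"
    and H: "\<And>y. y \<in> S \<Longrightarrow> (H has_derivative H' y) (at y)"
    and H2: "((\<lambda>y. H' y u) has_derivative L) (at z)"
  shows "((\<lambda>t. (H (z + t *\<^sub>R (u + v)) - H (z + t *\<^sub>R u) - H (z + t *\<^sub>R v) + H z) / t\<^sup>2)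
           \<longlongrightarrow> L v) (at_right 0)"
proof (rule tendstoI)
  fix e :: real assume "e > 0"
  \<comment> \<open>All points z + s u + a v with s, a in [0, t] lie within t M / 2 of z; the
    summand 1 keeps M positive when u = v = 0.\<close>
  define M where "M = 2 * (norm u + norm v) + 1"
  have "M > 0" by (simp add: M_def add_nonneg_pos)
  have linL: "linear L" using H2 has_derivative_linear by blast
  from H2 obtain d where d: "d > 0" "\<And>y. norm (y - z) < d \<Longrightarrow>
      norm (H' y u - H' z u - L (y - z)) \<le> e / (2 * M) * norm (y - z)"
    unfolding has_derivative_at_alt using \<open>e > 0\<close> \<open>M > 0\<close>
    by (metis divide_pos_pos mult_pos_pos zero_less_numeral)
  obtain r where r: "r > 0" "ball z r \<subseteq> S" using assms(1,2) open_contains_ball by blast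
  define \<delta> where "\<delta> = min d r / M"
  have "\<delta> > 0" using d r \<open>M > 0\<close> by (simp add: \<delta>_def)
  have "dist ((H (z + t *\<^sub>R (u + v)) - H (z + t *\<^sub>R u) - H (z + t *\<^sub>R v) + H z) / t\<^sup>2) (L v) < e"
    if t: "0 < t" "t < \<delta>" for t
  proof -
    have tM: "t * M < min d r" using t \<open>M > 0\<close> by (simp add: \<delta>_def field_simps)
    have small: "norm (s *\<^sub>R u + a *\<^sub>R v) \<le> t * (norm u + norm v)"
      if "0 \<le> s" "s \<le> t" "0 \<le> a" "a \<le> t" for s a
    proof -
      have "norm (s *\<^sub>R u + a *\<^sub>R v) \<le> s * norm u + a * norm v"
        using that by (intro order_trans[OF norm_triangle_ineq]) auto
      also have "\<dots> \<le> t * norm u + t * norm v"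
        using that by (intro add_mono mult_right_mono) auto
      finally show ?thesis by (simp add: algebra_simps)
    qed
    have tN: "t * (norm u + norm v) \<le> t * M / 2" "t * M / 2 < min d r"
      using t tM \<open>M > 0\<close> d(1) r(1) by (auto simp: M_def algebra_simps)
    define g where "g s = H (z + s *\<^sub>R u + t *\<^sub>R v) - H (z + s *\<^sub>R u)" for s
    have inS: "z + s *\<^sub>R u + a *\<^sub>R v \<in> S" if "0 \<le> s" "s \<le> t" "0 \<le> a" "a \<le> t" for s a
    proof -
      have "dist (z + (s *\<^sub>R u + a *\<^sub>R v)) z < r"
        using small[OF that] tN unfolding dist_norm by simp
      then have "dist z (z + s *\<^sub>R u + a *\<^sub>R v) < r"
        by (simp only: dist_commute add.assoc)
      then show ?thesis using r(2) by auto
    qed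
    have dg: "(g has_real_derivative H' (z + s *\<^sub>R u + t *\<^sub>R v) u - H' (z + s *\<^sub>R u) u) (at s)"
      if "0 \<le> s" "s \<le> t" for s
    proof -
      have lin: "linear (H' y)" if "y \<in> S" for y using H[OF that] has_derivative_linear by blast
      have 1: "((\<lambda>s. H (z + s *\<^sub>R u + t *\<^sub>R v)) has_derivative (\<lambda>x. H' (z + s *\<^sub>R u + t *\<^sub>R v) (x *\<^sub>R u))) (at s)"
        by (rule has_derivative_compose[where g=H, OF _ H])
          (use t inS[OF that, of t] in \<open>auto intro!: derivative_eq_intros\<close>)
      have 2: "((\<lambda>s. H (z + s *\<^sub>R u)) has_derivative (\<lambda>x. H' (z + s *\<^sub>R u) (x *\<^sub>R u))) (at s)"
        by (rule has_derivative_compose[where g=H, OF _ H])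
          (use t inS[OF that, of 0] in \<open>auto intro!: derivative_eq_intros\<close>)
      show ?thesis
        unfolding g_def has_field_derivative_def
        by (rule has_derivative_eq_rhs[OF has_derivative_diff[OF 1 2]])
          (use inS[OF that, of t] inS[OF that, of 0] t in
            \<open>auto simp: linear_scale[OF lin] algebra_simps fun_eq_iff\<close>)
    qed
    obtain s where s: "0 < s" "s < t" "g t - g 0 = (t - 0) * (H' (z + s *\<^sub>R u + t *\<^sub>R v) u - H' (z + s *\<^sub>R u) u)"
      using MVT2[OF t(1), of g "\<lambda>s. H' (z + s *\<^sub>R u + t *\<^sub>R v) u - H' (z + s *\<^sub>R u) u"] dg by auto
    have b1: "\<bar>H' (z + s *\<^sub>R u + a *\<^sub>R v) u - H' z u - L (s *\<^sub>R u + a *\<^sub>R v)\<bar> \<le> e / (2*M) * (t * (norm u + norm v))"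
      if "0 \<le> a" "a \<le> t" for a
    proof -
      have *: "norm (s *\<^sub>R u + a *\<^sub>R v) \<le> t * (norm u + norm v)" using small that s by auto
      moreover from this have "norm (s *\<^sub>R u + a *\<^sub>R v) < d" using tN by linarith
      ultimately have "\<bar>H' (z + s *\<^sub>R u + a *\<^sub>R v) u - H' z u - L (s *\<^sub>R u + a *\<^sub>R v)\<bar>
          \<le> e / (2*M) * norm (s *\<^sub>R u + a *\<^sub>R v)"
        using d(2)[of "z + s *\<^sub>R u + a *\<^sub>R v"] by (simp add: add.assoc)
      also have "\<dots> \<le> e / (2*M) * (t * (norm u + norm v))"
        using * \<open>e > 0\<close> \<open>M > 0\<close> by (intro mult_left_mono) auto
      finally show ?thesis .
    qed
    have eqL: "L (s *\<^sub>R u + t *\<^sub>R v) - L (s *\<^sub>R u) = t * L v"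
      using linL by (simp add: linear_add linear_scale)
    have "\<bar>(H' (z + s *\<^sub>R u + t *\<^sub>R v) u - H' (z + s *\<^sub>R u) u) - t * L v\<bar> \<le> 2 * (e / (2*M) * (t * (norm u + norm v)))"
    proof -
      have *: "\<bar>a - b - r\<bar> \<le> 2 * K"
        if "\<bar>a - c - l1\<bar> \<le> K" "\<bar>b - c - l2\<bar> \<le> K" "l1 - l2 = r" for a b c l1 l2 r K :: real
        using that by linarith
      show ?thesis by (rule *[OF b1[of t] _ eqL]) (use b1[of 0] t in auto)
    qed
    also have "\<dots> \<le> 2 * (e / (2*M) * (t * M / 2))"
      using tN(1) \<open>e > 0\<close> \<open>M > 0\<close> by (intro mult_left_mono) auto
    also have "\<dots> = t * (e / 2)" using \<open>M > 0\<close> by simp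
    finally have f1: "\<bar>(H' (z + s *\<^sub>R u + t *\<^sub>R v) u - H' (z + s *\<^sub>R u) u) - t * L v\<bar> \<le> t * (e/2)" .
    have "H (z + t *\<^sub>R (u + v)) - H (z + t *\<^sub>R u) - H (z + t *\<^sub>R v) + H z = g t - g 0"
      by (simp add: g_def algebra_simps)
    also have "\<dots> / t\<^sup>2 - L v = ((H' (z + s *\<^sub>R u + t *\<^sub>R v) u - H' (z + s *\<^sub>R u) u) - t * L v) / t"
      unfolding s(3) using t by (simp add: field_simps power2_eq_square)
    finally have eq: "(H (z + t *\<^sub>R (u + v)) - H (z + t *\<^sub>R u) - H (z + t *\<^sub>R v) + H z) / t\<^sup>2 - L v
      = ((H' (z + s *\<^sub>R u + t *\<^sub>R v) u - H' (z + s *\<^sub>R u) u) - t * L v) / t" .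
    show ?thesis unfolding dist_real_def eq abs_divide
      using order.strict_trans1[OF f1, of "t * e"] t \<open>e > 0\<close> by (simp add: divide_simps mult.commute)
  qed
  then show "\<forall>\<^sub>F t in at_right 0. dist ((H (z + t *\<^sub>R (u + v)) - H (z + t *\<^sub>R u) - H (z + t *\<^sub>R v) + H z) / t\<^sup>2) (L v) < e"
    unfolding eventually_at_right_field using \<open>\<delta> > 0\<close> by auto
qed

lemma dirderiv_commute:
  fixes H :: "complex \<Rightarrow> real"
  assumes "open S" "Ck_on 2 S H" "z \<in> S"
  shows "dirderiv v (dirderiv u H) z = dirderiv u (dirderiv v H) z"
proof -
  have 1: "Ck_on (Suc 1) S H" "\<And>v. Ck_on (Suc 0) S (dirderiv v H)"
    using assms(2) by (auto simp: numeral_2_eq_2)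
  note lim = second_difference_limit[OF assms(1,3) Ck_on_has_derivative[OF 1(1)]
      Ck_on_has_derivative[OF 1(2) assms(3)]]
  have "((\<lambda>t. (H (z + t *\<^sub>R (u + v)) - H (z + t *\<^sub>R u) - H (z + t *\<^sub>R v) + H z) / t\<^sup>2)
           \<longlongrightarrow> dirderiv u (dirderiv v H) z) (at_right 0)"
    using lim[of v u] by (simp add: algebra_simps)
  from tendsto_unique[OF _ lim[of u v] this] show ?thesis by simp
qed

text \<open>For p = H_x - i H_y one Cauchy-Riemann equation is the Laplace equation and the other is
  the symmetry of second derivatives. This holomorphic gradient exists globally, whereas a harmonic
  conjugate need not exist on a multiply connected domain.\<close>

lemma harmonic_on_gradient:
  assumes "open S" "harmonic_on S H"
  obtains p where "p holomorphic_on S"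
    "\<And>z. z \<in> S \<Longrightarrow> (H has_derivative (\<lambda>v. Re (p z * v))) (at z)"
proof
  define p where "p z = Complex (dirderiv 1 H z) (- dirderiv \<i> H z)" for z
  have C: "Ck_on (Suc 1) S H" "\<And>v. Ck_on (Suc 0) S (dirderiv v H)" "Ck_on 2 S H"
    using assms(2) by (auto simp: numeral_2_eq_2 harmonic_on_def)
  have decomp: "L v = Re v * L 1 + Im v * L \<i>" if "linear L" for L :: "complex \<Rightarrow> real" and v
  proof -
    have "v = Re v *\<^sub>R 1 + Im v *\<^sub>R \<i>" by (simp add: complex_eq_iff)
    then have "L v = L (Re v *\<^sub>R 1 + Im v *\<^sub>R \<i>)" by (rule arg_cong)
    then show ?thesis using that by (simp only: linear_add linear_scale real_scaleR_def)
  qed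
  show "(H has_derivative (\<lambda>v. Re (p z * v))) (at z)" if "z \<in> S" for z
  proof (rule has_derivative_eq_rhs[OF Ck_on_has_derivative[OF C(1) that]])
    have "linear (\<lambda>v. dirderiv v H z)"
      using Ck_on_has_derivative[OF C(1) that] has_derivative_linear by blast
    show "(\<lambda>v. dirderiv v H z) = (\<lambda>v. Re (p z * v))"
    proof
      show "dirderiv v H z = Re (p z * v)" for v
        by (subst decomp[OF \<open>linear _\<close>]) (simp add: p_def mult.commute)
    qed
  qed
  show "p holomorphic_on S"
  proof (rule holomorphic_onI)
    fix z assume z: "z \<in> S"
    let ?a = "dirderiv 1 (dirderiv 1 H) z" and ?b = "dirderiv \<i> (dirderiv 1 H) z"
    have lap: "dirderiv \<i> (dirderiv \<i> H) z = - ?a" "dirderiv 1 (dirderiv \<i> H) z = ?b"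
      using assms(2) z dirderiv_commute[OF assms(1) C(3) z] by (auto simp: harmonic_on_def)
    have d: "(dirderiv u H has_derivative (\<lambda>v. dirderiv v (dirderiv u H) z)) (at z)" for u
      by (rule Ck_on_has_derivative[OF C(2) z])
    have lin: "linear (\<lambda>v. dirderiv v (dirderiv u H) z)" for u
      using d has_derivative_linear by blast
    have "((\<lambda>z. of_real (dirderiv 1 H z) - \<i> * of_real (dirderiv \<i> H z)) has_derivative
      (\<lambda>v. of_real (dirderiv v (dirderiv 1 H) z) - \<i> * of_real (dirderiv v (dirderiv \<i> H) z))) (at z)"
      by (intro derivative_intros d)
    moreover have "(\<lambda>v. of_real (dirderiv v (dirderiv 1 H) z) - \<i> * of_real (dirderiv v (dirderiv \<i> H) z))
      = (*) (Complex ?a (- ?b))"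
    proof
      fix v
      have e1: "dirderiv v (dirderiv 1 H) z = Re v * ?a + Im v * ?b"
        by (rule decomp[OF lin])
      have e2: "dirderiv v (dirderiv \<i> H) z = Re v * ?b - Im v * ?a"
        by (subst decomp[OF lin]) (simp only: lap mult_minus_right diff_conv_add_uminus)
      show "of_real (dirderiv v (dirderiv 1 H) z) - \<i> * of_real (dirderiv v (dirderiv \<i> H) z) = Complex ?a (- ?b) * v"
        unfolding e1 e2 by (simp add: complex_eq_iff mult.commute)
    qed
    moreover have "p = (\<lambda>z. of_real (dirderiv 1 H z) - \<i> * of_real (dirderiv \<i> H z))"
      unfolding p_def[abs_def] by (rule ext) (simp add: complex_eq_iff)
    ultimately have "(p has_field_derivative Complex ?a (- ?b)) (at z)"
      unfolding has_field_derivative_def by simp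
    then show "p field_differentiable at z within S"
      by (metis field_differentiable_at_within field_differentiable_def)
  qed
qed

text \<open>Every directional derivative of \<open>H\<close> is the real part of a holomorphic
  function, so the regularity of holomorphic functions is inherited.\<close>

lemma Ck_on_harmonic:
  assumes "open S" "p holomorphic_on S"
    and H: "\<And>z. z \<in> S \<Longrightarrow> (H has_derivative (\<lambda>v. Re (p z * v))) (at z)"
  shows "Ck_on k S H"
proof -
  have "Ck_on (Suc k) S H"
    by (rule Ck_on_SucI[OF \<open>open S\<close> H])
      (auto intro!: Ck_on_bounded_linear[OF assms(1) bounded_linear_Re]
        Ck_on_holomorphic holomorphic_intros assms(1,2) simp del: times_complex.sel)
  then show ?thesis by (rule Ck_on_Suc_imp)
qed

section \<open>Integration by parts for the Cauchy-Riemann operator\<close>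

lemma integrable_compact_support:
  fixes f :: "complex \<Rightarrow> 'b::{banach, second_countable_topology}"
  assumes "compact K" "continuous_on K f" "\<And>z. z \<notin> K \<Longrightarrow> f z = 0"
  shows "integrable lborel f"
proof -
  have "(\<lambda>x. indicator K x *\<^sub>R f x) = f"
    using assms(3) by (auto simp: indicator_def fun_eq_iff)
  then show ?thesis using borel_integrable_compact[OF assms(1,2)] by simp
qed

lemma integrable_bounded_mult:
  fixes V g :: "complex \<Rightarrow> complex"
  assumes "integrable lborel V" "g \<in> borel_measurable borel" "\<And>z. cmod (g z) \<le> B"
  shows "integrable lborel (\<lambda>z. g z * V z)"
proof (rule Bochner_Integration.integrable_bound)
  show "integrable lborel (\<lambda>z. B * norm (V z))" using assms(1) by auto
  show "(\<lambda>z. g z * V z) \<in> borel_measurable lborel"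
    using assms by measurable
  show "AE z in lborel. norm (g z * V z) \<le> norm (B * norm (V z))"
  proof (intro AE_I2)
    fix z
    have "0 \<le> B" using assms(3)[of z] norm_ge_zero order_trans by blast
    then show "norm (g z * V z) \<le> norm (B * norm (V z))"
      using assms(3)[of z] by (simp add: norm_mult mult_right_mono)
  qed
qed

lemma continuous_compact_support_bounded:
  fixes f :: "complex \<Rightarrow> 'b::real_normed_vector"
  assumes "compact K" "continuous_on K f" "\<And>z. z \<notin> K \<Longrightarrow> f z = 0"
  obtains B where "B > 0" "\<And>z. norm (f z) \<le> B"
proof -
  have "bounded (f ` K)" by (intro compact_imp_bounded compact_continuous_image assms)
  then obtain B where B: "B > 0" "\<And>z. z \<in> K \<Longrightarrow> norm (f z) \<le> B"
    unfolding bounded_pos by auto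
  then have "norm (f z) \<le> B" for z using assms(3)[of z] by (cases "z \<in> K") auto
  with B(1) show ?thesis using that by blast
qed

lemma lborel_integral_translate:
  fixes f :: "complex \<Rightarrow> 'b::{banach, second_countable_topology}"
  assumes "f \<in> borel_measurable borel"
  shows "(\<integral>z. f (c + z) \<partial>lborel) = (\<integral>z. f z \<partial>lborel)"
proof -
  have "(\<integral>z. f z \<partial>lborel) = (\<integral>z. f z \<partial>distr lborel borel ((+) c))"
    by (simp add: lborel_distr_plus)
  also have "\<dots> = (\<integral>z. f (c + z) \<partial>lborel)"
    using assms by (intro integral_distr) auto
  finally show ?thesis by simp
qed

lemma has_derivative_zero_outside:
  fixes f :: "complex \<Rightarrow> 'b::real_normed_vector"
  assumes "closed K" "\<And>z. z \<notin> K \<Longrightarrow> f z = 0" "z \<notin> K"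
  shows "(f has_derivative (\<lambda>_. 0)) (at z)"
  by (rule has_derivative_transform_within_open[OF has_derivative_const[of 0], of "- K"])
    (use assms in auto)

text \<open>By translation invariance all difference quotients of \<open>g\<close> have integral zero.\<close>

lemma integral_derivative_compact_support:
  fixes g :: "complex \<Rightarrow> complex"
  assumes g: "\<And>z. (g has_derivative g' z) (at z)" and cont: "continuous_on UNIV (\<lambda>z. g' z v)"
    and K: "compact K" "\<And>z. z \<notin> K \<Longrightarrow> g z = 0"
  shows "(\<integral>z. g' z v \<partial>lborel) = 0"
proof -
  have g'0: "g' z v = 0" if "z \<notin> K" for z
    using has_derivative_unique[OF g has_derivative_zero_outside[OF compact_imp_closed[OF K(1)] K(2) that]]
    by simp
  obtain B where B: "B > 0" "\<And>z. norm (g' z v) \<le> B"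
    using continuous_compact_support_bounded[OF K(1) continuous_on_subset[OF cont], of] g'0 by auto
  obtain R where R: "R > 0" "K \<subseteq> cball 0 R"
    using compact_imp_bounded[OF K(1)] unfolding bounded_pos by (auto simp: subset_iff)
  have contg: "continuous_on UNIV g"
    by (intro continuous_at_imp_continuous_on ballI has_derivative_continuous[OF g])
  have [measurable]: "g \<in> borel_measurable borel"
    using contg by (rule borel_measurable_continuous_onI)
  have [measurable]: "(\<lambda>z. g' z v) \<in> borel_measurable borel"
    using cont by (rule borel_measurable_continuous_onI)
  have ig: "integrable lborel g"
    by (rule integrable_compact_support[OF K(1) continuous_on_subset[OF contg]]) (use K in auto)
  have igc: "integrable lborel (\<lambda>z. g (c + z))" for c
  proof -
    have "integrable (distr lborel borel ((+) c)) g" using ig by (simp add: lborel_distr_plus)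
    then show ?thesis by (subst (asm) integrable_distr_eq) auto
  qed
  define t :: "nat \<Rightarrow> real" where "t n = 1 / real (Suc n)" for n
  have t: "0 < t n" "t n \<le> 1" for n by (auto simp: t_def)
  define q where "q n z = (g (t n *\<^sub>R v + z) - g z) /\<^sub>R t n" for n z
  have [measurable]: "q n \<in> borel_measurable borel" for n
    unfolding q_def by measurable
  have int_q: "(\<integral>z. q n z \<partial>lborel) = 0" for n
    unfolding q_def by (simp add: Bochner_Integration.integral_diff[OF igc ig] lborel_integral_translate)
  have lim: "(\<lambda>n. q n z) \<longlonglongrightarrow> g' z v" for z
  proof -
    have "((\<lambda>s. g (s *\<^sub>R v + z)) has_derivative (\<lambda>s. s *\<^sub>R g' z v)) (at 0)"
    proof (rule has_derivative_eq_rhs)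
      show "((\<lambda>s. g (s *\<^sub>R v + z)) has_derivative (\<lambda>s. g' z (s *\<^sub>R v))) (at 0)"
        by (rule has_derivative_compose[where g=g]) (auto intro!: derivative_eq_intros g)
      show "(\<lambda>s. g' z (s *\<^sub>R v)) = (\<lambda>h. h *\<^sub>R g' z v)"
        using has_derivative_linear[OF g] by (auto simp: linear_scale)
    qed
    then have "((\<lambda>s. norm (g (s *\<^sub>R v + z) - g z - s *\<^sub>R g' z v) / norm s) \<longlongrightarrow> 0) (at 0)"
      by (simp add: has_derivative_at)
    then have "((\<lambda>s. norm ((g (s *\<^sub>R v + z) - g z) /\<^sub>R s - g' z v)) \<longlongrightarrow> 0) (at 0)"
    proof (rule Lim_transform_eventually)
      have "norm (x - s *\<^sub>R y) / norm s = norm (x /\<^sub>R s - y)" if "s \<noteq> 0" for x y :: complex and s :: real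
      proof -
        have "x - s *\<^sub>R y = s *\<^sub>R (x /\<^sub>R s - y)" using that by (simp add: scaleR_diff_right)
        then show ?thesis using that by simp
      qed
      then show "\<forall>\<^sub>F s in at 0. norm (g (s *\<^sub>R v + z) - g z - s *\<^sub>R g' z v) / norm s
          = norm ((g (s *\<^sub>R v + z) - g z) /\<^sub>R s - g' z v)"
        by (auto simp: eventually_at_filter)
    qed
    then have "((\<lambda>s. (g (s *\<^sub>R v + z) - g z) /\<^sub>R s) \<longlongrightarrow> g' z v) (at 0)"
      unfolding tendsto_norm_zero_iff LIM_zero_iff .
    moreover have "filterlim t (at 0) sequentially"
      unfolding filterlim_at using LIMSEQ_inverse_real_of_nat
      by (auto simp: t_def[abs_def] inverse_eq_divide)
    ultimately show ?thesis unfolding q_def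
      by (rule filterlim_compose)
  qed
  \<comment> \<open>Dominating function for the difference quotients: the mean value inequality
    inside the large disc; outside it the steps \<open>t n\<close> \<le> 1 cannot carry z into the
    support.\<close>
  have bound: "norm (q n z) \<le> indicator (cball 0 (R + norm v)) z * B" for n z
  proof (cases "z \<in> cball 0 (R + norm v)")
    case True
    have "\<exists>x\<in>{0<..<t n}. norm (g (t n *\<^sub>R v + z) - g (0 *\<^sub>R v + z)) \<le> norm (g' (x *\<^sub>R v + z) ((t n - 0) *\<^sub>R v))"
    proof (rule mvt_general[OF t(1), of _ "\<lambda>s. g (s *\<^sub>R v + z)" "\<lambda>x y. g' (x *\<^sub>R v + z) (y *\<^sub>R v)"])
      show "continuous_on {0..t n} (\<lambda>s. g (s *\<^sub>R v + z))"
        by (intro continuous_on_compose2[OF contg] continuous_intros) auto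
      show "((\<lambda>s. g (s *\<^sub>R v + z)) has_derivative (\<lambda>y. g' (x *\<^sub>R v + z) (y *\<^sub>R v))) (at x)" for x
        by (rule has_derivative_compose[where g=g]) (auto intro!: derivative_eq_intros g)
    qed
    then obtain x where "norm (g (t n *\<^sub>R v + z) - g z) \<le> norm (g' (x *\<^sub>R v + z) (t n *\<^sub>R v))"
      by auto
    also have "\<dots> = t n * norm (g' (x *\<^sub>R v + z) v)"
      using has_derivative_linear[OF g] t[of n] by (simp add: linear_scale)
    also have "\<dots> \<le> t n * B" using B t[of n] by (intro mult_left_mono) auto
    finally show ?thesis using True t[of n] by (simp add: q_def divide_simps mult.commute)
  next
    case False
    then have "norm z > R + norm v" by simp
    moreover have "norm z \<le> norm (t n *\<^sub>R v + z) + norm (t n *\<^sub>R v)"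
      using norm_triangle_ineq4[of "t n *\<^sub>R v + z" "t n *\<^sub>R v"] by simp
    moreover have "norm (t n *\<^sub>R v) \<le> norm v" using t[of n] by (simp add: mult_left_le_one_le)
    ultimately have "norm z > R" "norm (t n *\<^sub>R v + z) > R" using norm_ge_zero[of v] by linarith+
    then have "z \<notin> K" "t n *\<^sub>R v + z \<notin> K" using R(2) by auto
    then show ?thesis using False K(2) by (simp add: q_def)
  qed
  have "(\<lambda>n. \<integral>z. q n z \<partial>lborel) \<longlonglongrightarrow> (\<integral>z. g' z v \<partial>lborel)"
    by (rule integral_dominated_convergence[where w="\<lambda>z. indicator (cball 0 (R + norm v)) z * B"])
      (use lim bound in \<open>auto intro!: integrable_mult_left integrable_real_indicator simp: emeasure_lborel_cball_finite[unfolded infinity_ennreal_def]\<close>)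
  then show ?thesis by (simp add: int_q LIMSEQ_const_iff)
qed

lemma wirtinger_eqI:
  assumes "(f has_derivative (\<lambda>v. A * v + B * cnj v)) (at z)"
  shows "d_z f z = A" "d_zbar f z = B"
  unfolding d_z_def d_zbar_def dirderiv_eq[OF assms]
  by (simp_all add: complex_eq_iff)

lemma has_derivative_wirtinger:
  assumes "f differentiable (at z)"
  shows "(f has_derivative (\<lambda>v. d_z f z * v + d_zbar f z * cnj v)) (at z)"
proof -
  have d: "(f has_derivative (\<lambda>v. dirderiv v f z)) (at z)"
    using assms by (simp add: frechet_derivative_works)
  have "linear (\<lambda>v. dirderiv v f z)" using d has_derivative_linear by blast
  then have lin: "L v = Re v *\<^sub>R L 1 + Im v *\<^sub>R L \<i>" if "L = (\<lambda>v. dirderiv v f z)" for v L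
  proof -
    have "v = Re v *\<^sub>R 1 + Im v *\<^sub>R \<i>" by (simp add: complex_eq_iff)
    then have "L v = L (Re v *\<^sub>R 1 + Im v *\<^sub>R \<i>)" by (rule arg_cong)
    with \<open>linear _\<close> that show ?thesis by (simp only: linear_add linear_scale)
  qed
  have "(\<lambda>v. dirderiv v f z) = (\<lambda>v. d_z f z * v + d_zbar f z * cnj v)"
  proof
    show "dirderiv v f z = d_z f z * v + d_zbar f z * cnj v" for v
      unfolding d_z_def d_zbar_def by (subst lin[OF refl]) (simp add: complex_eq_iff field_simps)
  qed
  then show ?thesis using d by simp
qed

lemma has_derivative_wirtinger_mult:
  assumes "(f has_derivative (\<lambda>v. A * v + B * cnj v)) (at z)"
    and "(g has_derivative (\<lambda>v. A' * v + B' * cnj v)) (at z)"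
  shows "((\<lambda>z. f z * g z) has_derivative
    (\<lambda>v. (f z * A' + A * g z) * v + (f z * B' + B * g z) * cnj v)) (at z)"
  by (rule has_derivative_eq_rhs[OF has_derivative_mult[OF assms]])
    (simp add: fun_eq_iff algebra_simps)

text \<open>The derivatives in directions 1 and i have integral zero, so the integrals of A + B and
  of i (A - B) vanish, and with them that of B. On S - K both coefficients are zero, so their
  extensions by zero are continuous on the plane.\<close>

lemma dbar_integral_zero:
  assumes "open S" "compact K" "K \<subseteq> S"
    and f: "\<And>z. z \<in> S \<Longrightarrow> (f has_derivative (\<lambda>v. A z * v + B z * cnj v)) (at z)"
    and A: "continuous_on S A" and B: "continuous_on S B"
    and f0: "\<And>z. z \<notin> K \<Longrightarrow> f z = 0"
  shows "(\<integral>z. (if z \<in> S then B z else 0) \<partial>lborel) = 0"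
proof -
  have "closed K" using assms(2) by (rule compact_imp_closed)
  have zero: "A z = 0" "B z = 0" if "z \<in> S" "z \<notin> K" for z
  proof -
    have "(f has_derivative (\<lambda>v. 0 * v + 0 * cnj v)) (at z)"
      using has_derivative_zero_outside[OF \<open>closed K\<close> f0 that(2)] by simp
    from wirtinger_eqI[OF this] wirtinger_eqI[OF f[OF that(1)]] show "A z = 0" "B z = 0" by auto
  qed
  define A' where "A' z = (if z \<in> S then A z else 0)" for z
  define B' where "B' z = (if z \<in> S then B z else 0)" for z
  have f': "(f has_derivative (\<lambda>v. A' z * v + B' z * cnj v)) (at z)" for z
  proof (cases "z \<in> S")
    case False
    then show ?thesis using has_derivative_zero_outside[where f=f, OF \<open>closed K\<close> f0, of z] assms(3)
      by (auto simp: A'_def B'_def)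
  qed (auto simp: A'_def B'_def f)
  have cont: "continuous_on UNIV (\<lambda>z. if z \<in> S then C z else 0)"
    if "continuous_on S C" "\<And>z. z \<in> S \<Longrightarrow> z \<notin> K \<Longrightarrow> C z = 0" for C :: "complex \<Rightarrow> complex"
  proof -
    have "continuous_on (S \<union> - K) (\<lambda>z. if z \<in> S then C z else 0)"
    proof (rule continuous_on_open_Un)
      show "continuous_on S (\<lambda>z. if z \<in> S then C z else 0)"
        using that(1) by (simp cong: continuous_on_cong)
      have "continuous_on (- K) (\<lambda>z. 0 :: complex)" by simp
      then show "continuous_on (- K) (\<lambda>z. if z \<in> S then C z else 0)"
        by (rule continuous_on_eq) (use that(2) in auto)
    qed (use assms \<open>closed K\<close> in auto)
    moreover have "S \<union> - K = UNIV" using assms(3) by auto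
    ultimately show ?thesis by simp
  qed
  have cA: "continuous_on UNIV A'" and cB: "continuous_on UNIV B'"
    unfolding A'_def B'_def using cont[OF A] cont[OF B] zero by auto
  have "(\<integral>z. A' z * 1 + B' z * cnj 1 \<partial>lborel) = 0"
    by (rule integral_derivative_compact_support[OF f' _ assms(2) f0])
      (auto intro!: continuous_intros cA cB)
  moreover have "(\<integral>z. A' z * \<i> + B' z * cnj \<i> \<partial>lborel) = 0"
    by (rule integral_derivative_compact_support[OF f' _ assms(2) f0])
      (auto intro!: continuous_intros cA cB)
  moreover have "integrable lborel A'" "integrable lborel B'"
    by (rule integrable_compact_support[OF assms(2)];
      use cA cB zero in \<open>auto simp: A'_def B'_def intro: continuous_on_subset\<close>)+
  ultimately have "integral\<^sup>L lborel A' + integral\<^sup>L lborel B' = 0"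
    "integral\<^sup>L lborel A' * \<i> - integral\<^sup>L lborel B' * \<i> = 0" by simp_all
  then have "integral\<^sup>L lborel B' = 0"
  proof -
    have "(integral\<^sup>L lborel A' - integral\<^sup>L lborel B') * \<i> = 0"
      using \<open>_ * \<i> - _ = 0\<close> by (simp add: left_diff_distrib)
    then have "integral\<^sup>L lborel A' = integral\<^sup>L lborel B'" by simp
    with \<open>_ + _ = 0\<close> show ?thesis by simp
  qed
  then show ?thesis by (simp add: B'_def[abs_def])
qed

section \<open>Smooth bump functions\<close>

lemma poly_times_exp_tendsto_0:
  fixes P :: "real poly"
  shows "((\<lambda>x. poly P x * x ^ k / exp x) \<longlongrightarrow> 0) at_top"
proof (induction P arbitrary: k)
  case (pCons a P)
  have "((\<lambda>x. a * (x ^ k / exp x) + poly P x * x ^ Suc k / exp x) \<longlongrightarrow> a * 0 + 0) at_top"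
    by (rule tendsto_add[OF tendsto_mult[OF tendsto_const tendsto_power_div_exp_0] pCons.IH])
  moreover have "a * (x ^ k / exp x) + poly P x * x ^ Suc k / exp x = poly (pCons a P) x * x ^ k / exp x" for x
    by (simp add: algebra_simps add_divide_distrib)
  ultimately show ?case by simp
qed simp

text \<open>The functions P (1 / x) exp (- 1 / x), extended by 0, are closed under differentiation:
  with y = 1 / x the polynomial P is replaced by y^2 (P - P').\<close>

definition flat_poly :: "real poly \<Rightarrow> real \<Rightarrow> real" where
  "flat_poly P x = (if x > 0 then poly P (1 / x) * exp (- (1 / x)) else 0)"

text \<open>The n-th derivative of exp (- 1 / x), extended by 0, as a sequence in the shape that
  \<open>Ck_on_compose_real\<close> expects.\<close>

definition flat :: "nat \<Rightarrow> real \<Rightarrow> real" where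
  "flat n = flat_poly (((\<lambda>P. [:0, 0, 1:] * (P - pderiv P)) ^^ n) 1)"

lemma DERIV_flat_poly:
  "(flat_poly P has_real_derivative flat_poly ([:0, 0, 1:] * (P - pderiv P)) x) (at x)"
proof -
  consider "x > 0" | "x < 0" | "x = 0" by linarith
  then show ?thesis
  proof cases
    case 1
    have "((\<lambda>x. poly P (1 / x) * exp (- (1 / x))) has_real_derivative
        flat_poly ([:0, 0, 1:] * (P - pderiv P)) x) (at x)"
      using 1 by (auto intro!: derivative_eq_intros DERIV_chain2[OF poly_DERIV]
        simp: flat_poly_def field_simps power2_eq_square)
    moreover have "eventually (\<lambda>y. flat_poly P y = poly P (1 / y) * exp (- (1 / y))) (nhds x)"
      using 1 by (auto simp: flat_poly_def eventually_nhds intro!: exI[of _ "{0<..}"])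
    ultimately show ?thesis by (subst DERIV_cong_ev[OF refl _ refl])
  next
    case 2
    have "eventually (\<lambda>y. flat_poly P y = 0) (nhds x)"
      using 2 by (auto simp: flat_poly_def eventually_nhds intro!: exI[of _ "{..<0}"])
    then show ?thesis using 2 by (subst DERIV_cong_ev[OF refl _ refl]) (auto simp: flat_poly_def)
  next
    case 3
    have "((\<lambda>h. flat_poly P h / h) \<longlongrightarrow> 0) (at_right 0)"
    proof -
      have "((\<lambda>h. poly P (inverse h) * inverse h ^ 1 / exp (inverse h)) \<longlongrightarrow> 0) (at_right 0)"
        by (rule filterlim_compose[OF poly_times_exp_tendsto_0 filterlim_inverse_at_top_right])
      moreover have "eventually (\<lambda>h. poly P (inverse h) * inverse h ^ 1 / exp (inverse h) = flat_poly P h / h) (at_right (0::real))"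
        unfolding eventually_at_right_field
        by (rule exI[of _ 1]) (auto simp: flat_poly_def field_simps exp_minus)
      ultimately show ?thesis by (rule Lim_transform_eventually)
    qed
    moreover have "((\<lambda>h. flat_poly P h / h) \<longlongrightarrow> 0) (at_left 0)"
      by (rule Lim_transform_eventually[of "\<lambda>_. 0"])
        (auto simp: flat_poly_def eventually_at_left_field intro!: exI[of _ "-1"])
    ultimately have "((\<lambda>h. flat_poly P h / h) \<longlongrightarrow> 0) (at 0)"
      by (simp add: filterlim_split_at)
    then show ?thesis using 3 by (simp add: DERIV_def flat_poly_def)
  qed
qed

lemma DERIV_flat: "(flat n has_real_derivative flat (Suc n) x) (at x)"
  using DERIV_flat_poly by (simp add: flat_def)

lemma flat_eq_0: "x \<le> 0 \<Longrightarrow> flat n x = 0"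
  by (simp add: flat_def flat_poly_def)

lemma flat_1_pos: "x > 0 \<Longrightarrow> flat 1 x > 0"
  by (simp add: flat_def flat_poly_def)

lemma flat_1_nonneg: "flat 1 x \<ge> 0"
  using flat_1_pos[of x] flat_eq_0[of x 1] by fastforce

lemma continuous_on_flat [continuous_intros]:
  "continuous_on S u \<Longrightarrow> continuous_on S (\<lambda>x. flat n (u x))"
  by (rule continuous_on_compose2[of UNIV "flat n"])
    (auto intro!: continuous_at_imp_continuous_on DERIV_isCont DERIV_flat)

text \<open>Built from \<open>flat 1\<close> and not from \<open>flat 0\<close>, so that the radial
  profile has the explicit primitive \<open>flat 0\<close>, which drives
  \<open>bump_mean_value\<close>. The bump is not normalized; \<open>bump_mass\<close> records its
  integral.\<close>

definition bump :: "real \<Rightarrow> complex \<Rightarrow> real" where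
  "bump e y = flat 1 (e\<^sup>2 - (cmod y)\<^sup>2)"

definition bump_grad :: "real \<Rightarrow> complex \<Rightarrow> complex" where
  "bump_grad e y = (- 2 * flat 2 (e\<^sup>2 - (cmod y)\<^sup>2)) *\<^sub>R y"

lemma has_derivative_flat_cmod:
  "((\<lambda>y. flat n (c - (cmod (y - z))\<^sup>2)) has_derivative
     (\<lambda>h. (- 2 * flat (Suc n) (c - (cmod (y - z))\<^sup>2)) *\<^sub>R (y - z) \<bullet> h)) (at y)"
proof -
  have "((\<lambda>y. c - (y - z) \<bullet> (y - z)) has_derivative (\<lambda>h. - 2 * ((y - z) \<bullet> h))) (at y)"
    by (auto intro!: derivative_eq_intros simp: inner_commute)
  from has_derivative_compose[OF this DERIV_flat[unfolded has_field_derivative_def]]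
  have "((\<lambda>y. flat n (c - (y - z) \<bullet> (y - z))) has_derivative
      (\<lambda>h. flat (Suc n) (c - (y - z) \<bullet> (y - z)) * (- 2 * ((y - z) \<bullet> h)))) (at y)"
    by simp
  then show ?thesis by (simp add: power2_norm_eq_inner algebra_simps)
qed

lemma has_derivative_bump: "(bump e has_derivative (\<lambda>h. bump_grad e y \<bullet> h)) (at y)"
  using has_derivative_flat_cmod[of 1 "e\<^sup>2" 0 y]
  by (simp add: bump_def[abs_def] bump_grad_def numeral_2_eq_2)

lemma bump_nonneg: "bump e y \<ge> 0" unfolding bump_def by (rule flat_1_nonneg)

lemma bump_minus: "bump e (x - y) = bump e (y - x)"
  by (simp add: bump_def norm_minus_commute)

lemma bump_eq_0: "0 \<le> e \<Longrightarrow> y \<notin> cball 0 e \<Longrightarrow> bump e y = 0"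
  unfolding bump_def by (rule flat_eq_0) (use power_mono[of e "cmod y" 2] in auto)

lemma bump_grad_eq_0: "0 \<le> e \<Longrightarrow> y \<notin> cball 0 e \<Longrightarrow> bump_grad e y = 0"
  unfolding bump_grad_def by (subst flat_eq_0) (use power_mono[of e "cmod y" 2] in auto)

lemma continuous_on_bump [continuous_intros]:
  "continuous_on S u \<Longrightarrow> continuous_on S (\<lambda>x. bump e (u x))"
  unfolding bump_def by (intro continuous_intros)

lemma continuous_on_bump_grad [continuous_intros]:
  "continuous_on S u \<Longrightarrow> continuous_on S (\<lambda>x. bump_grad e (u x))"
  unfolding bump_grad_def by (intro continuous_intros)

lemma borel_measurable_bump [measurable]: "bump e \<in> borel_measurable borel"
  by (intro borel_measurable_continuous_onI continuous_intros)

lemma borel_measurable_bump_grad [measurable]: "bump_grad e \<in> borel_measurable borel"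
  by (intro borel_measurable_continuous_onI continuous_intros)

lemma integrable_bump: "0 \<le> e \<Longrightarrow> integrable lborel (\<lambda>y. bump e (z - y))"
  by (rule integrable_compact_support[of "cball z e"])
    (auto intro!: continuous_intros bump_eq_0 simp: dist_norm norm_minus_commute)

definition bump_mass :: "real \<Rightarrow> real" where
  "bump_mass e = (\<integral>y. bump e y \<partial>lborel)"

lemma integral_bump: "(\<integral>y. bump e (z - y) \<partial>lborel) = bump_mass e"
proof -
  have "(\<integral>y. bump e (z - y) \<partial>lborel) = (\<integral>y. bump e (- z + y) \<partial>lborel)"
    by (simp add: bump_minus[of e z])
  also have "\<dots> = bump_mass e"
    unfolding bump_mass_def by (rule lborel_integral_translate) simp
  finally show ?thesis .
qed

lemma bump_mass_pos: "e > 0 \<Longrightarrow> bump_mass e > 0"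
proof -
  assume e: "e > 0"
  have i: "integrable lborel (bump e)" by (rule integrable_compact_support[of "cball 0 e"])
      (use e in \<open>auto intro!: continuous_intros bump_eq_0\<close>)
  have "\<not> (AE y in lborel. bump e y = 0)"
  proof
    assume "AE y in lborel. bump e y = 0"
    then obtain N where N: "{y. bump e y \<noteq> 0} \<subseteq> N" "N \<in> null_sets lborel"
      by (auto elim!: AE_E simp: null_sets_def)
    have "ball 0 e \<subseteq> {y. bump e y \<noteq> 0}"
    proof
      fix y :: complex assume "y \<in> ball 0 e"
      then have "(cmod y)\<^sup>2 < e\<^sup>2" by (simp add: power_strict_mono)
      then show "y \<in> {y. bump e y \<noteq> 0}" using flat_1_pos[of "e\<^sup>2 - (cmod y)\<^sup>2"] by (simp add: bump_def)
    qed
    moreover have "negligible N"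
      using N(2) by (simp add: negligible_iff_null_sets null_sets_completionI)
    ultimately have "negligible (ball (0::complex) e)"
      using N(1) negligible_subset by blast
    with e show False using open_not_negligible[of "ball (0::complex) e"] by auto
  qed
  then have "bump_mass e \<noteq> 0"
    unfolding bump_mass_def using integral_nonneg_eq_0_iff_AE[OF i] bump_nonneg by auto
  moreover have "bump_mass e \<ge> 0" unfolding bump_mass_def by (simp add: bump_nonneg)
  ultimately show ?thesis by simp
qed

text \<open>No polar coordinates are needed: away from \<open>z\<close>, \<open>bump e (x - z) (g x - g z)\<close> is the
  Cauchy-Riemann derivative of a compactly supported function, since \<open>flat 0\<close> is a primitive of
  \<open>flat 1\<close> and \<open>(g x - g z) / (x - z)\<close> is holomorphic.\<close>

lemma bump_mean_value:
  fixes g :: "complex \<Rightarrow> complex"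
  assumes "open S" "g holomorphic_on S" "0 < e" "cball z e \<subseteq> S"
  shows "(\<integral>x. bump e (z - x) * g x \<partial>lborel) = bump_mass e * g z"
proof -
  define q where "q x = (if x = z then deriv g z else (g x - g z) / (x - z))" for x
  have zS: "z \<in> S" using assms(3,4) by auto
  have q: "q holomorphic_on S"
    unfolding q_def[abs_def] by (rule pole_lemma_open[OF assms(2,1)])
  define f where "f x = complex_of_real (flat 0 (e\<^sup>2 - (cmod (x - z))\<^sup>2)) * q x" for x
  let ?c = "\<lambda>n x. complex_of_real (flat n (e\<^sup>2 - (cmod (x - z))\<^sup>2))"
  define A where "A x = ?c 0 x * deriv q x + (- ?c 1 x * cnj (x - z)) * q x" for x
  define B where "B x = ?c 0 x * 0 + (- ?c 1 x * (x - z)) * q x" for x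
  have outside: "?c n x = 0" if "x \<notin> cball z e" for n x
    using that assms(3) power_mono[of e "cmod (x - z)" 2]
    by (auto intro!: flat_eq_0 simp: dist_norm norm_minus_commute)
  have "(\<integral>x. (if x \<in> S then B x else 0) \<partial>lborel) = 0"
  proof (rule dbar_integral_zero[OF assms(1) compact_cball assms(4)])
    fix x assume x: "x \<in> S"
    have 1: "(q has_derivative (\<lambda>v. deriv q x * v + 0 * cnj v)) (at x)"
      using holomorphic_derivI[OF q assms(1) x] by (simp add: has_field_derivative_def)
    have 2: "(?c 0 has_derivative (\<lambda>v. (- ?c 1 x * cnj (x - z)) * v + (- ?c 1 x * (x - z)) * cnj v)) (at x)"
    proof (rule has_derivative_eq_rhs[OF has_derivative_of_real[OF has_derivative_flat_cmod]])
      show "(\<lambda>h. complex_of_real ((- 2 * flat (Suc 0) (e\<^sup>2 - (cmod (x - z))\<^sup>2)) *\<^sub>R (x - z) \<bullet> h))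
        = (\<lambda>v. (- ?c 1 x * cnj (x - z)) * v + (- ?c 1 x * (x - z)) * cnj v)"
        by (rule ext) (simp add: complex_eq_iff inner_complex_def algebra_simps)
    qed
    show "(f has_derivative (\<lambda>v. A x * v + B x * cnj v)) (at x)"
      unfolding f_def[abs_def] A_def B_def by (rule has_derivative_wirtinger_mult[OF 2 1])
  next
    have "continuous_on S q" "continuous_on S (deriv q)"
      using q assms(1) by (auto intro!: holomorphic_on_imp_continuous_on holomorphic_deriv)
    then show "continuous_on S A" "continuous_on S B"
      unfolding A_def B_def by (auto intro!: continuous_intros)
  next
    show "f x = 0" if "x \<notin> cball z e" for x using outside[OF that] by (simp add: f_def)
  qed
  also have "(\<lambda>x. if x \<in> S then B x else 0) = (\<lambda>x. bump e (z - x) * g z - bump e (z - x) * g x)"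
  proof
    fix x
    show "(if x \<in> S then B x else 0) = bump e (z - x) * g z - bump e (z - x) * g x"
    proof (cases "x \<in> S")
      case True
      have "B x = - ?c 1 x * ((x - z) * q x)" by (simp add: B_def)
      also have "(x - z) * q x = g x - g z" by (simp add: q_def)
      also have "?c 1 x = bump e (z - x)" by (simp only: bump_minus[of e z]) (simp only: bump_def)
      finally show ?thesis using True by (simp add: algebra_simps)
    next
      case False
      then have "x \<notin> cball z e" using assms(4) by auto
      from outside[OF this, of 1] False show ?thesis by (simp add: bump_def norm_minus_commute)
    qed
  qed
  finally have *: "(\<integral>x. bump e (z - x) * g z - bump e (z - x) * g x \<partial>lborel) = 0" .
  have "integrable lborel (\<lambda>x. bump e (z - x) * g x)"
  proof (rule integrable_compact_support[of "cball z e"])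
    show "continuous_on (cball z e) (\<lambda>x. bump e (z - x) * g x)"
      using assms by (intro continuous_intros)
        (auto intro: continuous_on_subset holomorphic_on_imp_continuous_on)
  qed (use assms(3) in \<open>auto intro!: bump_eq_0 simp: dist_norm norm_minus_commute\<close>)
  moreover have "integrable lborel (\<lambda>x. complex_of_real (bump e (z - x)) * g z)"
    using integrable_bump[of e z] assms(3) by simp
  ultimately show ?thesis using * by (simp add: integral_bump)
qed

section \<open>Convolution with a smooth kernel\<close>

text \<open>Differentiation under the integral for a merely integrable \<open>V\<close>: the
  gradient \<open>G\<close> of the kernel is uniformly continuous, so the first order remainder of
  the kernel is at most (e / M) |h| uniformly in y. The halves come from G \<bullet> h = (cnj G h +
  G cnj h) / 2.\<close>

lemma convolution_has_derivative:
  fixes V :: "complex \<Rightarrow> complex" and k :: "complex \<Rightarrow> real"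
  assumes V: "integrable lborel V" and k: "\<And>y. (k has_derivative (\<lambda>h. G y \<bullet> h)) (at y)"
    and G: "continuous_on UNIV G" "\<And>y. y \<notin> cball 0 R \<Longrightarrow> G y = 0"
    and k0: "\<And>y. y \<notin> cball 0 R \<Longrightarrow> k y = 0"
  shows "((\<lambda>z. \<integral>y. k (z - y) * V y \<partial>lborel) has_derivative
     (\<lambda>h. (\<integral>y. cnj (G (z - y)) * V y \<partial>lborel) / 2 * h + (\<integral>y. G (z - y) * V y \<partial>lborel) / 2 * cnj h)) (at z)"
proof -
  have contk: "continuous_on UNIV k"
    by (intro continuous_at_imp_continuous_on ballI has_derivative_continuous[OF k])
  have [measurable]: "k \<in> borel_measurable borel" "G \<in> borel_measurable borel"
    using contk G(1) by (auto intro: borel_measurable_continuous_onI)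
  obtain Bk where Bk: "Bk > 0" "\<And>y. norm (k y) \<le> Bk"
    by (rule continuous_compact_support_bounded[OF compact_cball continuous_on_subset[OF contk], of 0 R])
      (use k0 in auto)
  obtain BG where BG: "BG > 0" "\<And>y. norm (G y) \<le> BG"
    by (rule continuous_compact_support_bounded[OF compact_cball continuous_on_subset[OF G(1)], of 0 R])
      (use G(2) in auto)
  have ik: "integrable lborel (\<lambda>y. k (x - y) * V y)" for x
    using Bk by (intro integrable_bounded_mult[OF V, where B=Bk]) auto
  have iG: "integrable lborel (\<lambda>y. G (z - y) * V y)" "integrable lborel (\<lambda>y. cnj (G (z - y)) * V y)"
    using BG by (auto intro!: integrable_bounded_mult[OF V, where B=BG] borel_measurable_continuous_onI
        continuous_intros continuous_on_compose2[OF G(1)])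
  have unif: "\<exists>d>0. \<forall>x y. norm (y - x) < d \<longrightarrow> norm (G y - G x) < e" if "e > 0" for e
  proof -
    have "uniformly_continuous_on (cball 0 (R + 1)) G"
      by (intro compact_uniformly_continuous continuous_on_subset[OF G(1)]) auto
    then obtain d where d: "d > 0" "\<And>x y. x \<in> cball 0 (R + 1) \<Longrightarrow> y \<in> cball 0 (R + 1) \<Longrightarrow>
        norm (y - x) < d \<Longrightarrow> norm (G y - G x) < e"
      using \<open>e > 0\<close> unfolding uniformly_continuous_on_def dist_norm by metis
    have "norm (G y - G x) < e" if "norm (y - x) < min d 1" for x y
    proof (cases "x \<in> cball 0 R \<or> y \<in> cball 0 R")
      case True
      then have "x \<in> cball 0 (R + 1)" "y \<in> cball 0 (R + 1)"
        using that norm_triangle_ineq2[of x y] norm_triangle_ineq2[of y x]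
        by (auto simp: norm_minus_commute)
      then show ?thesis using d that by simp
    qed (use G(2) \<open>e > 0\<close> in auto)
    then show ?thesis using d(1) by (intro exI[of _ "min d 1"]) auto
  qed
  define D where "D h = (\<integral>y. cnj (G (z - y)) * V y \<partial>lborel) / 2 * h + (\<integral>y. G (z - y) * V y \<partial>lborel) / 2 * cnj h" for h
  have D: "D h = (\<integral>y. of_real (G (z - y) \<bullet> h) * V y \<partial>lborel)"
    and iD: "integrable lborel (\<lambda>y. of_real (G (z - y) \<bullet> h) * V y)" for h
  proof -
    have eq: "(\<lambda>y. of_real (G (z - y) \<bullet> h) * V y) =
      (\<lambda>y. (cnj (G (z - y)) * V y) * (h / 2) + (G (z - y) * V y) * (cnj h / 2))"
      by (rule ext) (simp add: complex_eq_iff inner_complex_def field_simps)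
    show "integrable lborel (\<lambda>y. of_real (G (z - y) \<bullet> h) * V y)"
      unfolding eq using iG by (intro Bochner_Integration.integrable_add integrable_mult_left) auto
    show "D h = (\<integral>y. of_real (G (z - y) \<bullet> h) * V y \<partial>lborel)"
      unfolding eq D_def using iG by simp
  qed
  define \<Phi> where "\<Phi> z = (\<integral>y. k (z - y) * V y \<partial>lborel)" for z
  define M where "M = (\<integral>y. norm (V y) \<partial>lborel) + 1"
  have M: "M > 0" unfolding M_def by (simp add: add_nonneg_pos)
  have "\<exists>d>0. \<forall>y. norm (y - z) < d \<longrightarrow> norm (\<Phi> y - \<Phi> z - D (y - z)) \<le> e * norm (y - z)" if "e > 0" for e
  proof -
    obtain d where d: "d > 0" "\<And>x y. norm (y - x) < d \<Longrightarrow> norm (G y - G x) < e / M"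
      using unif[of "e / M"] \<open>e > 0\<close> M by (metis divide_pos_pos)
    have "norm (\<Phi> x - \<Phi> z - D (x - z)) \<le> e * norm (x - z)" if x: "norm (x - z) < d" for x
    proof -
      define h where "h = x - z"
      have pt: "\<bar>k (x - y) - k (z - y) - G (z - y) \<bullet> h\<bar> \<le> e / M * norm h" for y
      proof -
        have dg: "((\<lambda>s. k (z - y + s *\<^sub>R h)) has_real_derivative G (z - y + s *\<^sub>R h) \<bullet> h) (at s)" for s
          unfolding has_field_derivative_def
        proof (rule has_derivative_eq_rhs)
          show "((\<lambda>s. k (z - y + s *\<^sub>R h)) has_derivative (\<lambda>t. G (z - y + s *\<^sub>R h) \<bullet> (t *\<^sub>R h))) (at s)"
            by (rule has_derivative_compose[where g=k]) (auto intro!: derivative_eq_intros k)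
        qed (simp add: fun_eq_iff)
        obtain s where s: "0 < s" "s < (1::real)"
          "k (z - y + 1 *\<^sub>R h) - k (z - y + 0 *\<^sub>R h) = (1 - 0) * (G (z - y + s *\<^sub>R h) \<bullet> h)"
          using MVT2[of 0 1 "\<lambda>s. k (z - y + s *\<^sub>R h)" "\<lambda>s. G (z - y + s *\<^sub>R h) \<bullet> h"] dg by auto
        have "k (x - y) - k (z - y) - G (z - y) \<bullet> h = (G (z - y + s *\<^sub>R h) - G (z - y)) \<bullet> h"
          using s(3) by (simp add: h_def inner_diff_left)
        also have "\<bar>\<dots>\<bar> \<le> norm (G (z - y + s *\<^sub>R h) - G (z - y)) * norm h"
          by (rule Cauchy_Schwarz_ineq2)
        also have "norm (G (z - y + s *\<^sub>R h) - G (z - y)) \<le> e / M"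
        proof (rule less_imp_le[OF d(2)])
          have "norm (s *\<^sub>R h) \<le> norm h" using s by (simp add: mult_left_le_one_le)
          then show "norm (z - y + s *\<^sub>R h - (z - y)) < d" using x by (simp add: h_def)
        qed
        finally show ?thesis by (simp add: mult_right_mono)
      qed
      have "\<Phi> x - \<Phi> z - D h = (\<integral>y. of_real (k (x - y) - k (z - y) - G (z - y) \<bullet> h) * V y \<partial>lborel)"
        unfolding \<Phi>_def D using ik iD
        by (simp add: left_diff_distrib)
      also have "norm \<dots> \<le> (\<integral>y. norm (of_real (k (x - y) - k (z - y) - G (z - y) \<bullet> h) * V y) \<partial>lborel)"
        by (rule integral_norm_bound)
      also have "\<dots> \<le> (\<integral>y. e / M * norm h * norm (V y) \<partial>lborel)"
      proof (rule integral_mono)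
        show "integrable lborel (\<lambda>y. norm (of_real (k (x - y) - k (z - y) - G (z - y) \<bullet> h) * V y))"
          using ik iD by (intro integrable_norm) (simp add: left_diff_distrib)
        show "integrable lborel (\<lambda>y. e / M * norm h * norm (V y))" using V by auto
        show "norm (of_real (k (x - y) - k (z - y) - G (z - y) \<bullet> h) * V y) \<le> e / M * norm h * norm (V y)" for y
          unfolding norm_mult norm_of_real by (intro mult_right_mono pt) auto
      qed
      also have "\<dots> = (e / M) * norm h * (M - 1)" by (simp add: M_def)
      also have "\<dots> \<le> e * norm h" using M \<open>e > 0\<close> by (simp add: field_simps)
      finally show ?thesis by (simp add: h_def)
    qed
    then show ?thesis using d(1) by blast
  qed
  moreover have "bounded_linear D"
    unfolding D_def
    by (intro bounded_linear_add bounded_linear_mult_right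
        bounded_linear_compose[OF bounded_linear_mult_right bounded_linear_cnj])
  ultimately show ?thesis
    unfolding has_derivative_at_alt \<Phi>_def[symmetric] D_def[symmetric] by blast
qed

section \<open>Test functions\<close>

lemma lborel_integral_reflect:
  fixes f :: "complex \<Rightarrow> 'b::{banach, second_countable_topology}"
  assumes "f \<in> borel_measurable borel"
  shows "(\<integral>z. f (c - z) \<partial>lborel) = (\<integral>z. f z \<partial>lborel)"
proof -
  have "lborel = density (distr lborel borel (\<lambda>x. c + (- 1) *\<^sub>R x)) (\<lambda>_. \<bar>- 1 :: real\<bar> ^ DIM(complex))"
    by (rule lborel_affine) simp
  then have "lborel = distr lborel borel (\<lambda>x. c - x)"
    by (simp add: density_1)
  then have "(\<integral>z. f z \<partial>lborel) = (\<integral>z. f z \<partial>distr lborel borel (\<lambda>x. c - x))" by simp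
  also have "\<dots> = (\<integral>z. f (c - z) \<partial>lborel)"
    using assms by (intro integral_distr) auto
  finally show ?thesis by simp
qed

text \<open>The definitions integrate over \<open>lebesgue_on D\<close>, the calculus above over
  \<open>lborel\<close>; for continuous integrands with compact support in \<open>D\<close> the two
  agree.\<close>

lemma compact_support_lebesgue_on:
  fixes f :: "complex \<Rightarrow> 'b::{banach, second_countable_topology}"
  assumes "open D" "compact K" "K \<subseteq> D" "continuous_on D f" "\<And>z. z \<in> D \<Longrightarrow> z \<notin> K \<Longrightarrow> f z = 0"
  shows "integrable lborel (\<lambda>z. if z \<in> D then f z else 0)"
    and "integrable (lebesgue_on D) f"
    and "(\<integral>z. f z \<partial>lebesgue_on D) = (\<integral>z. (if z \<in> D then f z else 0) \<partial>lborel)"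
proof -
  let ?f = "\<lambda>z. if z \<in> D then f z else 0"
  show 1: "integrable lborel ?f"
  proof (rule integrable_compact_support[OF assms(2)])
    have "continuous_on K f" using assms by (auto intro: continuous_on_subset)
    then show "continuous_on K ?f"
      by (rule continuous_on_eq) (use assms(3) in auto)
  qed (use assms(5) in auto)
  then have m: "?f \<in> lborel \<rightarrow>\<^sub>M borel" by auto
  have D: "D \<in> sets lebesgue" using assms(1) by auto
  have 2: "integrable lebesgue ?f" using 1 integrable_completion[OF m] by simp
  have ind: "(\<lambda>z. indicator D z *\<^sub>R f z) = ?f" by (auto simp: fun_eq_iff)
  show "integrable (lebesgue_on D) f"
    using D 2 ind by (simp add: integrable_restrict_space set_integrable_def)
  show "(\<integral>z. f z \<partial>lebesgue_on D) = (\<integral>z. ?f z \<partial>lborel)"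
    using D ind by (simp add: integral_restrict_space integral_completion[OF m])
qed

lemma test_function_props:
  assumes "test_function D \<psi>"
  obtains K where "compact K" "K \<subseteq> D" "\<And>z. z \<notin> K \<Longrightarrow> \<psi> z = 0"
    "\<And>z. z \<notin> K \<Longrightarrow> d_z \<psi> z = 0" "\<And>z. z \<notin> K \<Longrightarrow> d_zbar \<psi> z = 0"
    "\<And>S. continuous_on S \<psi>" "\<And>S. continuous_on S (d_z \<psi>)" "\<And>S. continuous_on S (d_zbar \<psi>)"
    "\<And>z. (\<psi> has_derivative (\<lambda>v. d_z \<psi> z * v + d_zbar \<psi> z * cnj v)) (at z)"
proof -
  from assms obtain K where K: "compact K" "K \<subseteq> D" "\<And>z. z \<notin> K \<Longrightarrow> \<psi> z = 0"
    unfolding test_function_def by auto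
  have C: "Ck_on (Suc 0) UNIV \<psi>"
    using assms unfolding test_function_def smooth_on_def by auto
  have der: "(\<psi> has_derivative (\<lambda>v. d_z \<psi> z * v + d_zbar \<psi> z * cnj v)) (at z)" for z
    using C by (intro has_derivative_wirtinger) auto
  have "continuous_on UNIV (d_z \<psi>)" "continuous_on UNIV (d_zbar \<psi>)" "continuous_on UNIV \<psi>"
    using C Ck_on_imp_continuous[OF C]
    unfolding d_z_def[abs_def] d_zbar_def[abs_def] by (auto intro!: continuous_intros)
  then have cont: "continuous_on S (d_z \<psi>)" "continuous_on S (d_zbar \<psi>)" "continuous_on S \<psi>" for S
    by (auto intro: continuous_on_subset)
  have zero: "d_z \<psi> z = 0" "d_zbar \<psi> z = 0" if "z \<notin> K" for z
  proof -
    have "(\<psi> has_derivative (\<lambda>v. 0 * v + 0 * cnj v)) (at z)"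
      using has_derivative_zero_outside[where f=\<psi>, OF compact_imp_closed[OF K(1)] K(3) that] by simp
    from wirtinger_eqI[OF this] show "d_z \<psi> z = 0" "d_zbar \<psi> z = 0" by auto
  qed
  show ?thesis by (rule that[OF K zero cont(3) cont(1,2) der])
qed

text \<open>\<open>dbar_integral_zero\<close> for the product of \<psi> and v: a classical solution
  of the Cauchy-Riemann equation is also a weak one.\<close>

lemma dbar_integration_by_parts:
  assumes "open D" "test_function D \<psi>"
    and v: "\<And>z. z \<in> D \<Longrightarrow> (v has_derivative (\<lambda>x. A z * x + B z * cnj x)) (at z)"
    and A: "continuous_on D A" and B: "continuous_on D B"
  shows "- (\<integral>z. d_zbar \<psi> z * v z \<partial>lebesgue_on D) = (\<integral>z. \<psi> z * B z \<partial>lebesgue_on D)"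
    and "integrable (lebesgue_on D) (\<lambda>z. d_zbar \<psi> z * v z)"
    and "integrable (lebesgue_on D) (\<lambda>z. \<psi> z * B z)"
proof -
  obtain K where K: "compact K" "K \<subseteq> D" and \<psi>: "\<And>z. z \<notin> K \<Longrightarrow> \<psi> z = 0"
    "\<And>z. z \<notin> K \<Longrightarrow> d_z \<psi> z = 0" "\<And>z. z \<notin> K \<Longrightarrow> d_zbar \<psi> z = 0"
    "\<And>S. continuous_on S \<psi>" "\<And>S. continuous_on S (d_z \<psi>)" "\<And>S. continuous_on S (d_zbar \<psi>)"
    "\<And>z. (\<psi> has_derivative (\<lambda>v. d_z \<psi> z * v + d_zbar \<psi> z * cnj v)) (at z)"
    using test_function_props[OF assms(2)] by blast
  have cv: "continuous_on D v"
    by (intro continuous_at_imp_continuous_on ballI has_derivative_continuous[OF v])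
  have c1: "continuous_on D (\<lambda>z. d_zbar \<psi> z * v z)" and c2: "continuous_on D (\<lambda>z. \<psi> z * B z)"
    by (intro continuous_intros \<psi> cv B)+
  note L1 = compact_support_lebesgue_on[OF assms(1) K c1]
  note L2 = compact_support_lebesgue_on[OF assms(1) K c2]
  show "integrable (lebesgue_on D) (\<lambda>z. d_zbar \<psi> z * v z)" "integrable (lebesgue_on D) (\<lambda>z. \<psi> z * B z)"
    by (rule L1 L2; simp add: \<psi>)+
  have "(\<integral>z. (if z \<in> D then \<psi> z * B z + d_zbar \<psi> z * v z else 0) \<partial>lborel) = 0"
  proof (rule dbar_integral_zero[OF assms(1) K])
    show "((\<lambda>z. \<psi> z * v z) has_derivative (\<lambda>x. (\<psi> z * A z + d_z \<psi> z * v z) * x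
        + (\<psi> z * B z + d_zbar \<psi> z * v z) * cnj x)) (at z)" if "z \<in> D" for z
      by (rule has_derivative_wirtinger_mult[OF \<psi>(7) v[OF that]])
    show "continuous_on D (\<lambda>z. \<psi> z * A z + d_z \<psi> z * v z)"
      "continuous_on D (\<lambda>z. \<psi> z * B z + d_zbar \<psi> z * v z)"
      by (intro continuous_intros \<psi> cv A B)+
  qed (simp add: \<psi>)
  also have "(\<lambda>z. if z \<in> D then \<psi> z * B z + d_zbar \<psi> z * v z else 0)
    = (\<lambda>z. (if z \<in> D then \<psi> z * B z else 0) + (if z \<in> D then d_zbar \<psi> z * v z else 0))"
    by auto
  finally have "(\<integral>z. \<psi> z * B z \<partial>lebesgue_on D) + (\<integral>z. d_zbar \<psi> z * v z \<partial>lebesgue_on D) = 0"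
    using L1 L2 \<psi> by simp
  then show "- (\<integral>z. d_zbar \<psi> z * v z \<partial>lebesgue_on D) = (\<integral>z. \<psi> z * B z \<partial>lebesgue_on D)"
    by (simp add: eq_neg_iff_add_eq_0 add.commute neg_eq_iff_add_eq_0)
qed

section \<open>The fundamental lemma of the calculus of variations\<close>

text \<open>Inner regularity: a Lebesgue set exceeds a closed subset by arbitrarily small measure,
  and a closed set is a countable union of compact ones. The point is to reach compact sets, whose
  indicators are limits of continuous cutoffs.\<close>

lemma negligible_of_compact_subsets:
  fixes S :: "'a::euclidean_space set"
  assumes S: "S \<in> sets lebesgue" and K: "\<And>K. compact K \<Longrightarrow> K \<subseteq> S \<Longrightarrow> negligible K"
  shows "negligible S"
proof -
  have "emeasure lebesgue S \<le> 0 + ennreal e" if e: "e > 0" for e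
  proof -
    obtain T where T: "closed T" "T \<subseteq> S" "S - T \<in> lmeasurable" "emeasure lebesgue (S - T) < ennreal e"
      using sets_lebesgue_inner_closed[OF S e] by blast
    have n: "negligible (T \<inter> cball 0 (real n))" for n :: nat
      by (rule K) (use T in auto)
    have "negligible (\<Union> (range (\<lambda>n::nat. T \<inter> cball 0 (real n))))"
      by (rule negligible_countable_Union) (use n in auto)
    moreover have "\<Union> (range (\<lambda>n::nat. T \<inter> cball 0 (real n))) = T"
      by (auto intro: real_arch_simple)
    ultimately have "negligible T" by simp
    then have T0: "T \<in> sets lebesgue" "emeasure lebesgue T = 0"
      using negligible_imp_sets[of T] negligible_iff_emeasure0[of T] by blast+
    have "emeasure lebesgue S \<le> emeasure lebesgue (T \<union> (S - T))"
      using T(2,3) T0 S by (intro emeasure_mono) auto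
    also have "\<dots> \<le> emeasure lebesgue T + emeasure lebesgue (S - T)"
      by (intro emeasure_subadditive) (use T0 T S in auto)
    finally show ?thesis using T0 T(4) by simp
  qed
  then have "emeasure lebesgue S \<le> 0" by (rule ennreal_le_epsilon) auto
  then show ?thesis using S by (simp add: negligible_iff_emeasure0)
qed

text \<open>For a compact \<open>T\<close> inside the set, cutoffs decreasing to the indicator of
  \<open>T\<close> show that \<open>R\<close> has integral 0 over \<open>T\<close>, although R > 0
  there; so \<open>T\<close> is null.\<close>

lemma fundamental_lemma_positive_part:
  fixes R :: "complex \<Rightarrow> real"
  assumes R: "integrable lborel R" and "open U"
    and *: "\<And>g K. continuous_on UNIV g \<Longrightarrow> compact K \<Longrightarrow> K \<subseteq> U \<Longrightarrow> (\<And>z. z \<notin> K \<Longrightarrow> g z = 0)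
      \<Longrightarrow> (\<integral>z. g z * R z \<partial>lborel) = 0"
  shows "negligible {z \<in> U. R z > 0}"
proof (rule negligible_of_compact_subsets)
  have [measurable]: "R \<in> borel_measurable borel" using R by auto
  have [measurable]: "U \<in> sets borel" using \<open>open U\<close> by auto
  have "{z \<in> space borel. z \<in> U \<and> R z > 0} \<in> sets borel" by measurable
  then show "{z \<in> U. R z > 0} \<in> sets lebesgue" by simp
  fix T :: "complex set" assume T: "compact T" "T \<subseteq> {z \<in> U. R z > 0}"
  show "negligible T"
  proof (cases "T = {}")
    case False
    obtain d where d: "d > 0" "{z. infdist z T \<le> d} \<subseteq> U"
      using compact_in_open_separated[OF False T(1) \<open>open U\<close>] T(2) by blast
    \<comment> \<open>Equal to 1 on \<open>T\<close>, and for every n supported in the same closed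
      d-neighbourhood of \<open>T\<close>, which lies in \<open>U\<close>.\<close>
    define g where "g n z = max 0 (1 - real (Suc n) / d * infdist z T)" for n z
    have g0: "g n z = 0" if "z \<notin> {z. infdist z T \<le> d}" for n z
    proof -
      have "1 \<le> real (Suc n) / d * infdist z T"
        using that d(1) mult_mono[of 1 "real (Suc n)" d "infdist z T"] by (simp add: field_simps)
      then show ?thesis by (simp add: g_def)
    qed
    have zero: "(\<integral>z. g n z * R z \<partial>lborel) = 0" for n
    proof (rule *[OF _ compact_infdist_le[OF False T(1) d(1)] d(2) g0])
      show "continuous_on UNIV (g n)"
        unfolding g_def by (intro continuous_intros)
    qed
    have lim: "(\<lambda>n. g n z * R z) \<longlonglongrightarrow> indicator T z * R z" for z
    proof (cases "z \<in> T")
      case True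
      then show ?thesis by (simp add: g_def)
    next
      case False
      then have pos: "infdist z T > 0"
        using \<open>T \<noteq> {}\<close> T(1) compact_imp_closed in_closed_iff_infdist_zero[of T z]
          infdist_nonneg[of z T] by (metis less_eq_real_def)
      obtain N where N: "real N > d / infdist z T" using reals_Archimedean2 by blast
      have "g n z * R z = 0" if "n \<ge> N" for n
      proof -
        have "d / infdist z T < real (Suc n)" using N that by linarith
        then have "1 \<le> real (Suc n) / d * infdist z T"
          using pos d(1) by (simp add: field_simps)
        then show ?thesis by (simp add: g_def)
      qed
      then have "\<forall>\<^sub>F n in sequentially. g n z * R z = 0"
        unfolding eventually_sequentially by blast
      then show ?thesis using False by (simp add: tendsto_eventually)
    qed
    have g1: "0 \<le> g n z" "g n z \<le> 1" for n z
      using d(1) infdist_nonneg[of z T] by (auto simp: g_def)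
    have "(\<lambda>n. \<integral>z. g n z * R z \<partial>lborel) \<longlonglongrightarrow> (\<integral>z. indicator T z * R z \<partial>lborel)"
    proof (rule integral_dominated_convergence[where w="\<lambda>z. \<bar>R z\<bar>"])
      have [measurable]: "T \<in> sets borel" using T(1) by (intro borel_closed compact_imp_closed)
      show "(\<lambda>z. indicat_real T z * R z) \<in> borel_measurable lborel" by measurable
      have [measurable]: "g n \<in> borel_measurable borel" for n
        unfolding g_def by (intro borel_measurable_continuous_onI continuous_intros)
      show "(\<lambda>z. g n z * R z) \<in> borel_measurable lborel" for n by measurable
      show "AE z in lborel. norm (g n z * R z) \<le> \<bar>R z\<bar>" for n
        using g1[of n] by (auto simp: abs_mult mult_left_le_one_le)
    qed (use R lim in auto)
    then have int0: "(\<integral>z. indicator T z * R z \<partial>lborel) = 0"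
      by (simp add: zero LIMSEQ_const_iff)
    have T_sets: "T \<in> sets lborel" using T(1) by (simp add: borel_closed compact_imp_closed)
    then have "integrable lborel (\<lambda>z. indicator T z * R z)"
      using integrable_mult_indicator[of T lborel R] R by simp
    moreover have "AE z in lborel. 0 \<le> indicator T z * R z"
      by (rule AE_I2) (use T(2) in \<open>auto simp: indicator_def\<close>)
    ultimately have "AE z in lborel. indicator T z * R z = 0"
      using int0 integral_nonneg_eq_0_iff_AE by blast
    then have "AE z in lborel. z \<notin> T"
      by eventually_elim (use T(2) in \<open>auto simp: indicator_def split: if_splits\<close>)
    then have "T \<in> null_sets lborel" using AE_iff_null_sets[OF T_sets] by simp
    then show ?thesis by (simp add: negligible_iff_null_sets null_sets_completionI)
  qed auto
qed

lemma fundamental_lemma: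
  fixes V :: "complex \<Rightarrow> complex"
  assumes V: "integrable lborel V" and "open U"
    and *: "\<And>g K. continuous_on UNIV g \<Longrightarrow> compact K \<Longrightarrow> K \<subseteq> U \<Longrightarrow> (\<And>z. z \<notin> K \<Longrightarrow> g z = 0)
      \<Longrightarrow> (\<integral>z. of_real (g z) * V z \<partial>lborel) = 0"
  shows "negligible {z \<in> U. V z \<noteq> 0}"
proof -
  have i: "integrable lborel (\<lambda>z. of_real (g z) * V z)"
    if "continuous_on UNIV g" "compact K" "K \<subseteq> U" "\<And>z. z \<notin> K \<Longrightarrow> g z = 0" for g K
  proof -
    note g = that
    obtain B where B: "B > 0" "\<And>z. norm (g z) \<le> B"
      by (rule continuous_compact_support_bounded[OF g(2) continuous_on_subset[OF g(1)]]) (use g in auto)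
    have [measurable]: "g \<in> borel_measurable borel" using g(1) by (rule borel_measurable_continuous_onI)
    show ?thesis by (rule integrable_bounded_mult[OF V, where B=B]) (use B in auto)
  qed
  have "negligible {z \<in> U. L (V z) > 0}" if L: "bounded_linear L" for L :: "complex \<Rightarrow> real"
  proof (rule fundamental_lemma_positive_part[OF _ \<open>open U\<close>])
    show "integrable lborel (\<lambda>z. L (V z))" using V by (rule integrable_bounded_linear[OF L])
    fix g :: "complex \<Rightarrow> real" and K assume g: "continuous_on UNIV g" "compact K" "K \<subseteq> U" "\<And>z. z \<notin> K \<Longrightarrow> g z = 0"
    have "(\<lambda>z. g z * L (V z)) = (\<lambda>z. L (of_real (g z) * V z))"
      using bounded_linear.linear[OF L] by (auto simp: scaleR_conv_of_real[symmetric] linear_scale)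
    then show "(\<integral>z. g z * L (V z) \<partial>lborel) = 0"
      using integral_bounded_linear[OF L i[OF g]] *[OF g] linear_0[OF bounded_linear.linear[OF L]] by simp
  qed
  from this[OF bounded_linear_Re] this[OF bounded_linear_Im]
    this[OF bounded_linear_minus[OF bounded_linear_Re]] this[OF bounded_linear_minus[OF bounded_linear_Im]]
  have "negligible ({z \<in> U. Re (V z) > 0} \<union> {z \<in> U. Im (V z) > 0} \<union>
      {z \<in> U. - Re (V z) > 0} \<union> {z \<in> U. - Im (V z) > 0})"
    by (intro negligible_Un)
  then show ?thesis by (rule negligible_subset) (auto simp: complex_eq_iff)
qed

lemma continuous_eq_of_negligible:
  fixes f g :: "complex \<Rightarrow> complex"
  assumes "open U" "continuous_on U f" "continuous_on U g" "negligible {z \<in> U. f z \<noteq> g z}" "z \<in> U"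
  shows "f z = g z"
proof -
  have "{z \<in> U. f z \<noteq> g z} = U \<inter> (\<lambda>z. f z - g z) -` (- {0})" by auto
  moreover have "open (U \<inter> (\<lambda>z. f z - g z) -` (- {0}))"
    by (auto intro!: continuous_open_preimage continuous_intros assms)
  ultimately have "{z \<in> U. f z \<noteq> g z} = {}"
    using assms(4) open_not_negligible[of "{z \<in> U. f z \<noteq> g z}"] by auto
  then show ?thesis using assms(5) by auto
qed

section \<open>Weyl's lemma for the Cauchy-Riemann operator\<close>

lemma integrable_product:
  fixes f g :: "complex \<Rightarrow> complex"
  assumes f: "integrable lborel f" and g: "integrable lborel g"
  shows "integrable (lborel \<Otimes>\<^sub>M lborel) (\<lambda>(x, y). f x * g y)"
proof (rule lborel_pair.Fubini_integrable)
  have [measurable]: "f \<in> borel_measurable borel" "g \<in> borel_measurable borel"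
    using f g by auto
  show "(\<lambda>(x, y). f x * g y) \<in> borel_measurable (lborel \<Otimes>\<^sub>M lborel)" by measurable
  show "integrable lborel (\<lambda>x. \<integral>y. norm (case (x, y) of (x, y) \<Rightarrow> f x * g y) \<partial>lborel)"
    using f by (simp add: norm_mult)
  show "AE x in lborel. integrable lborel (\<lambda>y. case (x, y) of (x, y) \<Rightarrow> f x * g y)"
    using g by simp
qed

lemma bump_bound:
  obtains B where "B > 0" "\<And>y. bump e y \<le> B"
proof -
  have c: "continuous_on (cball 0 \<bar>e\<bar>) (bump e)"
    by (intro continuous_on_bump[where u="\<lambda>y. y"] continuous_intros)
  have "bump e y = 0" if "y \<notin> cball 0 \<bar>e\<bar>" for y
    using bump_eq_0[OF _ that] by (simp add: bump_def)
  then obtain B where B: "B > 0" "\<And>y. norm (bump e y) \<le> B"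
    using continuous_compact_support_bounded[OF compact_cball c] by metis
  show ?thesis
  proof (rule that)
    show "bump e y \<le> B" for y using B(2)[of y] by simp
  qed (rule B)
qed

text \<open>After Fubini each side contains the convolution of the two bumps, and the substitution
  of z + y - x for x exchanges them.\<close>

lemma mollify_commute:
  fixes V :: "complex \<Rightarrow> complex"
  assumes V: "integrable lborel V" and "0 \<le> d" "0 \<le> e"
  shows "(\<integral>x. of_real (bump d (z - x)) * (\<integral>y. of_real (bump e (x - y)) * V y \<partial>lborel) \<partial>lborel)
       = (\<integral>x. of_real (bump e (z - x)) * (\<integral>y. of_real (bump d (x - y)) * V y \<partial>lborel) \<partial>lborel)"
proof -
  have [measurable]: "V \<in> borel_measurable borel" using V by auto
  have swap: "(\<integral>x. of_real (bump d (z - x)) * (\<integral>y. of_real (bump e (x - y)) * V y \<partial>lborel) \<partial>lborel)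
      = (\<integral>y. V y * of_real (\<integral>x. bump d (z - x) * bump e (x - y) \<partial>lborel) \<partial>lborel)"
    if "0 \<le> d" for d e
  proof -
    define F where "F x y = complex_of_real (bump d (z - x)) * (of_real (bump e (x - y)) * V y)" for x y
    obtain B where B: "B > 0" "\<And>y. bump e y \<le> B" by (rule bump_bound[of e]) blast
    have i: "integrable (lborel \<Otimes>\<^sub>M lborel) (case_prod F)"
    proof (rule Bochner_Integration.integrable_bound)
      show "integrable (lborel \<Otimes>\<^sub>M lborel) (\<lambda>(x, y). complex_of_real (bump d (z - x)) * (of_real B * V y))"
        by (rule integrable_product) (use integrable_bump[OF that, of z] V in auto)
      show "case_prod F \<in> borel_measurable (lborel \<Otimes>\<^sub>M lborel)"
        unfolding F_def by measurable
      show "AE p in lborel \<Otimes>\<^sub>M lborel. norm (case_prod F p)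
          \<le> norm (case p of (x, y) \<Rightarrow> complex_of_real (bump d (z - x)) * (of_real B * V y))"
        using B by (intro AE_I2) (auto simp: F_def norm_mult bump_nonneg intro!: mult_left_mono mult_right_mono)
    qed
    have "(\<integral>x. of_real (bump d (z - x)) * (\<integral>y. of_real (bump e (x - y)) * V y \<partial>lborel) \<partial>lborel)
      = (\<integral>x. (\<integral>y. F x y \<partial>lborel) \<partial>lborel)"
      by (simp add: F_def)
    also have "\<dots> = (\<integral>y. (\<integral>x. F x y \<partial>lborel) \<partial>lborel)"
      using lborel_pair.Fubini_integral[OF i] by simp
    also have "(\<lambda>y. \<integral>x. F x y \<partial>lborel) = (\<lambda>y. V y * of_real (\<integral>x. bump d (z - x) * bump e (x - y) \<partial>lborel))"
    proof
      fix y
      have "F x y = V y * complex_of_real (bump d (z - x) * bump e (x - y))" for x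
        by (simp add: F_def)
      then show "(\<integral>x. F x y \<partial>lborel) = V y * of_real (\<integral>x. bump d (z - x) * bump e (x - y) \<partial>lborel)"
        by (simp only: integral_mult_right_zero integral_complex_of_real)
    qed
    finally show ?thesis .
  qed
  have refl: "(\<integral>x. bump d (z - x) * bump e (x - y) \<partial>lborel) = (\<integral>x. bump e (z - x) * bump d (x - y) \<partial>lborel)" for y
  proof -
    have "(\<integral>x. bump d (z - x) * bump e (x - y) \<partial>lborel)
      = (\<integral>x. bump d (z - (z + y - x)) * bump e (z + y - x - y) \<partial>lborel)"
      by (rule lborel_integral_reflect[symmetric]) measurable
    also have "\<dots> = (\<integral>x. bump e (z - x) * bump d (x - y) \<partial>lborel)"
      by (simp add: mult.commute algebra_simps)
    finally show ?thesis .
  qed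
  show ?thesis using swap[of d e] swap[of e d] assms(2,3) refl by simp
qed

text \<open>The mollifications \<open>\<Phi> e\<close> of \<open>V\<close> are holomorphic because
  the weak equation kills their zbar-derivative. The mean value property and the commutation of
  mollifiers give \<open>bump_mass d * \<Phi> e z = bump_mass e * \<Phi> d z\<close>, so
  \<open>\<Phi> e / bump_mass e\<close> does not depend on e. This single function is
  \<open>k\<close>, and letting the radius tend to 0 identifies it with \<open>V\<close> almost
  everywhere.\<close>

lemma weyl_local:
  fixes V :: "complex \<Rightarrow> complex"
  assumes V: "integrable lborel V" and r: "r > 0"
    and weak: "\<And>z e. z \<in> ball z0 (2 * r) \<Longrightarrow> 0 < e \<Longrightarrow> e \<le> r \<Longrightarrow>
      (\<integral>y. bump_grad e (z - y) * V y \<partial>lborel) = 0"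
  obtains k where "k holomorphic_on ball z0 r" "negligible {z \<in> ball z0 r. V z \<noteq> k z}"
proof -
  have [measurable]: "V \<in> borel_measurable borel" using V by auto
  define \<Phi> where "\<Phi> e z = (\<integral>y. of_real (bump e (z - y)) * V y \<partial>lborel)" for e z
  have hol: "\<Phi> e holomorphic_on ball z0 (2 * r)" if e: "0 < e" "e \<le> r" for e
  proof (rule holomorphic_onI)
    fix z assume z: "z \<in> ball z0 (2 * r)"
    have "(\<Phi> e has_derivative (\<lambda>h. (\<integral>y. cnj (bump_grad e (z - y)) * V y \<partial>lborel) / 2 * h
        + (\<integral>y. bump_grad e (z - y) * V y \<partial>lborel) / 2 * cnj h)) (at z)"
      unfolding \<Phi>_def[abs_def]
      by (rule convolution_has_derivative[OF V has_derivative_bump, where R=e])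
        (use e in \<open>auto intro!: continuous_intros bump_eq_0 bump_grad_eq_0\<close>)
    then have "(\<Phi> e has_field_derivative (\<integral>y. cnj (bump_grad e (z - y)) * V y \<partial>lborel) / 2) (at z)"
      unfolding has_field_derivative_def
      by (rule has_derivative_eq_rhs) (simp add: fun_eq_iff weak[OF z e])
    then show "\<Phi> e field_differentiable at z within ball z0 (2 * r)"
      using field_differentiable_at_within field_differentiable_def by blast
  qed
  have mass: "bump_mass d * \<Phi> e z = bump_mass e * \<Phi> d z"
    if "z \<in> ball z0 r" "0 < d" "d \<le> r" "0 < e" "e \<le> r" for d e z
  proof -
    have c: "cball z a \<subseteq> ball z0 (2 * r)" if "a \<le> r" for a
    proof
      fix x assume "x \<in> cball z a"
      then show "x \<in> ball z0 (2 * r)"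
        using \<open>z \<in> ball z0 r\<close> that dist_triangle[of z0 x z] by simp
    qed
    have "(\<integral>x. bump d (z - x) * \<Phi> e x \<partial>lborel) = bump_mass d * \<Phi> e z"
      by (rule bump_mean_value[OF open_ball hol]) (use that c in auto)
    moreover have "(\<integral>x. bump e (z - x) * \<Phi> d x \<partial>lborel) = bump_mass e * \<Phi> d z"
      by (rule bump_mean_value[OF open_ball hol]) (use that c in auto)
    ultimately show ?thesis
      using mollify_commute[OF V, of d e z] that unfolding \<Phi>_def by simp
  qed
  define k where "k z = \<Phi> r z / bump_mass r" for z
  have mr: "bump_mass r > 0" using r by (rule bump_mass_pos)
  have holk: "k holomorphic_on ball z0 (2 * r)"
    unfolding k_def using mr r by (intro holomorphic_intros hol) auto
  have \<Phi>k: "\<Phi> d z = bump_mass d * k z" if "z \<in> ball z0 r" "0 < d" "d \<le> r" for d z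
    using mass[OF that(1,2,3) r order_refl] mr by (simp add: k_def field_simps)
  \<comment> \<open>Cut off to the closed ball so that the difference is integrable over the plane;
    \<open>k\<close> is continuous up to the boundary since it is holomorphic on the ball of twice
    the radius.\<close>
  define W where "W z = V z - (if z \<in> cball z0 r then k z else 0)" for z
  have contk: "continuous_on (cball z0 r) k"
    using r by (intro holomorphic_on_imp_continuous_on holomorphic_on_subset[OF holk]) auto
  have W: "integrable lborel W"
    unfolding W_def
    by (intro Bochner_Integration.integrable_diff V integrable_compact_support[of "cball z0 r"]
        continuous_on_eq[OF contk]) auto
  have "negligible {z \<in> ball z0 r. W z \<noteq> 0}"
  proof (rule fundamental_lemma[OF W open_ball])
    fix g :: "complex \<Rightarrow> real" and K
    assume g: "continuous_on UNIV g" "compact K" "K \<subseteq> ball z0 r" "\<And>z. z \<notin> K \<Longrightarrow> g z = 0"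
    obtain Bg where Bg: "Bg > 0" "\<And>z. norm (g z) \<le> Bg"
      by (rule continuous_compact_support_bounded[OF g(2) continuous_on_subset[OF g(1)]]) (use g in auto)
    have [measurable]: "g \<in> borel_measurable borel" using g(1) by (rule borel_measurable_continuous_onI)
    have ig: "integrable lborel (\<lambda>z. complex_of_real (g z))"
      by (rule integrable_compact_support[OF g(2)]) (use g in \<open>auto intro!: continuous_intros intro: continuous_on_subset\<close>)
    \<comment> \<open>The mollifier is moved from \<open>V\<close> to the test function:
      \<open>A d / bump_mass d\<close> tends to g pointwise and is bounded by \<open>Bg\<close>, so
      a multiple of |V| serves as dominating function.\<close>
    define A where "A d y = (\<integral>z. g z * bump d (z - y) \<partial>lborel)" for d y
    have igb: "integrable lborel (\<lambda>z. g z * bump d (z - y))" for d y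
      by (rule integrable_compact_support[OF g(2)])
        (use g in \<open>auto intro!: continuous_intros intro: continuous_on_subset\<close>)
    have [measurable]: "A d \<in> borel_measurable borel" for d
    proof -
      have "(\<lambda>y. \<integral>z. g z * bump d (z - y) \<partial>lborel) \<in> borel_measurable lborel"
        by (rule lborel.borel_measurable_lebesgue_integral) measurable
      then show ?thesis unfolding A_def by simp
    qed
    have eq: "bump_mass d * (\<integral>z. of_real (g z) * k z \<partial>lborel) = (\<integral>y. of_real (A d y) * V y \<partial>lborel)"
      if d: "0 < d" "d \<le> r" for d
    proof -
      define F where "F z y = complex_of_real (g z) * (of_real (bump d (z - y)) * V y)" for z y
      obtain B where B: "B > 0" "\<And>y. bump d y \<le> B" by (rule bump_bound[of d]) blast
      have i: "integrable (lborel \<Otimes>\<^sub>M lborel) (case_prod F)"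
      proof (rule Bochner_Integration.integrable_bound)
        show "integrable (lborel \<Otimes>\<^sub>M lborel) (\<lambda>(x, y). complex_of_real (g x) * (of_real B * V y))"
          by (rule integrable_product) (use ig V in auto)
        show "case_prod F \<in> borel_measurable (lborel \<Otimes>\<^sub>M lborel)"
          unfolding F_def by measurable
        show "AE p in lborel \<Otimes>\<^sub>M lborel. norm (case_prod F p)
            \<le> norm (case p of (x, y) \<Rightarrow> complex_of_real (g x) * (of_real B * V y))"
          using B by (intro AE_I2) (auto simp: F_def norm_mult bump_nonneg intro!: mult_left_mono mult_right_mono)
      qed
      have gk: "bump_mass d * (of_real (g z) * k z) = (\<integral>y. F z y \<partial>lborel)" for z
      proof (cases "z \<in> ball z0 r")
        case True
        then show ?thesis using \<Phi>k[OF True d] by (simp add: F_def \<Phi>_def)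
      next
        case False
        then have "g z = 0" using g(3,4) by blast
        then show ?thesis by (simp add: F_def)
      qed
      have "bump_mass d * (\<integral>z. of_real (g z) * k z \<partial>lborel) = (\<integral>z. (\<integral>y. F z y \<partial>lborel) \<partial>lborel)"
        unfolding gk[symmetric] by simp
      also have "\<dots> = (\<integral>y. (\<integral>z. F z y \<partial>lborel) \<partial>lborel)"
        using lborel_pair.Fubini_integral[OF i] by simp
      also have "(\<lambda>y. \<integral>z. F z y \<partial>lborel) = (\<lambda>y. of_real (A d y) * V y)"
      proof
        fix y
        have "F z y = complex_of_real (g z * bump d (z - y)) * V y" for z by (simp add: F_def)
        then show "(\<integral>z. F z y \<partial>lborel) = of_real (A d y) * V y"
          unfolding A_def by (simp only: integral_mult_left_zero integral_complex_of_real)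
      qed
      finally show ?thesis .
    qed
    have mb: "(\<integral>z. bump d (z - y) \<partial>lborel) = bump_mass d" for d y
      using integral_bump[of d y] by (simp add: bump_minus)
    have ib: "integrable lborel (\<lambda>z. bump d (z - y))" if "0 \<le> d" for d y
      using integrable_bump[OF that, of y] by (simp add: bump_minus)
    have A_bound: "\<bar>A d y\<bar> \<le> Bg * bump_mass d" if "0 \<le> d" for d y
    proof -
      have "\<bar>A d y\<bar> \<le> (\<integral>z. \<bar>g z * bump d (z - y)\<bar> \<partial>lborel)"
        unfolding A_def by (rule integral_abs_bound)
      also have "\<dots> \<le> (\<integral>z. Bg * bump d (z - y) \<partial>lborel)"
        using Bg igb ib[OF that] by (intro integral_mono integrable_abs)
          (auto simp: abs_mult bump_nonneg intro!: mult_right_mono)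
      finally show ?thesis by (simp add: mb)
    qed
    define t where "t n = r / real (Suc n)" for n
    have t: "0 < t n" "t n \<le> r" for n
      using r by (auto simp: t_def divide_le_eq mult_le_cancel_left1)
    have t0: "t \<longlonglongrightarrow> 0"
      unfolding t_def by (intro LIMSEQ_Suc lim_const_over_n)
    have lim: "(\<lambda>n. A (t n) y / bump_mass (t n)) \<longlonglongrightarrow> g y" for y
    proof (rule LIMSEQ_I)
      fix a :: real assume a: "a > 0"
      have "isCont g y" using g(1) by (simp add: continuous_on_eq_continuous_at)
      then obtain s where s: "s > 0" "\<And>z. norm (z - y) < s \<Longrightarrow> norm (g z - g y) < a / 2"
        using a unfolding isCont_def LIM_def dist_norm
        by (metis half_gt_zero diff_self norm_zero)
      obtain N where N: "\<And>n. n \<ge> N \<Longrightarrow> t n < s"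
        using LIMSEQ_D[OF t0 s(1)] t by (metis abs_of_pos diff_zero real_norm_def)
      have "norm (A (t n) y / bump_mass (t n) - g y) < a" if "n \<ge> N" for n
      proof -
        have mp: "bump_mass (t n) > 0" using t by (intro bump_mass_pos)
        have "A (t n) y - g y * bump_mass (t n) = (\<integral>z. (g z - g y) * bump (t n) (z - y) \<partial>lborel)"
          unfolding A_def mb[symmetric, of "t n" y] using igb ib t[of n] by (simp add: left_diff_distrib)
        also have "\<bar>\<dots>\<bar> \<le> (\<integral>z. \<bar>(g z - g y) * bump (t n) (z - y)\<bar> \<partial>lborel)"
          by (rule integral_abs_bound)
        also have "\<dots> \<le> (\<integral>z. a / 2 * bump (t n) (z - y) \<partial>lborel)"
        proof (rule integral_mono)
          show "integrable lborel (\<lambda>z. \<bar>(g z - g y) * bump (t n) (z - y)\<bar>)"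
            using igb ib[of "t n" y] t[of n] by (intro integrable_abs) (simp add: left_diff_distrib)
          show "integrable lborel (\<lambda>z. a / 2 * bump (t n) (z - y))"
            using ib[of "t n" y] t[of n] by simp
          show "\<bar>(g z - g y) * bump (t n) (z - y)\<bar> \<le> a / 2 * bump (t n) (z - y)" for z
          proof (cases "z - y \<in> cball 0 (t n)")
            case True
            then have "norm (z - y) < s" using N[OF that] by simp
            then have "\<bar>g z - g y\<bar> \<le> a / 2" using s(2)[of z] by simp
            from mult_right_mono[OF this bump_nonneg] show ?thesis by (simp add: abs_mult bump_nonneg)
          next
            case False
            then show ?thesis using bump_eq_0[of "t n" "z - y"] t[of n] by simp
          qed
        qed
        also have "\<dots> = a / 2 * bump_mass (t n)" by (simp add: mb)
        finally have "\<bar>A (t n) y / bump_mass (t n) - g y\<bar> \<le> a / 2"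
          using mp by (simp add: field_simps abs_le_iff)
        then show ?thesis using a by simp
      qed
      then show "\<exists>N. \<forall>n\<ge>N. norm (A (t n) y / bump_mass (t n) - g y) < a" by blast
    qed
    have "(\<lambda>n. \<integral>y. of_real (A (t n) y / bump_mass (t n)) * V y \<partial>lborel) \<longlonglongrightarrow> (\<integral>y. of_real (g y) * V y \<partial>lborel)"
    proof (rule integral_dominated_convergence[where w="\<lambda>y. Bg * norm (V y)"])
      show "AE y in lborel. (\<lambda>n. complex_of_real (A (t n) y / bump_mass (t n)) * V y) \<longlonglongrightarrow> of_real (g y) * V y"
        by (intro AE_I2 tendsto_mult tendsto_of_real lim tendsto_const)
      show "AE y in lborel. norm (complex_of_real (A (t n) y / bump_mass (t n)) * V y) \<le> Bg * norm (V y)" for n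
      proof (intro AE_I2)
        fix y
        have "bump_mass (t n) > 0" using t by (intro bump_mass_pos)
        then have "\<bar>A (t n) y / bump_mass (t n)\<bar> \<le> Bg"
          using A_bound[of "t n" y] t[of n] by (simp add: abs_divide divide_le_eq)
        then show "norm (complex_of_real (A (t n) y / bump_mass (t n)) * V y) \<le> Bg * norm (V y)"
          unfolding norm_mult norm_of_real by (rule mult_right_mono) auto
      qed
      show "integrable lborel (\<lambda>y. Bg * norm (V y))" using V by auto
    qed measurable
    moreover have "(\<integral>y. of_real (A (t n) y / bump_mass (t n)) * V y \<partial>lborel) = (\<integral>z. of_real (g z) * k z \<partial>lborel)" for n
    proof -
      have "bump_mass (t n) > 0" using t by (intro bump_mass_pos)
      moreover have "(\<lambda>y. of_real (A (t n) y / bump_mass (t n)) * V y) = (\<lambda>y. (of_real (A (t n) y) * V y) / bump_mass (t n))"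
        by auto
      ultimately show ?thesis by (simp flip: eq[OF t])
    qed
    ultimately have "(\<integral>z. of_real (g z) * k z \<partial>lborel) = (\<integral>y. of_real (g y) * V y \<partial>lborel)"
      by (simp add: LIMSEQ_const_iff)
    moreover have "g z = 0" if "z \<notin> cball z0 r" for z
      using that g(3,4) ball_subset_cball by blast
    then have "(\<lambda>z. of_real (g z) * W z) = (\<lambda>z. of_real (g z) * V z - of_real (g z) * k z)"
      by (auto simp: W_def algebra_simps fun_eq_iff)
    moreover have "integrable lborel (\<lambda>z. of_real (g z) * V z)"
      by (rule integrable_bounded_mult[OF V, where B=Bg]) (use Bg in auto)
    moreover have "integrable lborel (\<lambda>z. of_real (g z) * k z)"
      by (rule integrable_compact_support[OF g(2)])
        (use g(4) in \<open>auto intro!: continuous_intros continuous_on_subset[OF g(1)]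
          continuous_on_subset[OF contk order_trans[OF g(3) ball_subset_cball]]\<close>)
    ultimately show "(\<integral>z. of_real (g z) * W z \<partial>lborel) = 0" by simp
  qed
  then have "negligible {z \<in> ball z0 r. V z \<noteq> k z}"
    by (rule negligible_subset) (auto simp: W_def)
  moreover have "k holomorphic_on ball z0 r"
    using r by (intro holomorphic_on_subset[OF holk]) auto
  ultimately show ?thesis using that by blast
qed

text \<open>Bumps are admissible test functions, so the weak equation on \<open>D\<close> supplies
  the hypothesis \<open>weak\<close> of \<open>weyl_local\<close>.\<close>

lemma test_function_bump:
  assumes "0 < e" "cball z e \<subseteq> D"
  shows "test_function D (\<lambda>y. of_real (bump e (z - y)))"
    and "d_zbar (\<lambda>y. of_real (bump e (z - y))) y = - bump_grad e (z - y) / 2"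
proof -
  have "Ck_on k UNIV (\<lambda>y. complex_of_real (bump e (z - y)))" for k
  proof -
    have "Ck_on k UNIV (\<lambda>y. - 1 * (cmod (y - z))\<^sup>2)"
      by (intro Ck_on_mult Ck_on_const Ck_on_cmod_sq open_UNIV)
    then have "Ck_on k UNIV (\<lambda>y. e\<^sup>2 + - 1 * (cmod (y - z))\<^sup>2)"
      by (intro Ck_on_add Ck_on_const open_UNIV)
    then have "Ck_on k UNIV (\<lambda>y. flat 1 (e\<^sup>2 + - 1 * (cmod (y - z))\<^sup>2))"
      by (intro Ck_on_compose_real[where I=UNIV and f=flat]) (auto intro: DERIV_flat)
    from Ck_on_bounded_linear[OF open_UNIV bounded_linear_of_real this]
    show ?thesis by (simp add: bump_def norm_minus_commute)
  qed
  then show "test_function D (\<lambda>y. of_real (bump e (z - y)))"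
    unfolding test_function_def smooth_on_def
    using assms by (auto intro!: exI[of _ "cball z e"] bump_eq_0 simp: dist_norm norm_minus_commute)
  have "((\<lambda>y. complex_of_real (bump e (z - y))) has_derivative
      (\<lambda>h. - cnj (bump_grad e (z - y)) / 2 * h + - bump_grad e (z - y) / 2 * cnj h)) (at y)"
  proof (rule has_derivative_eq_rhs)
    show "((\<lambda>y. complex_of_real (bump e (z - y))) has_derivative
      (\<lambda>h. of_real (bump_grad e (z - y) \<bullet> (- h)))) (at y)"
      by (intro has_derivative_of_real has_derivative_compose[where g="bump e", OF _ has_derivative_bump])
        (auto intro!: derivative_eq_intros)
    show "(\<lambda>h. complex_of_real (bump_grad e (z - y) \<bullet> - h)) =
      (\<lambda>h. - cnj (bump_grad e (z - y)) / 2 * h + - bump_grad e (z - y) / 2 * cnj h)"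
      by (rule ext) (simp add: complex_eq_iff inner_complex_def field_simps)
  qed
  from wirtinger_eqI(2)[OF this]
  show "d_zbar (\<lambda>y. of_real (bump e (z - y))) y = - bump_grad e (z - y) / 2" .
qed

text \<open>Local holomorphic representatives come from \<open>weyl_local\<close>. Two of them agree
  almost everywhere on the overlap of their discs, hence everywhere by continuity, so they glue; the
  Lindelof property reduces the exceptional sets to countably many.\<close>

lemma weyl_dbar:
  fixes U :: "complex \<Rightarrow> complex"
  assumes "open D" and meas: "U \<in> borel_measurable (lebesgue_on D)"
    and loc: "\<And>K. compact K \<Longrightarrow> K \<subseteq> D \<Longrightarrow> integrable (lebesgue_on K) U"
    and weak: "\<And>\<psi>. test_function D \<psi> \<Longrightarrow> (\<integral>z. d_zbar \<psi> z * U z \<partial>lebesgue_on D) = 0"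
  obtains k where "k holomorphic_on D" "negligible {z \<in> D. U z \<noteq> k z}"
proof -
  have D: "D \<in> sets lebesgue" "D \<in> sets borel" using \<open>open D\<close> by auto
  have mU: "(\<lambda>z. if z \<in> D then U z else 0) \<in> borel_measurable lebesgue"
    by (rule borel_measurable_if_I[OF meas D(1)])
  \<comment> \<open>A Borel representative of the Lebesgue measurable \<open>U\<close>, because the
    local argument runs over \<open>lborel\<close>.\<close>
  obtain U' where U': "U' \<in> borel_measurable lborel" "AE z in lborel. (if z \<in> D then U z else 0) = U' z"
  proof -
    have m: "(\<lambda>z. Re (if z \<in> D then U z else 0)) \<in> borel_measurable lebesgue"
      "(\<lambda>z. Im (if z \<in> D then U z else 0)) \<in> borel_measurable lebesgue"
      by (intro borel_measurable_Re borel_measurable_Im measurable_compose[OF mU]; simp)+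
    obtain g1 g2 where g: "g1 \<in> borel_measurable lborel" "g2 \<in> borel_measurable lborel"
      "AE z in lborel. Re (if z \<in> D then U z else 0) = g1 z"
      "AE z in lborel. Im (if z \<in> D then U z else 0) = g2 z"
      using completion_ex_borel_measurable_real[OF m(1)] completion_ex_borel_measurable_real[OF m(2)]
      by blast
    have "(\<lambda>z. of_real (g1 z) + \<i> * of_real (g2 z)) \<in> borel_measurable lborel" using g(1,2) by measurable
    moreover have "AE z in lborel. (if z \<in> D then U z else 0) = of_real (g1 z) + \<i> * of_real (g2 z)"
      using g(3,4) by eventually_elim (simp add: complex_eq_iff)
    ultimately show ?thesis using that by blast
  qed
  have AE_U: "AE z in lebesgue. z \<in> D \<longrightarrow> U z = U' z"
    using AE_completion[OF U'(2)] by eventually_elim auto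
  have neg_U: "negligible {z \<in> D. U z \<noteq> U' z}"
  proof -
    obtain N where N: "N \<in> null_sets lebesgue" "{z \<in> space lebesgue. \<not> (z \<in> D \<longrightarrow> U z = U' z)} \<subseteq> N"
      using AE_U by (auto simp: eventually_ae_filter)
    have "negligible N" using N(1) by (simp add: negligible_iff_null_sets)
    then show ?thesis by (rule negligible_subset) (use N(2) in auto)
  qed
  have [measurable]: "U' \<in> borel_measurable borel" using U'(1) by simp
  have "\<exists>r k. r > 0 \<and> ball z0 r \<subseteq> D \<and> k holomorphic_on ball z0 r \<and> negligible {z \<in> ball z0 r. U z \<noteq> k z}"
    if "z0 \<in> D" for z0
  proof -
    obtain R where R: "R > 0" "cball z0 R \<subseteq> D" using \<open>z0 \<in> D\<close> \<open>open D\<close> unfolding open_contains_cball by auto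
    \<comment> \<open>Centres in the ball of radius 2 r and bump radii at most r keep all supports
      inside the ball of radius 4 r, where \<open>V\<close> agrees with \<open>U\<close> almost
      everywhere.\<close>
    define r where "r = R / 4"
    have r: "r > 0" "cball z0 (4 * r) \<subseteq> D" using R by (auto simp: r_def)
    define V where "V z = (if z \<in> cball z0 (4 * r) then U' z else 0)" for z
    have [measurable]: "cball z0 (4 * r) \<in> sets borel" by simp
    have mV [measurable]: "V \<in> borel_measurable borel" unfolding V_def by measurable
    have "integrable (lebesgue_on (cball z0 (4 * r))) U" by (rule loc) (use r in auto)
    then have i: "integrable lebesgue (\<lambda>z. indicator (cball z0 (4 * r)) z *\<^sub>R U z)"
      by (simp add: integrable_restrict_space set_integrable_def)
    have mV': "V \<in> borel_measurable lebesgue" using measurable_completion[of V lborel borel] mV by simp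
    have "AE z in lebesgue. indicator (cball z0 (4 * r)) z *\<^sub>R U z = V z"
      using AE_U by eventually_elim (use r(2) in \<open>auto simp: V_def indicator_def\<close>)
    then have "integrable lebesgue V"
      using integrable_cong_AE[OF borel_measurable_integrable[OF i] mV'] i by simp
    then have iV: "integrable lborel V" using integrable_completion[of V lborel] by simp
    obtain k where k: "k holomorphic_on ball z0 r" "negligible {z \<in> ball z0 r. V z \<noteq> k z}"
    proof (rule weyl_local[OF iV r(1)])
      fix z e assume z: "z \<in> ball z0 (2 * r)" and e: "0 < e" "e \<le> r"
      have sub: "cball z e \<subseteq> cball z0 (4 * r)"
      proof
        fix x assume "x \<in> cball z e"
        then show "x \<in> cball z0 (4 * r)" using z e r(1) dist_triangle[of z0 x z] by simp
      qed
      then have subD: "cball z e \<subseteq> D" using r(2) by auto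
      note tf = test_function_bump[OF e(1) subD]
      have "0 = (\<integral>y. - bump_grad e (z - y) / 2 * U y \<partial>lebesgue_on D)"
        using weak[OF tf(1)] tf(2) by simp
      also have "\<dots> = (\<integral>y. indicator D y *\<^sub>R (- bump_grad e (z - y) / 2 * U y) \<partial>lebesgue)"
        using D by (intro integral_restrict_space) auto
      also have "\<dots> = (\<integral>y. - bump_grad e (z - y) / 2 * V y \<partial>lebesgue)"
      proof (rule integral_cong_AE)
        have bg: "(\<lambda>y. - bump_grad e (z - y) / 2) \<in> borel_measurable lebesgue"
          by (intro measurable_completion) simp
        then show "(\<lambda>y. - bump_grad e (z - y) / 2 * V y) \<in> borel_measurable lebesgue"
          using mV' by (intro borel_measurable_times)
        have "(\<lambda>y. - bump_grad e (z - y) / 2 * (if y \<in> D then U y else 0)) \<in> borel_measurable lebesgue"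
          using bg mU by (intro borel_measurable_times)
        also have "(\<lambda>y. - bump_grad e (z - y) / 2 * (if y \<in> D then U y else 0))
          = (\<lambda>y. indicator D y *\<^sub>R (- bump_grad e (z - y) / 2 * U y))" by auto
        finally show "(\<lambda>y. indicator D y *\<^sub>R (- bump_grad e (z - y) / 2 * U y)) \<in> borel_measurable lebesgue" .
        show "AE y in lebesgue. indicator D y *\<^sub>R (- bump_grad e (z - y) / 2 * U y) = - bump_grad e (z - y) / 2 * V y"
          using AE_U
        proof eventually_elim
          case (elim y)
          show ?case
          proof (cases "y \<in> cball z e")
            case True
            then have "y \<in> D" "y \<in> cball z0 (4 * r)" using sub subD by auto
            then show ?thesis using elim by (simp add: V_def)
          next
            case False
            then have "z - y \<notin> cball 0 e" by (simp add: dist_norm norm_minus_commute)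
            then show ?thesis using bump_grad_eq_0[of e "z - y"] e by simp
          qed
        qed
      qed
      also have "\<dots> = (\<integral>y. - bump_grad e (z - y) / 2 * V y \<partial>lborel)"
        by (rule integral_completion) measurable
      also have "\<dots> = (\<integral>y. (- 1 / 2) * (bump_grad e (z - y) * V y) \<partial>lborel)"
        by (simp add: mult.assoc)
      also have "\<dots> = (- 1 / 2) * (\<integral>y. bump_grad e (z - y) * V y \<partial>lborel)"
        by (rule integral_mult_right_zero)
      finally show "(\<integral>y. bump_grad e (z - y) * V y \<partial>lborel) = 0" by simp
    qed
    have sub: "ball z0 r \<subseteq> D" using r by (auto intro!: subset_trans[OF _ r(2)])
    have "negligible ({z \<in> ball z0 r. V z \<noteq> k z} \<union> {z \<in> D. U z \<noteq> U' z})"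
      using k(2) neg_U by (rule negligible_Un)
    then have "negligible {z \<in> ball z0 r. U z \<noteq> k z}"
      by (rule negligible_subset) (use r sub in \<open>auto simp: V_def\<close>)
    then show ?thesis using k(1) r(1) sub by blast
  qed
  then obtain r \<kappa> where r\<kappa>: "\<And>z. z \<in> D \<Longrightarrow> r z > 0 \<and> ball z (r z) \<subseteq> D \<and> \<kappa> z holomorphic_on ball z (r z) \<and>
      negligible {y \<in> ball z (r z). U y \<noteq> \<kappa> z y}"
    by metis
  \<comment> \<open>Each point takes the value of the representative on its own disc;
    \<open>eq\<close> shows that every other disc containing the point gives the same value.\<close>
  define k where "k z = \<kappa> z z" for z
  have eq: "k y = \<kappa> z0 y" if z0: "z0 \<in> D" and y: "y \<in> ball z0 (r z0)" for z0 y
  proof -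
    have yD: "y \<in> D" using r\<kappa>[OF z0] y by auto
    let ?S = "ball z0 (r z0) \<inter> ball y (r y)"
    have "\<kappa> y y = \<kappa> z0 y"
    proof (rule continuous_eq_of_negligible[where U="?S" and f="\<kappa> y" and g="\<kappa> z0" and z=y])
      show "continuous_on ?S (\<kappa> y)" "continuous_on ?S (\<kappa> z0)"
        using r\<kappa>[OF yD] r\<kappa>[OF z0] by (auto intro!: holomorphic_on_imp_continuous_on intro: holomorphic_on_subset)
      have "negligible ({x \<in> ball y (r y). U x \<noteq> \<kappa> y x} \<union> {x \<in> ball z0 (r z0). U x \<noteq> \<kappa> z0 x})"
        using r\<kappa>[OF yD] r\<kappa>[OF z0] by (intro negligible_Un) auto
      then show "negligible {x \<in> ?S. \<kappa> y x \<noteq> \<kappa> z0 x}"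
        by (rule negligible_subset) auto
    qed (use r\<kappa>[OF yD] y in auto)
    then show ?thesis by (simp add: k_def)
  qed
  have "k holomorphic_on D"
  proof (rule holomorphic_onI)
    fix z assume z: "z \<in> D"
    have "k holomorphic_on ball z (r z)"
      using r\<kappa>[OF z] eq[OF z] by (auto intro: holomorphic_transform)
    then have "k field_differentiable at z"
      using r\<kappa>[OF z] by (intro holomorphic_on_imp_differentiable_at) auto
    then show "k field_differentiable at z within D" by (rule field_differentiable_at_within)
  qed
  moreover have "negligible {z \<in> D. U z \<noteq> k z}"
  proof -
    obtain F where F: "F \<subseteq> (\<lambda>z. ball z (r z)) ` D" "countable F" "\<Union> F = \<Union> ((\<lambda>z. ball z (r z)) ` D)"
      using Lindelof[of "(\<lambda>z. ball z (r z)) ` D"] by auto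
    have neg: "negligible (\<Union>B\<in>F. {z \<in> B. U z \<noteq> k z})"
    proof (rule negligible_countable_Union)
      fix S assume "S \<in> (\<lambda>B. {z \<in> B. U z \<noteq> k z}) ` F"
      then obtain z where z: "z \<in> D" "S = {y \<in> ball z (r z). U y \<noteq> k y}" using F(1) by auto
      have "S = {y \<in> ball z (r z). U y \<noteq> \<kappa> z y}" unfolding z(2) using eq[OF z(1)] by auto
      then show "negligible S" using r\<kappa>[OF z(1)] by simp
    qed (use F(2) in auto)
    have "D \<subseteq> \<Union> F" unfolding F(3) using r\<kappa> by force
    then show ?thesis by (intro negligible_subset[OF neg]) blast
  qed
  ultimately show ?thesis using that by blast
qed

section \<open>Hermitian forms\<close>

lemma hprod_add: "hprod h (a + b) c = hprod h a c + hprod h b c"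
  "hprod h a (b + c) = hprod h a b + hprod h a c"
  by (simp_all add: hprod_def algebra_simps sum.distrib)

lemma hprod_scale: "hprod h (c *s a) b = c * hprod h a b" "hprod h a (c *s b) = cnj c * hprod h a b"
  by (simp_all add: hprod_def sum_distrib_left algebra_simps)

lemma hprod_zero: "hprod h 0 a = 0" "hprod h a 0 = 0"
  by (simp_all add: hprod_def)

lemma hprod_commute: "pos_def_hermitian h \<Longrightarrow> hprod h b a = cnj (hprod h a b)"
proof -
  assume "pos_def_hermitian h"
  then have h: "h $ j $ i = cnj (h $ i $ j)" for i j unfolding pos_def_hermitian_def by blast
  have "cnj (hprod h a b) = (\<Sum>i\<in>UNIV. \<Sum>j\<in>UNIV. h $ j $ i * cnj (a $ i) * b $ j)"
    unfolding hprod_def by (simp add: h[symmetric])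
  also have "\<dots> = (\<Sum>j\<in>UNIV. \<Sum>i\<in>UNIV. h $ j $ i * cnj (a $ i) * b $ j)"
    by (rule sum.swap)
  also have "\<dots> = hprod h b a"
    unfolding hprod_def by (simp add: mult_ac)
  finally show ?thesis by simp
qed

lemma hnorm_sq_zero [simp]: "hnorm_sq h 0 = 0"
  by (simp add: hnorm_sq_def hprod_zero)

lemma hnorm_sq_nonneg: "pos_def_hermitian h \<Longrightarrow> 0 \<le> hnorm_sq h a"
  by (cases "a = 0") (auto simp: pos_def_hermitian_def less_imp_le)

lemma hnorm_sq_scale: "hnorm_sq h (c *s a) = (cmod c)\<^sup>2 * hnorm_sq h a"
proof -
  have "hprod h (c *s a) (c *s a) = of_real ((cmod c)\<^sup>2) * hprod h a a"
    by (simp add: hprod_scale complex_mult_cnj[symmetric] cmod_power2 mult_ac flip: complex_norm_square)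
  then show ?thesis by (simp add: hnorm_sq_def)
qed

lemma hnorm_sq_add:
  "pos_def_hermitian h \<Longrightarrow> hnorm_sq h (a + b) = hnorm_sq h a + hnorm_sq h b + 2 * Re (hprod h a b)"
  unfolding hnorm_sq_def using hprod_commute[of h a b] by (simp add: hprod_add)

text \<open>Positivity of the form on a + b and a - b bounds the real part, and i b in place of b
  bounds the imaginary part. The constant is crude: the estimate serves only to prove
  integrability.\<close>

lemma norm_hprod_le:
  assumes "pos_def_hermitian h"
  shows "cmod (hprod h a b) \<le> hnorm_sq h a + hnorm_sq h b"
proof -
  have *: "2 * \<bar>Re (hprod h a b)\<bar> \<le> hnorm_sq h a + hnorm_sq h b" for b
    using hnorm_sq_nonneg[OF assms, of "a + b"] hnorm_sq_nonneg[OF assms, of "a + (-1) *s b"]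
    unfolding hnorm_sq_add[OF assms] hnorm_sq_scale hprod_scale by simp
  have "2 * \<bar>Im (hprod h a b)\<bar> \<le> hnorm_sq h a + hnorm_sq h b"
    using *[of "\<i> *s b"] unfolding hnorm_sq_scale hprod_scale by simp
  with *[of b] show ?thesis using cmod_le[of "hprod h a b"] by linarith
qed

text \<open>Expansion of the square of sqrt t a - b / sqrt t. For small t the coefficient of the
  first term is close to 1, which the sharp constant requires.\<close>

lemma hnorm_sq_add_le:
  assumes "pos_def_hermitian h" "t > 0"
  shows "hnorm_sq h (a + b) \<le> (1 + t) * hnorm_sq h a + (1 + 1 / t) * hnorm_sq h b"
proof -
  let ?s = "complex_of_real (sqrt t)"
  have s: "cmod ?s = sqrt t" "(sqrt t)\<^sup>2 = t" using assms(2) by auto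
  have "0 \<le> hnorm_sq h (?s *s a + (- 1 / ?s) *s b)" by (rule hnorm_sq_nonneg[OF assms(1)])
  also have "\<dots> = t * hnorm_sq h a + hnorm_sq h b / t - 2 * Re (hprod h a b)"
    unfolding hnorm_sq_add[OF assms(1)] hnorm_sq_scale hprod_scale
    using assms(2) s by (simp add: norm_divide power_divide real_sqrt_pow2)
  finally show ?thesis unfolding hnorm_sq_add[OF assms(1)] by (simp add: algebra_simps)
qed

lemma continuous_on_hprod [continuous_intros]:
  "continuous_on S h \<Longrightarrow> continuous_on S a \<Longrightarrow> continuous_on S b \<Longrightarrow>
    continuous_on S (\<lambda>z. hprod (h z) (a z) (b z))"
  unfolding hprod_def by (intro continuous_intros)

lemma continuous_on_hnorm_sq [continuous_intros]:
  "continuous_on S h \<Longrightarrow> continuous_on S a \<Longrightarrow> continuous_on S (\<lambda>z. hnorm_sq (h z) (a z))"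
  unfolding hnorm_sq_def by (intro continuous_intros)

lemma norm_vec_scale: "norm (c *s (a :: complex^'r)) = cmod c * norm a"
  by (simp add: norm_vec_def L2_set_def norm_mult power_mult_distrib sum_distrib_left[symmetric]
      real_sqrt_mult)

text \<open>Extreme values on the product of \<open>K\<close> with the compact unit sphere, then
  homogeneity.\<close>

lemma hnorm_sq_bounds_compact:
  fixes h :: "complex \<Rightarrow> complex^'r^'r"
  assumes "compact K" "continuous_on K h" "\<And>z. z \<in> K \<Longrightarrow> pos_def_hermitian (h z)"
  obtains c C where "c > 0" "C > 0" "\<And>z a. z \<in> K \<Longrightarrow> c * (norm a)\<^sup>2 \<le> hnorm_sq (h z) a"
    "\<And>z a. z \<in> K \<Longrightarrow> hnorm_sq (h z) a \<le> C * (norm a)\<^sup>2"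
proof (cases "K = {}")
  case True
  then show ?thesis using that[of 1 1] by auto
next
  case False
  let ?X = "K \<times> sphere (0 :: complex^'r) 1" and ?f = "\<lambda>p :: complex \<times> (complex^'r). hnorm_sq (h (fst p)) (snd p)"
  have comp: "compact ?X" using assms(1) by (intro compact_Times) auto
  have "axis undefined 1 \<in> sphere (0 :: complex^'r) 1"     by (simp add: norm_vec_def L2_set_def axis_def if_distrib[of cmod] if_distrib[of "\<lambda>x. x\<^sup>2"] cong: if_cong)
  then have ne: "?X \<noteq> {}" using False by blast
  have cont: "continuous_on ?X ?f"
    by (intro continuous_intros continuous_on_compose2[OF assms(2)]) auto
  obtain p where p: "p \<in> ?X" "\<And>q. q \<in> ?X \<Longrightarrow> ?f p \<le> ?f q"
    using continuous_attains_inf[OF comp ne cont] by blast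
  obtain P where P: "P \<in> ?X" "\<And>q. q \<in> ?X \<Longrightarrow> ?f q \<le> ?f P"
    using continuous_attains_sup[OF comp ne cont] by blast
  have pos: "?f q > 0" if "q \<in> ?X" for q
  proof -
    have "snd q \<noteq> 0" "fst q \<in> K" using that by auto
    then show ?thesis using assms(3)[of "fst q"] unfolding pos_def_hermitian_def by blast
  qed
  have scale: "hnorm_sq (h z) a = (norm a)\<^sup>2 * ?f (z, of_real (1 / norm a) *s a)" if "a \<noteq> 0" for z a
    using that by (simp add: hnorm_sq_scale norm_divide power_divide)
  have inX: "(z, of_real (1 / norm a) *s a) \<in> ?X" if "a \<noteq> 0" "z \<in> K" for z a
    using that by (simp add: norm_vec_scale norm_divide)
  show ?thesis
  proof (rule that[OF pos[OF p(1)] pos[OF P(1)]])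
    fix z and a :: "complex^'r" assume z: "z \<in> K"
    show "?f p * (norm a)\<^sup>2 \<le> hnorm_sq (h z) a"
      using p(2)[OF inX[OF _ z, of a]] scale[of a z] by (cases "a = 0") (auto simp: mult.commute mult_right_mono)
    show "hnorm_sq (h z) a \<le> ?f P * (norm a)\<^sup>2"
      using P(2)[OF inX[OF _ z, of a]] scale[of a z] by (cases "a = 0") (auto simp: mult.commute mult_right_mono)
  qed
qed

text \<open>With c the lower bound of \<open>h w\<close> against the Euclidean norm and N the rank,
  entries of h z - h w of size at most t c / N^2 add up to an error of at most t times the form
  \<open>h w\<close>. The comparison is multiplicative, so it costs only a factor 1 + t in the final
  constant.\<close>

lemma hnorm_sq_le_near:
  fixes h :: "complex \<Rightarrow> complex^'r^'r"
  assumes "open D" "continuous_hermitian_metric D h" "w \<in> D" "t > 0"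
  obtains r where "r > 0" "cball w r \<subseteq> D"
    "\<And>z a. z \<in> cball w r \<Longrightarrow> hnorm_sq (h z) a \<le> (1 + t) * hnorm_sq (h w) a"
proof -
  have cont: "continuous_on D h" and pd: "\<And>z. z \<in> D \<Longrightarrow> pos_def_hermitian (h z)"
    using assms(2) by (auto simp: continuous_hermitian_metric_def)
  obtain c C where c: "c > 0" "\<And>a. c * (norm a)\<^sup>2 \<le> hnorm_sq (h w) a"
  proof (rule hnorm_sq_bounds_compact[of "{w}" h])
    fix c C :: real
    assume "c > 0" "\<And>z a. z \<in> {w} \<Longrightarrow> c * (norm a)\<^sup>2 \<le> hnorm_sq (h z) a"
    then show thesis using that by blast
  qed (use pd[OF assms(3)] in auto)
  let ?N = "real (CARD('r))"
  have "isCont h w" using cont assms(1,3) continuous_on_eq_continuous_at by blast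
  then obtain d where d: "d > 0" "\<And>z. dist z w < d \<Longrightarrow> norm (h z - h w) < t * c / ?N\<^sup>2"
    unfolding continuous_at_eps_delta dist_norm using assms(4) c(1)
    by (metis divide_pos_pos mult_pos_pos of_nat_0_less_iff zero_less_card_finite zero_less_power)
  obtain e where e: "e > 0" "cball w e \<subseteq> D" using assms(1,3) open_contains_cball by blast
  define r where "r = min e (d / 2)"
  show ?thesis
  proof (rule that)
    show "r > 0" using d e by (simp add: r_def)
    show "cball w r \<subseteq> D" using e(2) by (auto simp: r_def)
    fix z and a :: "complex^'r" assume z: "z \<in> cball w r"
    then have "dist z w < d" using d(1) by (auto simp: r_def dist_commute)
    from d(2)[OF this] have M: "norm (h z - h w) \<le> t * c / ?N\<^sup>2" by simp
    have "hprod (h z) a a - hprod (h w) a a = hprod (h z - h w) a a"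
      by (simp add: hprod_def algebra_simps sum_subtractf)
    also have "cmod \<dots> \<le> (\<Sum>i\<in>(UNIV::'r set). \<Sum>j\<in>(UNIV::'r set). t * c / ?N\<^sup>2 * (norm a)\<^sup>2)"
      unfolding hprod_def
    proof (intro sum_norm_le)
      fix i j
      have "cmod ((h z - h w) $ i $ j) \<le> t * c / ?N\<^sup>2"
        using M Finite_Cartesian_Product.norm_nth_le[of "h z - h w" i]
          Finite_Cartesian_Product.norm_nth_le[of "(h z - h w) $ i" j] by linarith
      moreover have "cmod (a $ i) * cmod (a $ j) \<le> norm a * norm a"
        by (intro mult_mono Finite_Cartesian_Product.norm_nth_le) auto
      ultimately have "cmod ((h z - h w) $ i $ j) * (cmod (a $ i) * cmod (a $ j)) \<le> t * c / ?N\<^sup>2 * (norm a * norm a)"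
        using assms(4) c(1) by (rule_tac mult_mono) auto
      then show "cmod ((h z - h w) $ i $ j * a $ i * cnj (a $ j)) \<le> t * c / ?N\<^sup>2 * (norm a)\<^sup>2"
        by (simp add: norm_mult power2_eq_square mult.assoc)
    qed
    also have "\<dots> = t * (c * (norm a)\<^sup>2)" by (simp add: power2_eq_square field_simps)
    also have "\<dots> \<le> t * hnorm_sq (h w) a" using c(2) assms(4) by (intro mult_left_mono) auto
    finally have "Re (hprod (h z) a a - hprod (h w) a a) \<le> t * hnorm_sq (h w) a"
      using complex_Re_le_cmod order_trans by blast
    then show "hnorm_sq (h z) a \<le> (1 + t) * hnorm_sq (h w) a"
      by (simp add: hnorm_sq_def algebra_simps)
  qed
qed

section \<open>The Hoermander estimate for explicit data\<close>

lemma borel_measurable_lebesgue_on_continuous: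
  "open D \<Longrightarrow> continuous_on D f \<Longrightarrow> f \<in> borel_measurable (lebesgue_on D)"
  by (intro continuous_imp_measurable_on_sets_lebesgue) auto

lemma integrable_lebesgue_on_compact:
  fixes f :: "complex \<Rightarrow> 'b::{banach, second_countable_topology}"
  assumes "compact K" "continuous_on K f"
  shows "integrable (lebesgue_on K) f"
proof -
  have i: "integrable lborel (\<lambda>x. indicator K x *\<^sub>R f x)" by (rule borel_integrable_compact[OF assms])
  then have "integrable lebesgue (\<lambda>x. indicator K x *\<^sub>R f x)"
    by (subst integrable_completion) auto
  moreover have "K \<in> sets lebesgue" using assms(1) by (simp add: lmeasurable_compact fmeasurableD)
  ultimately show ?thesis by (simp add: integrable_restrict_space set_integrable_def)
qed

lemma AE_lebesgue_on_negligible: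
  assumes "open D" "negligible {z \<in> D. \<not> P z}"
  shows "AE z in lebesgue_on D. P z"
proof -
  have "{z \<in> D. \<not> P z} \<in> null_sets lebesgue" using assms(2) by (simp add: negligible_iff_null_sets)
  then have "AE z in lebesgue. z \<notin> {z \<in> D. \<not> P z}" by (rule AE_not_in)
  then have "AE z in lebesgue. z \<in> D \<longrightarrow> P z" by eventually_elim auto
  then show ?thesis using assms(1) by (subst AE_restrict_space_iff) auto
qed

lemma continuous_on_vec_scale [continuous_intros]:
  fixes f :: "'a::topological_space \<Rightarrow> complex" and g :: "'a \<Rightarrow> complex^'r"
  assumes "continuous_on S f" "continuous_on S g"
  shows "continuous_on S (\<lambda>z. f z *s g z)"
  unfolding vector_scalar_mult_def
  by (intro continuous_on_vec_lambda continuous_on_mult continuous_on_component assms)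

lemma integrable_compact_support_scale:
  fixes U :: "complex \<Rightarrow> complex^'r"
  assumes "open D" "compact K" "K \<subseteq> D" and f: "continuous_on UNIV f" "\<And>z. z \<notin> K \<Longrightarrow> f z = 0"
    and U: "U \<in> borel_measurable (lebesgue_on D)" "integrable (lebesgue_on K) U"
  shows "integrable (lebesgue_on D) (\<lambda>z. f z *s U z)"
proof -
  obtain B where B: "B > 0" "\<And>z. norm (f z) \<le> B"
  proof (rule continuous_compact_support_bounded[OF assms(2) continuous_on_subset[OF f(1)] f(2)])
    fix B :: real assume "B > 0" "\<And>z. norm (f z) \<le> B"
    then show thesis using that by blast
  qed auto
  have s: "D \<in> sets lebesgue" "K \<in> sets lebesgue" using assms(1,2) by (auto simp: lmeasurable_compact fmeasurableD)
  have "integrable lebesgue (\<lambda>z. indicator K z *\<^sub>R U z)"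
    using U(2) s by (simp add: integrable_restrict_space set_integrable_def)
  also have "(\<lambda>z. indicator K z *\<^sub>R U z) = (\<lambda>z. indicator D z *\<^sub>R (indicator K z *\<^sub>R U z))"
    using assms(3) by (auto simp: indicator_def fun_eq_iff)
  finally have i: "integrable (lebesgue_on D) (\<lambda>z. indicator K z *\<^sub>R U z)"
    using s by (simp add: integrable_restrict_space set_integrable_def)
  show ?thesis
  proof (rule Bochner_Integration.integrable_bound)
    show "integrable (lebesgue_on D) (\<lambda>z. B * norm (indicator K z *\<^sub>R U z))"
      by (intro integrable_mult_right integrable_norm i)
    have "f \<in> borel_measurable (lebesgue_on D)"
      using assms(1) f(1) by (intro borel_measurable_lebesgue_on_continuous) (auto intro: continuous_on_subset)
    then show "(\<lambda>z. f z *s U z) \<in> borel_measurable (lebesgue_on D)"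
      by (rule borel_measurable_continuous_Pair[OF _ U(1)]) (intro continuous_intros)
    show "AE z in lebesgue_on D. norm (f z *s U z) \<le> norm (B * norm (indicator K z *\<^sub>R U z))"
      using B f(2) by (intro AE_I2) (auto simp: norm_vec_scale indicator_def intro!: mult_right_mono)
  qed
qed

lemma inv_B_op: "l \<noteq> 0 \<Longrightarrow> inv (B_op 1 l) F = (1 / l) *\<^sub>R F"
  by (rule inv_f_eq) (auto simp: B_op_def wedge11_def Lam_def inj_on_def)

lemma inner11_inv_B_op:
  assumes "l \<noteq> 0"
  shows "Re (inner11 1 h (inv (B_op 1 l) (\<i> *s b)) (\<i> *s b)) = hnorm_sq h b / l"
proof -
  have "(1 / l) *\<^sub>R (\<i> *s b) = (of_real (1 / l) * \<i>) *s b"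
    by (simp add: vec_eq_iff) (simp add: scaleR_conv_of_real)
  then show ?thesis using assms
    by (simp add: inv_B_op inner11_def hprod_scale hnorm_sq_def)
qed

text \<open>Optimality yields a weak solution \<open>U\<close>; since \<open>v\<close> solves the
  same equation classically, Weyl's lemma makes U - v agree almost everywhere with a holomorphic
  \<open>k\<close>. The metric is taken Euclidean, g = 1, and the factor 2 of
  \<open>vol_density\<close> then occurs on both sides and cancels.\<close>

lemma L2_optimal_estimate:
  fixes h :: "complex \<Rightarrow> complex^'r^'r" and v :: "complex \<Rightarrow> complex^'r"
  assumes "open D" and h: "continuous_hermitian_metric D h" and opt: "L2_optimal D h"
    and \<phi>: "smooth_on D \<phi>" and l: "continuous_on D l" "\<And>z. z \<in> D \<Longrightarrow> levi \<phi> z = l z" "\<And>z. z \<in> D \<Longrightarrow> 0 < l z"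
    and v: "\<And>z i. z \<in> D \<Longrightarrow> ((\<lambda>z. v z $ i) has_derivative (\<lambda>x. A z $ i * x + \<beta> z $ i * cnj x)) (at z)"
    and A: "continuous_on D A" and \<beta>: "continuous_on D \<beta>"
    and fin: "(\<integral>\<^sup>+z. ennreal (hnorm_sq (h z) (\<beta> z) / l z * exp (- \<phi> z)) \<partial>lebesgue_on D) < \<infinity>"
  obtains k :: "complex \<Rightarrow> complex^'r" where "\<And>i. (\<lambda>z. k z $ i) holomorphic_on D"
    "(\<integral>\<^sup>+z. ennreal (hnorm_sq (h z) (v z + k z) * exp (- \<phi> z)) \<partial>lebesgue_on D)
      \<le> (\<integral>\<^sup>+z. ennreal (hnorm_sq (h z) (\<beta> z) / l z * exp (- \<phi> z)) \<partial>lebesgue_on D)"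
proof -
  have conth: "continuous_on D h" and pd: "\<And>z. z \<in> D \<Longrightarrow> pos_def_hermitian (h z)"
    using h by (auto simp: continuous_hermitian_metric_def)
  have cont\<phi>: "continuous_on D \<phi>" using \<phi> Ck_on_imp_continuous by (auto simp: smooth_on_def)
  have contv: "continuous_on D v"
  proof -
    have "continuous_on D (\<lambda>z. \<chi> i. v z $ i)"
      by (intro continuous_on_vec_lambda continuous_at_imp_continuous_on ballI has_derivative_continuous[OF v])
    then show ?thesis by simp
  qed
  \<comment> \<open>The equation in \<open>dbar_solution\<close> reads U_zbar = - i F, so this datum
    asks for U_zbar = \<beta>.\<close>
  define F where "F z = \<i> *s \<beta> z" for z
  have contF: "continuous_on D F" unfolding F_def by (intro continuous_intros \<beta>)
  have "loc_L2 D F"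
    unfolding loc_L2_def
  proof (intro conjI allI impI)
    show "F \<in> borel_measurable (lebesgue_on D)"
      using assms(1) contF by (rule borel_measurable_lebesgue_on_continuous)
    fix K assume "compact K \<and> K \<subseteq> D"
    then show "integrable (lebesgue_on K) (\<lambda>z. (norm (F z))\<^sup>2)"
      using continuous_on_subset[OF contF] by (auto intro!: integrable_lebesgue_on_compact continuous_intros)
  qed
  moreover have "smooth_strictly_psh D \<phi>" using \<phi> l by (simp add: smooth_strictly_psh_def)
  moreover have "kaehler_metric D (\<lambda>_. 1)"
    using assms(1) by (simp add: kaehler_metric_def smooth_on_def Ck_on_const)
  ultimately have opt': "(\<integral>\<^sup>+z. ennreal (Re (inner11 1 (h z) (inv (B_op 1 (levi \<phi> z)) (F z)) (F z))
                            * exp (- \<phi> z) * vol_density 1) \<partial>lebesgue_on D) < \<infinity> \<Longrightarrow>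
      \<exists>U. dbar_solution D U F \<and>
             (\<integral>\<^sup>+z. ennreal (norm10_sq 1 (h z) (U z) * exp (- \<phi> z) * vol_density 1)
                \<partial>lebesgue_on D) \<le> (\<integral>\<^sup>+z. ennreal (Re (inner11 1 (h z) (inv (B_op 1 (levi \<phi> z)) (F z)) (F z))
                            * exp (- \<phi> z) * vol_density 1) \<partial>lebesgue_on D)"
    using opt[unfolded L2_optimal_def Let_def, rule_format, of F \<phi> "\<lambda>_. 1"] by simp
  define R where "R z = ennreal (hnorm_sq (h z) (\<beta> z) / l z * exp (- \<phi> z))" for z
  have two: "ennreal (x * 2) = 2 * ennreal x" for x
    by (cases "0 \<le> x") (simp_all add: ennreal_mult' mult.commute ennreal_neg)
  have "l z \<noteq> 0" if "z \<in> D" for z using l(3)[OF that] by simp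
  then have cR: "continuous_on D (\<lambda>z. hnorm_sq (h z) (\<beta> z) / l z * exp (- \<phi> z))"
    by (intro continuous_intros conth \<beta> l cont\<phi>) auto
  have mR: "R \<in> borel_measurable (lebesgue_on D)"
    unfolding R_def
    using borel_measurable_lebesgue_on_continuous[OF assms(1) cR] by measurable
  have "(\<integral>\<^sup>+z. ennreal (Re (inner11 1 (h z) (inv (B_op 1 (levi \<phi> z)) (F z)) (F z))
                            * exp (- \<phi> z) * vol_density 1) \<partial>lebesgue_on D) = (\<integral>\<^sup>+z. 2 * R z \<partial>lebesgue_on D)"
  proof (rule nn_integral_cong)
    fix z assume "z \<in> space (lebesgue_on D)"
    then have "z \<in> D" by simp
    then have "l z \<noteq> 0" using l(3) by force
    then show "ennreal (Re (inner11 1 (h z) (inv (B_op 1 (levi \<phi> z)) (F z)) (F z))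
                            * exp (- \<phi> z) * vol_density 1) = 2 * R z"
      unfolding R_def two[symmetric] using l(2)[OF \<open>z \<in> D\<close>]
      by (simp add: F_def inner11_inv_B_op vol_density_def)
  qed
  also have "\<dots> = 2 * (\<integral>\<^sup>+z. R z \<partial>lebesgue_on D)" by (rule nn_integral_cmult[OF mR])
  finally have rhs: "(\<integral>\<^sup>+z. ennreal (Re (inner11 1 (h z) (inv (B_op 1 (levi \<phi> z)) (F z)) (F z))
      * exp (- \<phi> z) * vol_density 1) \<partial>lebesgue_on D) = 2 * (\<integral>\<^sup>+z. R z \<partial>lebesgue_on D)" .
  have "2 * (\<integral>\<^sup>+z. R z \<partial>lebesgue_on D) < \<infinity>"
    using fin by (simp add: R_def ennreal_mult_less_top)
  from opt'[unfolded rhs, OF this] obtain U where U: "dbar_solution D U F"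
    "(\<integral>\<^sup>+z. ennreal (norm10_sq 1 (h z) (U z) * exp (- \<phi> z) * vol_density 1) \<partial>lebesgue_on D)
      \<le> 2 * (\<integral>\<^sup>+z. R z \<partial>lebesgue_on D)"
    by blast
  have Uloc: "U \<in> borel_measurable (lebesgue_on D)" "\<And>K. compact K \<Longrightarrow> K \<subseteq> D \<Longrightarrow> integrable (lebesgue_on K) U"
    using U(1) by (auto simp: dbar_solution_def loc_integrable_def)
  have Ueq: "- (\<integral>z. d_zbar \<psi> z *s U z \<partial>lebesgue_on D) = (\<integral>z. \<psi> z *s \<beta> z \<partial>lebesgue_on D)"
    if "test_function D \<psi>" for \<psi>
  proof -
    have "- \<i> *s F z = \<beta> z" for z by (simp add: F_def vec_eq_iff)
    then show ?thesis using U(1) that by (simp add: dbar_solution_def)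
  qed
  have comp: "\<exists>k. k holomorphic_on D \<and> negligible {z \<in> D. U z $ i - v z $ i \<noteq> k z}" for i
  proof -
    have Bi: "continuous_on D (\<lambda>z. A z $ i)" "continuous_on D (\<lambda>z. \<beta> z $ i)" "continuous_on D (\<lambda>z. v z $ i)"
      by (intro continuous_on_component A \<beta> contv)+
    obtain k where "k holomorphic_on D" "negligible {z \<in> D. U z $ i - v z $ i \<noteq> k z}"
    proof (rule weyl_dbar[OF assms(1)])
      show "(\<lambda>z. U z $ i - v z $ i) \<in> borel_measurable (lebesgue_on D)"
        by (intro borel_measurable_diff borel_measurable_lebesgue_on_continuous[OF assms(1) Bi(3)]
            measurable_compose[OF Uloc(1)] borel_measurable_continuous_onI continuous_on_component continuous_on_id)
      show "integrable (lebesgue_on K) (\<lambda>z. U z $ i - v z $ i)" if "compact K" "K \<subseteq> D" for K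
        using integrable_bounded_linear[OF bounded_linear_vec_nth Uloc(2)[OF that]]
          integrable_lebesgue_on_compact[OF that(1) continuous_on_subset[OF Bi(3) that(2)]]
        by (intro Bochner_Integration.integrable_diff)
      fix \<psi> assume \<psi>: "test_function D \<psi>"
      obtain K where K: "compact K" "K \<subseteq> D" and \<psi>': "\<And>z. z \<notin> K \<Longrightarrow> \<psi> z = 0"
        "\<And>z. z \<notin> K \<Longrightarrow> d_zbar \<psi> z = 0"
        "\<And>S. continuous_on S \<psi>" "\<And>S. continuous_on S (d_zbar \<psi>)"
        using test_function_props[OF \<psi>] by metis
      have i1: "integrable (lebesgue_on D) (\<lambda>z. d_zbar \<psi> z *s U z)"
        by (rule integrable_compact_support_scale[OF assms(1) K \<psi>'(4,2) Uloc(1) Uloc(2)[OF K]])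
      have i2: "integrable (lebesgue_on D) (\<lambda>z. \<psi> z *s \<beta> z)"
        by (rule compact_support_lebesgue_on(2)[OF assms(1) K]) (use \<psi>' \<beta> in \<open>auto intro!: continuous_intros\<close>)
      note ibp = dbar_integration_by_parts[OF assms(1) \<psi> v Bi(1,2)]
      have "- (\<integral>z. d_zbar \<psi> z * U z $ i \<partial>lebesgue_on D) = - (\<integral>z. d_zbar \<psi> z *s U z \<partial>lebesgue_on D) $ i"
        using integral_bounded_linear[OF bounded_linear_vec_nth[of i] i1] by simp
      also have "\<dots> = (\<integral>z. \<psi> z *s \<beta> z \<partial>lebesgue_on D) $ i"
        unfolding Ueq[OF \<psi>, symmetric] by simp
      also have "\<dots> = (\<integral>z. \<psi> z * \<beta> z $ i \<partial>lebesgue_on D)"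
        using integral_bounded_linear[OF bounded_linear_vec_nth[of i] i2] by simp
      also have "\<dots> = - (\<integral>z. d_zbar \<psi> z * v z $ i \<partial>lebesgue_on D)"
        using ibp(1) by simp
      finally have "(\<integral>z. d_zbar \<psi> z * U z $ i \<partial>lebesgue_on D) = (\<integral>z. d_zbar \<psi> z * v z $ i \<partial>lebesgue_on D)"
        by simp
      moreover have "integrable (lebesgue_on D) (\<lambda>z. d_zbar \<psi> z * U z $ i)"
        using integrable_bounded_linear[OF bounded_linear_vec_nth[of i] i1] by simp
      ultimately show "(\<integral>z. d_zbar \<psi> z * (U z $ i - v z $ i) \<partial>lebesgue_on D) = 0"
        using ibp(2) by (simp add: right_diff_distrib)
    next
      fix k assume "k holomorphic_on D" "negligible {z \<in> D. U z $ i - v z $ i \<noteq> k z}"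
      then show thesis using that by blast
    qed
    then show ?thesis by blast
  qed
  then have "\<forall>i. \<exists>k. k holomorphic_on D \<and> negligible {z \<in> D. U z $ i - v z $ i \<noteq> k z}" ..
  from choice[OF this] obtain \<kappa>
    where "\<forall>i. \<kappa> i holomorphic_on D \<and> negligible {z \<in> D. U z $ i - v z $ i \<noteq> \<kappa> i z}" ..
  then have \<kappa>: "\<kappa> i holomorphic_on D" "negligible {z \<in> D. U z $ i - v z $ i \<noteq> \<kappa> i z}" for i
    by (rule allE[of _ i], simp)+
  define k where "k z = (\<chi> i. \<kappa> i z)" for z
  have holk: "(\<lambda>z. k z $ i) holomorphic_on D" for i using \<kappa>(1) by (simp add: k_def)
  have contk: "continuous_on D k"
    unfolding k_def by (intro continuous_on_vec_lambda holomorphic_on_imp_continuous_on \<kappa>)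
  have "negligible (\<Union>i\<in>UNIV. {z \<in> D. U z $ i - v z $ i \<noteq> \<kappa> i z})"
    by (intro negligible_Union) (use \<kappa>(2) in auto)
  then have "negligible {z \<in> D. \<not> (U z = v z + k z)}"
    by (rule negligible_subset) (auto simp: vec_eq_iff k_def algebra_simps)
  then have AE: "AE z in lebesgue_on D. U z = v z + k z"
    by (rule AE_lebesgue_on_negligible[OF assms(1)])
  define L where "L z = ennreal (hnorm_sq (h z) (v z + k z) * exp (- \<phi> z))" for z
  have "continuous_on D (\<lambda>z. hnorm_sq (h z) (v z + k z) * exp (- \<phi> z))"
    by (intro continuous_intros conth contv contk cont\<phi>)
  then have mL: "L \<in> borel_measurable (lebesgue_on D)"
    unfolding L_def using borel_measurable_lebesgue_on_continuous[OF assms(1)] by measurable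
  have "2 * (\<integral>\<^sup>+z. L z \<partial>lebesgue_on D) = (\<integral>\<^sup>+z. 2 * L z \<partial>lebesgue_on D)"
    by (rule nn_integral_cmult[OF mL, symmetric])
  also have "\<dots> = (\<integral>\<^sup>+z. ennreal (norm10_sq 1 (h z) (U z) * exp (- \<phi> z) * vol_density 1) \<partial>lebesgue_on D)"
    by (rule nn_integral_cong_AE) (use AE in eventually_elim, simp add: L_def norm10_sq_def vol_density_def two)
  also have "\<dots> \<le> 2 * (\<integral>\<^sup>+z. R z \<partial>lebesgue_on D)" by (rule U(2))
  finally have "(\<integral>\<^sup>+z. L z \<partial>lebesgue_on D) \<le> (\<integral>\<^sup>+z. R z \<partial>lebesgue_on D)"
    by (subst (asm) ennreal_mult_le_mult_iff) auto
  then show ?thesis using that[OF holk] by (simp add: L_def R_def)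
qed

section \<open>Norm-minimizing holomorphic sections\<close>

text \<open>The bump mean value property with the bump replaced by an upper bound, so the constant
  depends on \<open>e\<close> alone. The \<open>ennreal\<close> form lets it combine with norms not
  yet known to be finite.\<close>

lemma holomorphic_L1_bound:
  assumes e: "e > 0"
  obtains C where "C > 0" "\<And>S f z. open S \<Longrightarrow> f holomorphic_on S \<Longrightarrow> cball z e \<subseteq> S \<Longrightarrow>
    ennreal (cmod (f z)) \<le> ennreal C * (\<integral>\<^sup>+y. ennreal (cmod (f y)) * indicator (cball z e) y \<partial>lborel)"
proof -
  obtain B where B: "B > 0" "\<And>y. bump e y \<le> B" by (rule bump_bound[of e]) blast
  have m: "bump_mass e > 0" using e by (rule bump_mass_pos)
  show ?thesis
  proof (rule that)
    show "B / bump_mass e > 0" using B m by simp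
    fix S f z assume S: "open S" "f holomorphic_on S" "cball z e \<subseteq> S"
    have contf: "continuous_on (cball z e) f"
      using S by (auto intro: holomorphic_on_imp_continuous_on holomorphic_on_subset)
    have i: "integrable lborel (\<lambda>y. indicator (cball z e) y *\<^sub>R f y)"
      by (rule borel_integrable_compact[OF compact_cball contf])
    have "bump_mass e * cmod (f z) = cmod (\<integral>y. bump e (z - y) * f y \<partial>lborel)"
      using bump_mean_value[OF S(1,2) e S(3)] m by (simp add: norm_mult)
    also have "\<dots> \<le> (\<integral>y. norm (bump e (z - y) * f y) \<partial>lborel)" by (rule integral_norm_bound)
    also have "\<dots> \<le> (\<integral>y. B * norm (indicator (cball z e) y *\<^sub>R f y) \<partial>lborel)"
    proof (rule integral_mono)
      show "integrable lborel (\<lambda>y. B * norm (indicator (cball z e) y *\<^sub>R f y))"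
        by (intro integrable_mult_right integrable_norm i)
      have *: "norm (bump e (z - y) * f y) \<le> B * norm (indicator (cball z e) y *\<^sub>R f y)" for y
      proof (cases "y \<in> cball z e")
        case True
        then show ?thesis using B(2)[of "z - y"] by (simp add: norm_mult bump_nonneg mult_right_mono)
      next
        case False
        then have "bump e (z - y) = 0" using e by (intro bump_eq_0) (auto simp: dist_norm norm_minus_commute)
        then show ?thesis using B(1) by simp
      qed
      then show "norm (bump e (z - y) * f y) \<le> B * norm (indicator (cball z e) y *\<^sub>R f y)" for y .
      have "integrable lborel (\<lambda>y. bump e (z - y) * f y)"
      proof (rule integrable_compact_support[of "cball z e"])
        show "continuous_on (cball z e) (\<lambda>y. bump e (z - y) * f y)"
          by (intro continuous_intros contf)
      qed (use e in \<open>auto intro!: bump_eq_0 simp: dist_norm norm_minus_commute\<close>)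
      then show "integrable lborel (\<lambda>y. norm (bump e (z - y) * f y))" by (rule integrable_norm)
    qed
    also have "\<dots> = B * (\<integral>y. norm (indicator (cball z e) y *\<^sub>R f y) \<partial>lborel)" by simp
    finally have "cmod (f z) \<le> B / bump_mass e * (\<integral>y. norm (indicator (cball z e) y *\<^sub>R f y) \<partial>lborel)"
      using m by (simp add: field_simps)
    then have "ennreal (cmod (f z)) \<le> ennreal (B / bump_mass e) * ennreal (\<integral>y. norm (indicator (cball z e) y *\<^sub>R f y) \<partial>lborel)"
      using B m by (subst ennreal_mult[symmetric]) (auto intro!: ennreal_leI)
    also have "ennreal (\<integral>y. norm (indicator (cball z e) y *\<^sub>R f y) \<partial>lborel)
      = (\<integral>\<^sup>+y. ennreal (norm (indicator (cball z e) y *\<^sub>R f y)) \<partial>lborel)"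
      by (rule nn_integral_eq_integral[symmetric, OF integrable_norm[OF i]]) simp
    also have "\<dots> = (\<integral>\<^sup>+y. ennreal (cmod (f y)) * indicator (cball z e) y \<partial>lborel)"
      by (rule nn_integral_cong) (auto simp: indicator_def)
    finally show "ennreal (cmod (f z)) \<le> ennreal (B / bump_mass e) * (\<integral>\<^sup>+y. ennreal (cmod (f y)) * indicator (cball z e) y \<partial>lborel)" .
  qed
qed

text \<open>A squared norm. With values in \<open>ennreal\<close>, sections of infinite norm may
  compete in the minimization and Fatou's lemma applies directly.\<close>

definition wnorm :: "complex set \<Rightarrow> (complex \<Rightarrow> complex^'r^'r) \<Rightarrow> (complex \<Rightarrow> real) \<Rightarrow> (complex \<Rightarrow> complex^'r) \<Rightarrow> ennreal" where
  "wnorm D h W F = (\<integral>\<^sup>+z. ennreal (hnorm_sq (h z) (F z) * W z) \<partial>lebesgue_on D)"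

definition hol_section :: "complex set \<Rightarrow> (complex \<Rightarrow> complex^'r) \<Rightarrow> bool" where
  "hol_section D F \<longleftrightarrow> (\<forall>i. (\<lambda>z. F z $ i) holomorphic_on D)"

lemma hol_section_continuous: "hol_section D F \<Longrightarrow> continuous_on D F"
proof -
  assume "hol_section D F"
  then have "continuous_on D (\<lambda>z. \<chi> i. F z $ i)"
    by (intro continuous_on_vec_lambda holomorphic_on_imp_continuous_on) (auto simp: hol_section_def)
  then show ?thesis by simp
qed

lemma hol_section_add: "hol_section D F \<Longrightarrow> hol_section D G \<Longrightarrow> hol_section D (\<lambda>z. F z + G z)"
  by (auto simp: hol_section_def intro!: holomorphic_intros)

lemma hol_section_scale: "f holomorphic_on D \<Longrightarrow> hol_section D F \<Longrightarrow> hol_section D (\<lambda>z. f z *s F z)"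
  by (auto simp: hol_section_def intro!: holomorphic_intros)

text \<open>The L^1 bound is applied to the squares of the components, which are holomorphic. On a
  compact neighbourhood of \<open>K\<close> both \<open>h\<close> and \<open>W\<close> are bounded
  below, and this converts the Euclidean integral into \<open>wnorm\<close>.\<close>

lemma hol_section_bound:
  fixes h :: "complex \<Rightarrow> complex^'r^'r"
  assumes "open D" and h: "continuous_hermitian_metric D h"
    and W: "continuous_on D W" "\<And>z. z \<in> D \<Longrightarrow> 0 < W z" and K: "compact K" "K \<subseteq> D"
  obtains C where "C > 0" "\<And>F z. hol_section D F \<Longrightarrow> z \<in> K \<Longrightarrow>
    ennreal ((norm (F z))\<^sup>2) \<le> ennreal C * wnorm D h W F"
proof (cases "K = {}")
  case True
  then show ?thesis using that[of 1] by auto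
next
  case False
  have conth: "continuous_on D h" and pd: "\<And>z. z \<in> D \<Longrightarrow> pos_def_hermitian (h z)"
    using h by (auto simp: continuous_hermitian_metric_def)
  obtain e where e: "e > 0" "{x. infdist x K \<le> e} \<subseteq> D"
    using compact_in_open_separated[OF False K(1) assms(1) K(2)] by blast
  define K' where "K' = {x. infdist x K \<le> e}"
  have K': "compact K'" "K' \<subseteq> D" using compact_infdist_le[OF False K(1) e(1)] e(2) by (auto simp: K'_def)
  have sub: "cball z e \<subseteq> K'" if "z \<in> K" for z
  proof
    fix x assume "x \<in> cball z e"
    then show "x \<in> K'" using infdist_le[OF that, of x] by (simp add: K'_def dist_commute)
  qed
  have ne: "K' \<noteq> {}" using False sub e(1) by force
  obtain c C where c: "c > 0" "\<And>z a. z \<in> K' \<Longrightarrow> c * (norm a)\<^sup>2 \<le> hnorm_sq (h z) a"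
  proof (rule hnorm_sq_bounds_compact[OF K'(1) continuous_on_subset[OF conth K'(2)]])
    fix c C :: real
    assume "c > 0" "\<And>z a. z \<in> K' \<Longrightarrow> c * (norm a)\<^sup>2 \<le> hnorm_sq (h z) a"
    then show thesis using that by blast
  qed (use pd K'(2) in auto)
  obtain z0 where z0: "z0 \<in> K'" "\<And>z. z \<in> K' \<Longrightarrow> W z0 \<le> W z"
    using continuous_attains_inf[OF K'(1) ne continuous_on_subset[OF W(1) K'(2)]] by blast
  have W0: "W z0 > 0" using z0(1) K'(2) W(2) by auto
  obtain C1 where C1: "C1 > 0" "\<And>S f z. open S \<Longrightarrow> f holomorphic_on S \<Longrightarrow> cball z e \<subseteq> S \<Longrightarrow>
    ennreal (cmod (f z)) \<le> ennreal C1 * (\<integral>\<^sup>+y. ennreal (cmod (f y)) * indicator (cball z e) y \<partial>lborel)"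
    using holomorphic_L1_bound[OF e(1)] by metis
  define C2 where "C2 = C1 / (c * W z0)"
  show ?thesis
  proof (rule that)
    show "C2 > 0" using C1(1) c(1) W0 by (simp add: C2_def)
    fix F :: "complex \<Rightarrow> complex^'r" and z assume F: "hol_section D F" and z: "z \<in> K"
    have cD: "cball z e \<subseteq> D" using sub[OF z] K'(2) by blast
    have contF: "continuous_on D F" by (rule hol_section_continuous[OF F])
    have meas: "(\<lambda>y. ennreal (cmod (F y $ i * F y $ i)) * indicator (cball z e) y) \<in> borel_measurable lborel" for i
    proof -
      have "continuous_on (cball z e) (\<lambda>y. cmod (F y $ i * F y $ i))"
        by (intro continuous_intros continuous_on_component continuous_on_subset[OF contF cD])
      then have "(\<lambda>y. indicator (cball z e) y *\<^sub>R cmod (F y $ i * F y $ i)) \<in> borel_measurable lborel"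
        using borel_integrable_compact[OF compact_cball] by blast
      then have "(\<lambda>y. ennreal (indicator (cball z e) y *\<^sub>R cmod (F y $ i * F y $ i))) \<in> borel_measurable lborel"
        by measurable
      also have "(\<lambda>y. ennreal (indicator (cball z e) y *\<^sub>R cmod (F y $ i * F y $ i)))
        = (\<lambda>y. ennreal (cmod (F y $ i * F y $ i)) * indicator (cball z e) y)"
        by (auto simp: indicator_def)
      finally show ?thesis .
    qed
    have sq: "(norm a)\<^sup>2 = (\<Sum>i\<in>UNIV. cmod (a $ i * a $ i))" for a :: "complex^'r"
      by (simp add: norm_vec_def L2_set_def sum_nonneg norm_mult power2_eq_square)
    have "ennreal ((norm (F z))\<^sup>2) = (\<Sum>i\<in>UNIV. ennreal (cmod (F z $ i * F z $ i)))"
      unfolding sq by (rule sum_ennreal[symmetric]) auto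
    also have "\<dots> \<le> (\<Sum>i\<in>UNIV. ennreal C1 * (\<integral>\<^sup>+y. ennreal (cmod (F y $ i * F y $ i)) * indicator (cball z e) y \<partial>lborel))"
    proof (rule sum_mono)
      fix i
      show "ennreal (cmod (F z $ i * F z $ i)) \<le> ennreal C1 * (\<integral>\<^sup>+y. ennreal (cmod (F y $ i * F y $ i)) * indicator (cball z e) y \<partial>lborel)"
        using F by (intro C1(2)[OF assms(1) _ cD]) (auto simp: hol_section_def intro!: holomorphic_intros)
    qed
    also have "\<dots> = ennreal C1 * (\<integral>\<^sup>+y. (\<Sum>i\<in>UNIV. ennreal (cmod (F y $ i * F y $ i)) * indicator (cball z e) y) \<partial>lborel)"
      by (simp only: nn_integral_sum[OF meas] sum_distrib_left)
    also have "(\<lambda>y. \<Sum>i\<in>UNIV. ennreal (cmod (F y $ i * F y $ i)) * indicator (cball z e) y)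
      = (\<lambda>y. ennreal ((norm (F y))\<^sup>2) * indicator (cball z e) y)"
      unfolding sq by (simp add: sum_distrib_right[symmetric] sum_ennreal)
    also have "(\<integral>\<^sup>+y. ennreal ((norm (F y))\<^sup>2) * indicator (cball z e) y \<partial>lborel)
        = (\<integral>\<^sup>+y. ennreal ((norm (F y))\<^sup>2) * indicator (cball z e) y \<partial>lebesgue)"
      by (simp add: nn_integral_completion)
    also have "\<dots> \<le> (\<integral>\<^sup>+y. ennreal (1 / (c * W z0)) * (ennreal (hnorm_sq (h y) (F y) * W y) * indicator D y) \<partial>lebesgue)"
    proof (rule nn_integral_mono)
      fix y
      show "ennreal ((norm (F y))\<^sup>2) * indicator (cball z e) y
        \<le> ennreal (1 / (c * W z0)) * (ennreal (hnorm_sq (h y) (F y) * W y) * indicator D y)"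
      proof (cases "y \<in> cball z e")
        case True
        then have y: "y \<in> K'" "y \<in> D" using sub[OF z] cD by auto
        have nn: "0 \<le> hnorm_sq (h y) (F y)" by (rule hnorm_sq_nonneg[OF pd[OF y(2)]])
        have "(norm (F y))\<^sup>2 * (c * W z0) = c * (norm (F y))\<^sup>2 * W z0" by simp
        also have "\<dots> \<le> hnorm_sq (h y) (F y) * W y"
          using c(2)[OF y(1)] z0(2)[OF y(1)] W0 nn by (intro mult_mono) auto
        finally have "(norm (F y))\<^sup>2 \<le> 1 / (c * W z0) * (hnorm_sq (h y) (F y) * W y)"
          using c(1) W0 by (simp add: field_simps)
        moreover have "0 \<le> 1 / (c * W z0)" using c(1) W0 by simp
        ultimately show ?thesis using True y(2)
          by (simp add: ennreal_mult'[symmetric] ennreal_leI)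
      qed simp
    qed
    also have "\<dots> = ennreal (1 / (c * W z0)) * wnorm D h W F"
    proof -
      have "continuous_on D (\<lambda>y. hnorm_sq (h y) (F y) * W y)"
        by (intro continuous_intros conth contF W)
      then have "(\<lambda>y. hnorm_sq (h y) (F y) * W y) \<in> borel_measurable (lebesgue_on D)"
        by (rule borel_measurable_lebesgue_on_continuous[OF assms(1)])
      then have "(\<lambda>y. ennreal (hnorm_sq (h y) (F y) * W y)) \<in> borel_measurable (lebesgue_on D)"
        by measurable
      then have "(\<lambda>y. ennreal (hnorm_sq (h y) (F y) * W y) * indicator D y) \<in> borel_measurable lebesgue"
        using assms(1) by (subst (asm) borel_measurable_restrict_space_iff_ennreal) auto
      then show ?thesis using assms(1)
        by (simp add: nn_integral_cmult wnorm_def nn_integral_restrict_space)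
    qed
    finally have "ennreal ((norm (F z))\<^sup>2) \<le> ennreal C1 * (ennreal (1 / (c * W z0)) * wnorm D h W F)"
      by (simp add: mult_left_mono)
    also have "\<dots> = ennreal C2 * wnorm D h W F"
      unfolding mult.assoc[symmetric] C2_def using C1(1) c(1) W0 by (subst ennreal_mult[symmetric]) auto
    finally show "ennreal ((norm (F z))\<^sup>2) \<le> ennreal C2 * wnorm D h W F" .
  qed
qed

text \<open>Montel's theorem for one component after the other, each time along a further
  subsequence.\<close>

lemma montel_sections:
  fixes F :: "nat \<Rightarrow> complex \<Rightarrow> complex^'r"
  assumes "open D" "\<And>n. hol_section D (F n)"
    and bd: "\<And>K. compact K \<Longrightarrow> K \<subseteq> D \<Longrightarrow> \<exists>B. \<forall>n. \<forall>z\<in>K. norm (F n z) \<le> B"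
  obtains G r where "hol_section D G" "strict_mono (r :: nat \<Rightarrow> nat)" "\<And>z. z \<in> D \<Longrightarrow> (\<lambda>n. F (r n) z) \<longlonglongrightarrow> G z"
proof -
  have "\<exists>r g. strict_mono (r :: nat \<Rightarrow> nat) \<and> (\<forall>i\<in>A. g i holomorphic_on D \<and> (\<forall>z\<in>D. (\<lambda>n. F (r n) z $ i) \<longlonglongrightarrow> g i z))"
    if "finite A" for A :: "'r set"
    using that
  proof induction
    case empty
    show ?case by (rule exI[of _ id]) (auto simp: strict_mono_def)
  next
    case (insert j A)
    then obtain r g where r: "strict_mono r"
      and g: "\<And>i. i \<in> A \<Longrightarrow> g i holomorphic_on D" "\<And>i z. i \<in> A \<Longrightarrow> z \<in> D \<Longrightarrow> (\<lambda>n. F (r n) z $ i) \<longlonglongrightarrow> g i z"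
      by blast
    define f where "f n z = F (r n) z $ j" for n z
    obtain gj r' where gj: "gj holomorphic_on D" "strict_mono r'" "\<And>z. z \<in> D \<Longrightarrow> (\<lambda>n. f (r' n) z) \<longlonglongrightarrow> gj z"
    proof (rule Montel[OF assms(1), of "range f" f])
      show "k holomorphic_on D" if "k \<in> range f" for k
        using that assms(2) by (auto simp: f_def[abs_def] hol_section_def)
      fix K assume "compact K" "K \<subseteq> D"
      from bd[OF this] obtain B where B: "\<And>n z. z \<in> K \<Longrightarrow> norm (F n z) \<le> B" by blast
      have "cmod (f n z) \<le> B" if "z \<in> K" for n z
        using B[OF that, of "r n"] Finite_Cartesian_Product.norm_nth_le[of "F (r n) z" j] by (simp add: f_def)
      then show "\<exists>B. \<forall>h\<in>range f. \<forall>z\<in>K. cmod (h z) \<le> B" by blast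
    next
      fix g r'
      assume "g holomorphic_on D" "strict_mono (r' :: nat \<Rightarrow> nat)" "\<And>x. x \<in> D \<Longrightarrow> (\<lambda>n. f (r' n) x) \<longlonglongrightarrow> g x"
      then show thesis using that by blast
    qed auto
    show ?case
    proof (intro exI conjI ballI)
      show "strict_mono (r \<circ> r')" using r gj(2) by (rule strict_mono_o)
      fix i assume i: "i \<in> insert j A"
      let ?g = "g(j := gj)"
      show "?g i holomorphic_on D" using i insert.hyps g(1) gj(1) by auto
      fix z assume z: "z \<in> D"
      show "(\<lambda>n. F ((r \<circ> r') n) z $ i) \<longlonglongrightarrow> ?g i z"
      proof (cases "i = j")
        case True
        then show ?thesis using gj(3)[OF z] by (simp add: f_def)
      next
        case False
        then have "(\<lambda>n. F (r n) z $ i) \<longlonglongrightarrow> g i z" using i g(2)[OF _ z] by auto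
        from LIMSEQ_subseq_LIMSEQ[OF this gj(2)] False show ?thesis by (simp add: o_def)
      qed
    qed
  qed
  from this[of UNIV] obtain r g where rg: "strict_mono (r :: nat \<Rightarrow> nat)"
    "\<And>i. g i holomorphic_on D" "\<And>i z. z \<in> D \<Longrightarrow> (\<lambda>n. F (r n) z $ i) \<longlonglongrightarrow> g i z"
    by auto
  show ?thesis
  proof (rule that[OF _ rg(1)])
    show "hol_section D (\<lambda>z. \<chi> i. g i z)" using rg(2) by (simp add: hol_section_def)
    show "(\<lambda>n. F (r n) z) \<longlonglongrightarrow> (\<chi> i. g i z)" if "z \<in> D" for z
      by (rule vec_tendstoI) (use rg(3)[OF that] in simp)
  qed
qed

text \<open>Direct method: a minimizing sequence is locally bounded by
  \<open>hol_section_bound\<close>, Montel's theorem gives a pointwise limit, and by Fatou's lemma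
  its norm is at most the infimum. Pointwise convergence keeps the value at
  \<open>w\<close>.\<close>

lemma wnorm_minimizer:
  fixes h :: "complex \<Rightarrow> complex^'r^'r"
  assumes "open D" and h: "continuous_hermitian_metric D h"
    and W: "continuous_on D W" "\<And>z. z \<in> D \<Longrightarrow> 0 < W z" and w: "w \<in> D"
    and F0: "hol_section D F0" "F0 w = s" "wnorm D h W F0 < \<infinity>"
  obtains F where "hol_section D F" "F w = s"
    "\<And>G. hol_section D G \<Longrightarrow> G w = s \<Longrightarrow> wnorm D h W F \<le> wnorm D h W G"
proof -
  have conth: "continuous_on D h" and pd: "\<And>z. z \<in> D \<Longrightarrow> pos_def_hermitian (h z)"
    using h by (auto simp: continuous_hermitian_metric_def)
  define X where "X = {G. hol_section D G \<and> G w = s}"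
  define I where "I = (INF G\<in>X. wnorm D h W G)"
  have Ile: "I \<le> wnorm D h W G" if "G \<in> X" for G unfolding I_def using that by (rule INF_lower)
  have Ifin: "I < \<infinity>" using Ile[of F0] F0 by (auto simp: X_def intro: le_less_trans)
  have "\<exists>G\<in>X. wnorm D h W G < I + ennreal (1 / real (Suc n))" for n
  proof -
    have "I < I + ennreal (1 / real (Suc n))"
      using Ifin ennreal_add_left_cancel_less[of I 0 "ennreal (1 / real (Suc n))"] by auto
    then show ?thesis unfolding I_def INF_less_iff by simp
  qed
  then obtain F where F: "\<And>n. F n \<in> X" "\<And>n. wnorm D h W (F n) < I + ennreal (1 / real (Suc n))"
    by metis
  have bound: "wnorm D h W (F n) \<le> I + 1" for n
    using F(2)[of n] by (rule less_imp_le[THEN order_trans]) (auto intro!: add_left_mono simp: divide_le_eq)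
  obtain I' where I': "I + 1 = ennreal I'" "I' \<ge> 0"
    using Ifin by (cases "I + 1") auto
  obtain G r where G: "hol_section D G" "strict_mono (r :: nat \<Rightarrow> nat)" "\<And>z. z \<in> D \<Longrightarrow> (\<lambda>n. F (r n) z) \<longlonglongrightarrow> G z"
  proof (rule montel_sections[OF assms(1), of F])
    show "hol_section D (F n)" for n using F(1)[of n] by (simp add: X_def)
    fix K assume K: "compact K" "K \<subseteq> D"
    obtain C where C: "C > 0" "\<And>F z. hol_section D F \<Longrightarrow> z \<in> K \<Longrightarrow>
        ennreal ((norm (F z))\<^sup>2) \<le> ennreal C * wnorm D h W F"
      using hol_section_bound[OF assms(1) h W K] by metis
    have "norm (F n z) \<le> sqrt (C * I')" if "z \<in> K" for n z
    proof -
      have "ennreal ((norm (F n z))\<^sup>2) \<le> ennreal C * wnorm D h W (F n)"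
        using F(1)[of n] that by (intro C(2)) (auto simp: X_def)
      also have "\<dots> \<le> ennreal C * ennreal I'" using bound[of n] I'(1) by (intro mult_left_mono) auto
      also have "\<dots> = ennreal (C * I')" using C(1) I'(2) by (simp add: ennreal_mult)
      finally have "(norm (F n z))\<^sup>2 \<le> C * I'" using C(1) I'(2) by (simp add: ennreal_le_iff)
      then show ?thesis by (rule real_le_rsqrt)
    qed
    then show "\<exists>B. \<forall>n. \<forall>z\<in>K. norm (F n z) \<le> B" by blast
  qed blast
  have contG: "continuous_on D G" by (rule hol_section_continuous[OF G(1)])
  have "wnorm D h W G \<le> I"
  proof -
    define f where "f n z = ennreal (hnorm_sq (h z) (F (r n) z) * W z)" for n z
    have mf: "f n \<in> borel_measurable (lebesgue_on D)" for n
    proof -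
      have "continuous_on D (F (r n))" using F(1) by (auto intro: hol_section_continuous simp: X_def)
      then have "continuous_on D (\<lambda>z. hnorm_sq (h z) (F (r n) z) * W z)"
        by (intro continuous_intros conth W)
      from borel_measurable_lebesgue_on_continuous[OF assms(1) this] show ?thesis
        unfolding f_def by measurable
    qed
    have "wnorm D h W G = (\<integral>\<^sup>+z. liminf (\<lambda>n. f n z) \<partial>lebesgue_on D)"
      unfolding wnorm_def
    proof (rule nn_integral_cong)
      fix z assume "z \<in> space (lebesgue_on D)"
      then have z: "z \<in> D" by simp
      have "(\<lambda>n. hnorm_sq (h z) (F (r n) z) * W z) \<longlonglongrightarrow> hnorm_sq (h z) (G z) * W z"
        unfolding hnorm_sq_def hprod_def
        by (intro tendsto_intros tendsto_vec_nth G(3)[OF z])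
      then have "(\<lambda>n. f n z) \<longlonglongrightarrow> ennreal (hnorm_sq (h z) (G z) * W z)"
        unfolding f_def by (rule tendsto_ennrealI)
      then show "ennreal (hnorm_sq (h z) (G z) * W z) = liminf (\<lambda>n. f n z)"
        by (simp add: lim_imp_Liminf)
    qed
    also have "\<dots> \<le> liminf (\<lambda>n. integral\<^sup>N (lebesgue_on D) (f n))"
      by (rule nn_integral_liminf[OF mf])
    also have "\<dots> \<le> liminf (\<lambda>n. I + ennreal (1 / real (Suc n)))"
    proof (rule Liminf_mono, rule always_eventually, rule allI)
      fix n
      have "integral\<^sup>N (lebesgue_on D) (f n) = wnorm D h W (F (r n))"
        by (simp add: f_def[abs_def] wnorm_def)
      also have "\<dots> \<le> I + ennreal (1 / real (Suc (r n)))" using F(2)[of "r n"] by simp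
      also have "\<dots> \<le> I + ennreal (1 / real (Suc n))"
        using seq_suble[OF G(2), of n] by (intro add_left_mono ennreal_leI) (auto simp: field_simps)
      finally show "integral\<^sup>N (lebesgue_on D) (f n) \<le> I + ennreal (1 / real (Suc n))" .
    qed
    also have "\<dots> = I"
    proof (rule lim_imp_Liminf)
      have "(\<lambda>n. 1 / real (Suc n)) \<longlonglongrightarrow> 0" using LIMSEQ_inverse_real_of_nat by (simp add: inverse_eq_divide)
      then have "(\<lambda>n. I + ennreal (1 / real (Suc n))) \<longlonglongrightarrow> I + ennreal 0"
        by (intro tendsto_add tendsto_const tendsto_ennrealI)
      then show "(\<lambda>n. I + ennreal (1 / real (Suc n))) \<longlonglongrightarrow> I" by simp
    qed simp
    finally show ?thesis .
  qed
  moreover have "G w = s"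
  proof -
    have "(\<lambda>n. F (r n) w) \<longlonglongrightarrow> s" using F(1) by (simp add: X_def)
    from LIMSEQ_unique[OF G(3)[OF w] this] show ?thesis .
  qed
  ultimately show ?thesis
    using G(1) Ile by (intro that[of G]) (auto simp: X_def intro: order_trans)
qed

lemma wnorm_integrable:
  fixes h :: "complex \<Rightarrow> complex^'r^'r"
  assumes "open D" and h: "continuous_hermitian_metric D h"
    and W: "continuous_on D W" "\<And>z. z \<in> D \<Longrightarrow> 0 \<le> W z"
    and F: "continuous_on D F"
  shows "wnorm D h W F < \<infinity> \<longleftrightarrow> integrable (lebesgue_on D) (\<lambda>z. hnorm_sq (h z) (F z) * W z)"
    and "wnorm D h W F < \<infinity> \<Longrightarrow> wnorm D h W F = ennreal (\<integral>z. hnorm_sq (h z) (F z) * W z \<partial>lebesgue_on D)"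
proof -
  have conth: "continuous_on D h" and pd: "\<And>z. z \<in> D \<Longrightarrow> pos_def_hermitian (h z)"
    using h by (auto simp: continuous_hermitian_metric_def)
  have nn: "AE z in lebesgue_on D. 0 \<le> hnorm_sq (h z) (F z) * W z"
    by (rule AE_I2) (auto intro!: mult_nonneg_nonneg hnorm_sq_nonneg pd W)
  have m: "(\<lambda>z. hnorm_sq (h z) (F z) * W z) \<in> borel_measurable (lebesgue_on D)"
    by (intro borel_measurable_lebesgue_on_continuous assms(1) continuous_intros conth W F)
  show iff: "wnorm D h W F < \<infinity> \<longleftrightarrow> integrable (lebesgue_on D) (\<lambda>z. hnorm_sq (h z) (F z) * W z)"
    unfolding wnorm_def using integrableI_nonneg[OF m nn] nn_integral_eq_integral[OF _ nn] by auto
  show "wnorm D h W F = ennreal (\<integral>z. hnorm_sq (h z) (F z) * W z \<partial>lebesgue_on D)" if "wnorm D h W F < \<infinity>"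
    using nn_integral_eq_integral[OF _ nn] that iff unfolding wnorm_def by simp
qed

lemma integrable_hprod:
  fixes h :: "complex \<Rightarrow> complex^'r^'r"
  assumes "open D" and h: "continuous_hermitian_metric D h"
    and W: "continuous_on D W" "\<And>z. z \<in> D \<Longrightarrow> 0 \<le> W z"
    and F: "continuous_on D F" "wnorm D h W F < \<infinity>" and G: "continuous_on D G" "wnorm D h W G < \<infinity>"
  shows "integrable (lebesgue_on D) (\<lambda>z. Re (hprod (h z) (F z) (G z)) * W z)"
proof (rule Bochner_Integration.integrable_bound)
  have conth: "continuous_on D h" and pd: "\<And>z. z \<in> D \<Longrightarrow> pos_def_hermitian (h z)"
    using h by (auto simp: continuous_hermitian_metric_def)
  show "integrable (lebesgue_on D) (\<lambda>z. hnorm_sq (h z) (F z) * W z + hnorm_sq (h z) (G z) * W z)"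
    using wnorm_integrable(1)[OF assms(1) h W F(1)] wnorm_integrable(1)[OF assms(1) h W G(1)] F G
    by (intro Bochner_Integration.integrable_add) auto
  show "(\<lambda>z. Re (hprod (h z) (F z) (G z)) * W z) \<in> borel_measurable (lebesgue_on D)"
    by (intro borel_measurable_lebesgue_on_continuous assms(1) continuous_intros conth W F G)
  show "AE z in lebesgue_on D. norm (Re (hprod (h z) (F z) (G z)) * W z)
      \<le> norm (hnorm_sq (h z) (F z) * W z + hnorm_sq (h z) (G z) * W z)"
  proof (rule AE_I2)
    fix z assume "z \<in> space (lebesgue_on D)"
    then have z: "z \<in> D" by simp
    have "\<bar>Re (hprod (h z) (F z) (G z))\<bar> \<le> hnorm_sq (h z) (F z) + hnorm_sq (h z) (G z)"
      using norm_hprod_le[OF pd[OF z]] abs_Re_le_cmod order_trans by blast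
    then have "\<bar>Re (hprod (h z) (F z) (G z))\<bar> * W z \<le> (hnorm_sq (h z) (F z) + hnorm_sq (h z) (G z)) * W z"
      using W(2)[OF z] by (rule mult_right_mono)
    then show "norm (Re (hprod (h z) (F z) (G z)) * W z)
      \<le> norm (hnorm_sq (h z) (F z) * W z + hnorm_sq (h z) (G z) * W z)"
      using W(2)[OF z] hnorm_sq_nonneg[OF pd[OF z]] by (simp add: abs_mult distrib_right)
  qed
qed

lemma integral_hnorm_sq_add:
  fixes h :: "complex \<Rightarrow> complex^'r^'r"
  assumes "open D" and h: "continuous_hermitian_metric D h"
    and W: "continuous_on D W" "\<And>z. z \<in> D \<Longrightarrow> 0 \<le> W z"
    and F: "continuous_on D F" "wnorm D h W F < \<infinity>" and G: "continuous_on D G" "wnorm D h W G < \<infinity>"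
  shows "wnorm D h W (\<lambda>z. F z + G z) < \<infinity>"
    and "(\<integral>z. hnorm_sq (h z) (F z + G z) * W z \<partial>lebesgue_on D) = (\<integral>z. hnorm_sq (h z) (F z) * W z \<partial>lebesgue_on D) +
      (\<integral>z. hnorm_sq (h z) (G z) * W z \<partial>lebesgue_on D) + 2 * (\<integral>z. Re (hprod (h z) (F z) (G z)) * W z \<partial>lebesgue_on D)"
proof -
  have conth: "continuous_on D h" and pd: "\<And>z. z \<in> D \<Longrightarrow> pos_def_hermitian (h z)"
    using h by (auto simp: continuous_hermitian_metric_def)
  have i1: "integrable (lebesgue_on D) (\<lambda>z. hnorm_sq (h z) (F z) * W z)"
    using wnorm_integrable(1)[OF assms(1) h W F(1)] F(2) by simp
  have i2: "integrable (lebesgue_on D) (\<lambda>z. hnorm_sq (h z) (G z) * W z)"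
    using wnorm_integrable(1)[OF assms(1) h W G(1)] G(2) by simp
  have i3: "integrable (lebesgue_on D) (\<lambda>z. Re (hprod (h z) (F z) (G z)) * W z)"
    by (rule integrable_hprod[OF assms(1) h W F G])
  let ?f = "\<lambda>z. hnorm_sq (h z) (F z) * W z + hnorm_sq (h z) (G z) * W z + 2 * (Re (hprod (h z) (F z) (G z)) * W z)"
  have eq: "hnorm_sq (h z) (F z + G z) * W z = ?f z" if "z \<in> D" for z
    using hnorm_sq_add[OF pd[OF that]] by (simp add: algebra_simps)
  have "integrable (lebesgue_on D) ?f" using i1 i2 i3 by auto
  then have "integrable (lebesgue_on D) (\<lambda>z. hnorm_sq (h z) (F z + G z) * W z)"
    by (subst Bochner_Integration.integrable_cong[OF refl eq]) auto
  then show "wnorm D h W (\<lambda>z. F z + G z) < \<infinity>"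
    using wnorm_integrable(1)[OF assms(1) h W continuous_on_add[OF F(1) G(1)]] by simp
  have "(\<integral>z. hnorm_sq (h z) (F z + G z) * W z \<partial>lebesgue_on D) = (\<integral>z. ?f z \<partial>lebesgue_on D)"
    by (rule Bochner_Integration.integral_cong[OF refl]) (use eq in auto)
  also have "\<dots> = (\<integral>z. hnorm_sq (h z) (F z) * W z \<partial>lebesgue_on D) +
      (\<integral>z. hnorm_sq (h z) (G z) * W z \<partial>lebesgue_on D) + 2 * (\<integral>z. Re (hprod (h z) (F z) (G z)) * W z \<partial>lebesgue_on D)"
    using i1 i2 i3 by simp
  finally show "(\<integral>z. hnorm_sq (h z) (F z + G z) * W z \<partial>lebesgue_on D) = (\<integral>z. hnorm_sq (h z) (F z) * W z \<partial>lebesgue_on D) +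
      (\<integral>z. hnorm_sq (h z) (G z) * W z \<partial>lebesgue_on D) + 2 * (\<integral>z. Re (hprod (h z) (F z) (G z)) * W z \<partial>lebesgue_on D)" .
qed

text \<open>First variation along F + t q, which keeps the value at \<open>w\<close>: t^2 Y + 2 t X
  \<ge> 0 for all real t forces X = 0.\<close>

lemma minimizer_orthogonal:
  fixes h :: "complex \<Rightarrow> complex^'r^'r"
  assumes "open D" and h: "continuous_hermitian_metric D h"
    and W: "continuous_on D W" "\<And>z. z \<in> D \<Longrightarrow> 0 \<le> W z"
    and F: "hol_section D F" "F w = s" "wnorm D h W F < \<infinity>"
    and min: "\<And>G. hol_section D G \<Longrightarrow> G w = s \<Longrightarrow> wnorm D h W F \<le> wnorm D h W G"
    and q: "hol_section D q" "q w = 0" "wnorm D h W q < \<infinity>"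
  shows "(\<integral>z. Re (hprod (h z) (F z) (q z)) * W z \<partial>lebesgue_on D) = 0"
proof -
  have conth: "continuous_on D h" and pd: "\<And>z. z \<in> D \<Longrightarrow> pos_def_hermitian (h z)"
    using h by (auto simp: continuous_hermitian_metric_def)
  have contF: "continuous_on D F" and contq: "continuous_on D q" using F(1) q(1) by (auto intro: hol_section_continuous)
  define A where "A = (\<integral>z. hnorm_sq (h z) (F z) * W z \<partial>lebesgue_on D)"
  define X where "X = (\<integral>z. Re (hprod (h z) (F z) (q z)) * W z \<partial>lebesgue_on D)"
  define Y where "Y = (\<integral>z. hnorm_sq (h z) (q z) * W z \<partial>lebesgue_on D)"
  have A0: "A \<ge> 0" and Y0: "Y \<ge> 0"
    unfolding A_def Y_def by (intro integral_nonneg_AE AE_I2; auto intro!: mult_nonneg_nonneg hnorm_sq_nonneg pd W)+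
  have wF: "wnorm D h W F = ennreal A" unfolding A_def by (rule wnorm_integrable(2)[OF assms(1) h W contF F(3)])
  have key: "0 \<le> t\<^sup>2 * Y + 2 * t * X" for t :: real
  proof -
    let ?tq = "\<lambda>z. of_real t *s q z"
    have tq: "hol_section D ?tq" by (intro hol_section_scale q holomorphic_intros)
    have conttq: "continuous_on D ?tq" by (rule hol_section_continuous[OF tq])
    have hn: "hnorm_sq (h z) (?tq z) * W z = t\<^sup>2 * (hnorm_sq (h z) (q z) * W z)" for z
      by (simp add: hnorm_sq_scale)
    have fin: "wnorm D h W ?tq < \<infinity>"
      using wnorm_integrable(1)[OF assms(1) h W conttq] wnorm_integrable(1)[OF assms(1) h W contq] q(3)
      unfolding hn by simp
    have add: "wnorm D h W (\<lambda>z. F z + ?tq z) < \<infinity>"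
      "(\<integral>z. hnorm_sq (h z) (F z + ?tq z) * W z \<partial>lebesgue_on D) = A +
        (\<integral>z. hnorm_sq (h z) (?tq z) * W z \<partial>lebesgue_on D) + 2 * (\<integral>z. Re (hprod (h z) (F z) (?tq z)) * W z \<partial>lebesgue_on D)"
      unfolding A_def by (rule integral_hnorm_sq_add[OF assms(1) h W contF F(3) conttq fin]; assumption)+
    have "ennreal A \<le> wnorm D h W (\<lambda>z. F z + ?tq z)"
      unfolding wF[symmetric] by (rule min) (use F q tq hol_section_add in auto)
    also have "\<dots> = ennreal (\<integral>z. hnorm_sq (h z) (F z + ?tq z) * W z \<partial>lebesgue_on D)"
      by (rule wnorm_integrable(2)[OF assms(1) h W continuous_on_add[OF contF conttq] add(1)])
    finally have "A \<le> (\<integral>z. hnorm_sq (h z) (F z + ?tq z) * W z \<partial>lebesgue_on D)"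
      by (subst (asm) ennreal_le_iff)
        (auto intro!: integral_nonneg_AE AE_I2 mult_nonneg_nonneg hnorm_sq_nonneg pd W)
    then show ?thesis unfolding add(2) hn
      by (simp add: A_def X_def Y_def hprod_scale mult.assoc)
  qed
  have "X = 0"
  proof (cases "Y = 0")
    case True
    then show ?thesis using key[of 1] key[of "-1"] by simp
  next
    case False
    then have "Y > 0" using Y0 by simp
    \<comment> \<open>t = - X / Y minimizes the quadratic polynomial in t.\<close>
    have "0 \<le> (- X / Y)\<^sup>2 * Y + 2 * (- X / Y) * X" by (rule key)
    also have "\<dots> = - X\<^sup>2 / Y" using \<open>Y > 0\<close> by (simp add: field_simps power2_eq_square)
    finally have "X\<^sup>2 \<le> 0" using \<open>Y > 0\<close> by (simp add: field_simps)
    then show ?thesis by simp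
  qed
  then show ?thesis by (simp add: X_def)
qed

section \<open>The Green function\<close>

text \<open>The second derivative in direction v is Re (p' v^2), and 1^2 + i^2 = 0.\<close>

lemma harmonic_onI:
  assumes "open S" "p holomorphic_on S"
    and H: "\<And>z. z \<in> S \<Longrightarrow> (H has_derivative (\<lambda>v. Re (p z * v))) (at z)"
  shows "harmonic_on S H"
  unfolding harmonic_on_def
proof (intro conjI ballI)
  show "Ck_on 2 S H" by (rule Ck_on_harmonic[OF assms])
  fix z assume z: "z \<in> S"
  have d: "dirderiv v (dirderiv v H) z = Re (deriv p z * v * v)" for v
  proof (rule dirderiv_eq[where f'="\<lambda>x. Re (deriv p z * x * v)"])
    have "(p has_derivative (\<lambda>x. deriv p z * x)) (at z)"
      using holomorphic_derivI[OF assms(2,1) z] by (simp add: has_field_derivative_def)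
    then have "((\<lambda>y. Re (p y * v)) has_derivative (\<lambda>x. Re (deriv p z * x * v))) (at z)"
      by (intro has_derivative_Re has_derivative_mult_left)
    then show "(dirderiv v H has_derivative (\<lambda>x. Re (deriv p z * x * v))) (at z)"
      by (rule has_derivative_transform_within_open[OF _ assms(1) z]) (simp add: dirderiv_eq[OF H])
  qed
  show "dirderiv 1 (dirderiv 1 H) z + dirderiv \<i> (dirderiv \<i> H) z = 0"
    unfolding d by simp
qed

lemma has_derivative_ln_cmod:
  assumes "z \<noteq> a"
  shows "((\<lambda>z. ln (cmod (z - a))) has_derivative (\<lambda>v. Re (1 / (z - a) * v))) (at z)"
proof -
  have pos: "(z - a) \<bullet> (z - a) > 0" using assms by simp
  have d: "((\<lambda>z. ln ((z - a) \<bullet> (z - a)) / 2) has_derivative (\<lambda>v. ((z - a) \<bullet> v) / ((z - a) \<bullet> (z - a)))) (at z)"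
    using pos by (auto intro!: derivative_eq_intros simp: inner_commute field_simps)
  have e1: "ln (cmod (z - a)) = ln ((z - a) \<bullet> (z - a)) / 2" for z
    by (cases "z = a") (auto simp: dot_square_norm ln_realpow)
  have e2: "((z - a) \<bullet> v) / ((z - a) \<bullet> (z - a)) = Re (1 / (z - a) * v)" for v
    by (simp add: inner_complex_def Re_divide power2_eq_square)
  show ?thesis unfolding e1 by (rule d[unfolded e2])
qed

lemma subharmonic_onD:
  assumes "subharmonic_on UNIV u"
  shows "u z < \<infinity>" "u z < c \<Longrightarrow> \<forall>\<^sub>F y in nhds z. u y < c"
  using assms unfolding subharmonic_on_def by simp_all

lemma subharmonic_on_le:
  assumes "subharmonic_on UNIV u" "compact K" "continuous_on K H" "harmonic_on (interior K) H"
    and "\<And>z. z \<in> frontier K \<Longrightarrow> u z \<le> ereal (H z)" "z \<in> K"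
  shows "u z \<le> ereal (H z)"
proof -
  have "\<forall>K H. compact K \<and> K \<subseteq> UNIV \<and> continuous_on K H \<and> harmonic_on (interior K) H \<and>
        (\<forall>z\<in>frontier K. u z \<le> ereal (H z)) \<longrightarrow> (\<forall>z\<in>K. u z \<le> ereal (H z))"
    using assms(1) unfolding subharmonic_on_def by (elim conjE)
  then have "\<forall>z\<in>K. u z \<le> ereal (H z)" using assms(2-5) by (elim allE[of _ K] allE[of _ H] impE) blast+
  then show ?thesis using assms(6) ..
qed

lemma usc_bounded_above:
  fixes u :: "complex \<Rightarrow> ereal"
  assumes "compact K" "\<And>z. u z < \<infinity>" "\<And>z c. u z < c \<Longrightarrow> \<forall>\<^sub>F y in nhds z. u y < c"
  obtains M :: real where "\<And>z. z \<in> K \<Longrightarrow> u z \<le> ereal M"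
proof -
  have "\<exists>c r. r > 0 \<and> (\<forall>y\<in>ball z r. u y < ereal c)" for z
  proof -
    have "u z \<noteq> \<infinity>" using assms(2)[of z] by auto
    with less_PInf_Ex_of_nat[of "u z"] obtain n :: nat where "u z < ereal (real n)" by blast
    from assms(3)[OF this] obtain d where "d > 0" "\<forall>x. dist x z < d \<longrightarrow> u x < ereal (real n)"
      unfolding eventually_nhds_metric by blast
    then show ?thesis
      by (intro exI[of _ "real n"] exI[of _ d]) (auto simp: dist_commute)
  qed
  then have "\<forall>z. \<exists>p. snd p > 0 \<and> (\<forall>y\<in>ball z (snd p). u y < ereal (fst p))" by auto
  from choice[OF this] obtain p where "\<forall>z. snd (p z) > 0 \<and> (\<forall>y\<in>ball z (snd (p z)). u y < ereal (fst (p z)))" ..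
  moreover define c where "c z = fst (p z)" for z
  moreover define r where "r z = snd (p z)" for z
  ultimately have cr: "\<And>z. r z > 0" "\<And>z y. y \<in> ball z (r z) \<Longrightarrow> u y < ereal (c z)" by auto
  obtain C where C: "C \<subseteq> K" "finite C" "K \<subseteq> (\<Union>z\<in>C. ball z (r z))"
    by (rule compactE_image[OF assms(1), of K "\<lambda>z. ball z (r z)"]) (use cr(1) in auto)
  show ?thesis
  proof (rule that[of "Max (insert 0 (c ` C))"])
    fix z assume "z \<in> K"
    then obtain x where x: "x \<in> C" "z \<in> ball x (r x)" using C(3) by auto
    have "u z \<le> ereal (c x)" using cr(2)[OF x(2)] by simp
    also have "c x \<le> Max (insert 0 (c ` C))" using C(2) x(1) by (intro Max_ge) auto
    finally show "u z \<le> ereal (Max (insert 0 (c ` C)))" by simp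
  qed
qed

text \<open>If \<open>u = -\<infinity>\<close> on a disc, comparing \<open>u\<close> on annuli with large multiples of \<open>log |z - a|\<close> gives
  \<open>u = -\<infinity>\<close> everywhere.\<close>

lemma subharmonic_minus_infinity:
  assumes u: "subharmonic_on UNIV u" and "r > 0" and inf: "\<And>z. z \<in> ball a r \<Longrightarrow> u z = -\<infinity>"
  shows "u z = -\<infinity>"
proof (cases "z \<in> ball a r")
  case False
  define R where "R = dist a z + 1"
  have d: "r \<le> dist a z" using False by simp
  obtain M where M: "\<And>y. y \<in> cball a R \<Longrightarrow> u y \<le> ereal M"
    using usc_bounded_above[where u=u, OF compact_cball subharmonic_onD(1)[OF u] subharmonic_onD(2)[OF u]]
    by blast
  \<comment> \<open>The inner radius r / 2 puts the inner circle where u = -\<infinity>; the outer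
    radius R exceeds |z - a|, which makes ln (R / |z - a|) positive.\<close>
  define K where "K = cball a R - ball a (r / 2)"
  have le: "u z \<le> ereal (M - real n * ln (R / dist a z))" for n :: nat
  proof -
    define H where "H y = M - real n * (ln R - ln (cmod (y - a)))" for y
    have K: "compact K" unfolding K_def by (intro compact_diff) auto
    have aK: "y \<noteq> a" if "y \<in> K" for y using that \<open>r > 0\<close> by (auto simp: K_def)
    have dH: "(H has_derivative (\<lambda>v. Re (of_nat n / (y - a) * v))) (at y)" if "y \<noteq> a" for y
    proof -
      have "(H has_derivative (\<lambda>v. 0 - real n * (0 - Re (1 / (y - a) * v)))) (at y)"
        unfolding H_def by (intro derivative_intros has_derivative_ln_cmod that)
      moreover have "0 - real n * (0 - Re (1 / (y - a) * v)) = Re (of_nat n / (y - a) * v)" for v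
      proof -
        have "of_nat n / (y - a) * v = complex_of_real (real n) * (1 / (y - a) * v)" by simp
        then show ?thesis by (simp only: Re_complex_of_real times_complex.sel Im_complex_of_real) (simp add: algebra_simps)
      qed
      ultimately show ?thesis by (simp only:)
    qed
    have cH: "continuous_on K H"
      by (intro continuous_at_imp_continuous_on ballI has_derivative_continuous[OF dH]) (rule aK)
    have aI: "y \<noteq> a" if "y \<in> interior K" for y using that aK interior_subset by blast
    have hH: "harmonic_on (interior K) H"
      by (rule harmonic_onI[OF open_interior, of "\<lambda>y. of_nat n / (y - a)"])
        (use aI in \<open>auto intro!: holomorphic_intros intro: dH[simplified]\<close>)
    have fr: "u y \<le> ereal (H y)" if "y \<in> frontier K" for y
    proof -
      have yK: "y \<in> K" using that K by (meson compact_imp_closed frontier_subset_closed subsetD)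
      have "y \<notin> ball a R - cball a (r / 2)"
      proof
        assume "y \<in> ball a R - cball a (r / 2)"
        then have "y \<in> interior K"
          by (intro interiorI[of "ball a R - cball a (r / 2)"]) (auto simp: K_def intro: open_Diff)
        then show False using that by (simp add: frontier_def)
      qed
      with yK consider "dist a y = R" | "dist a y \<le> r / 2" by (auto simp: K_def)
      then show ?thesis
      proof cases
        case 1
        then have "H y = M" by (simp add: H_def dist_norm norm_minus_commute)
        then show ?thesis using M[of y] 1 by simp
      next
        case 2
        then have "u y = -\<infinity>" using inf[of y] \<open>r > 0\<close> by auto
        then show ?thesis by simp
      qed
    qed
    have zK: "z \<in> K" using d \<open>r > 0\<close> by (auto simp: K_def R_def)
    have "u z \<le> ereal (H z)"
      by (rule subharmonic_on_le[OF u K cH hH fr zK])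
    also have "H z = M - real n * ln (R / dist a z)"
      using d \<open>r > 0\<close> by (simp add: H_def ln_div R_def dist_norm norm_minus_commute add_pos_pos)
    finally show ?thesis .
  qed
  have "dist a z > 0" using d \<open>r > 0\<close> by linarith
  then have "R / dist a z > 1" unfolding R_def by (subst less_divide_eq_1_pos) simp_all
  then have pos: "ln (R / dist a z) > 0" by (rule ln_gt_zero)
  have "u z \<le> ereal B" for B
  proof -
    obtain n where "real n > (M - B) / ln (R / dist a z)" using reals_Archimedean2 by blast
    then have "M - real n * ln (R / dist a z) \<le> B" using pos by (simp add: field_simps)
    then show ?thesis using le[of n] by (meson ereal_less_eq(3) order_trans)
  qed
  then show ?thesis by (rule ereal_bot)
qed (use inf in auto)

text \<open>Maximum principle with a polar exceptional set. A subharmonic \<open>u\<close> that is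
  -\<infinity> on \<open>N\<close> is compared with the harmonic function M + (\<eta> - g) /
  \<epsilon>: near \<open>N\<close> because u is very negative and g is bounded above, near the
  other boundary points because g < \<eta>, near \<open>w\<close> because g \<le> 0. Letting
  \<epsilon> and \<eta> tend to 0 gives g \<le> 0 wherever u is finite; if g were positive
  somewhere, u would be -\<infinity> on a disc and hence everywhere.\<close>

lemma green_function_nonpos:
  assumes "open D" "bounded D" "w \<in> D" and p: "p holomorphic_on D"
    and H: "\<And>z. z \<in> D \<Longrightarrow> (H has_derivative (\<lambda>v. Re (p z * v))) (at z)"
    and B: "\<And>z. z \<in> D \<Longrightarrow> \<bar>H z\<bar> \<le> B"
    and g: "\<And>z. z \<in> D - {w} \<Longrightarrow> g z = H z + ln (cmod (z - w))"
    and N: "polar N" "\<And>\<zeta>. \<zeta> \<in> frontier D - N \<Longrightarrow> (g \<longlongrightarrow> 0) (at \<zeta> within D)"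
    and z0: "z0 \<in> D - {w}"
  shows "g z0 \<le> 0"
proof -
  obtain u where u: "subharmonic_on UNIV u" "\<exists>z. u z \<noteq> -\<infinity>" "N \<subseteq> {z. u z = -\<infinity>}"
    using N(1) by (auto simp: polar_def)
  have usc: "\<And>z. u z < \<infinity>" "\<And>z c. u z < c \<Longrightarrow> \<forall>\<^sub>F y in nhds z. u y < c"
    using subharmonic_onD[OF u(1)] by blast+
  have compD: "compact (closure D)" using assms(2) by (simp add: compact_closure)
  obtain M where M: "\<And>z. z \<in> closure D \<Longrightarrow> u z \<le> ereal M"
    using usc_bounded_above[where u=u, OF compD usc] by blast
  obtain R where R: "R > 0" "\<And>z. z \<in> D \<Longrightarrow> cmod (z - w) \<le> R"
  proof -
    have "bounded ((\<lambda>z. z - w) ` D)" using assms(2) by (rule bounded_translation_minus)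
    then show ?thesis using that unfolding bounded_pos by auto
  qed
  have dg: "(g has_derivative (\<lambda>v. Re ((p y + 1 / (y - w)) * v))) (at y)" if "y \<in> D - {w}" for y
  proof -
    have "((\<lambda>z. H z + ln (cmod (z - w))) has_derivative (\<lambda>v. Re (p y * v) + Re (1 / (y - w) * v))) (at y)"
      by (intro derivative_intros H has_derivative_ln_cmod) (use that in auto)
    then have "((\<lambda>z. H z + ln (cmod (z - w))) has_derivative (\<lambda>v. Re ((p y + 1 / (y - w)) * v))) (at y)"
      by (simp add: algebra_simps)
    then show ?thesis
      by (rule has_derivative_transform_within_open[of _ _ _ _ "D - {w}"])
        (use that g assms(1) in auto)
  qed
  define Bg where "Bg = B + ln R"
  have Bg: "g y \<le> Bg" if "y \<in> D - {w}" for y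
  proof -
    have "ln (cmod (y - w)) \<le> ln R" using that R by (subst ln_le_cancel_iff) auto
    then show ?thesis using B[of y] g[OF that] that by (auto simp: Bg_def)
  qed
  \<comment> \<open>For finite u this is g + \<epsilon> (u - M) \<le> \<eta>; it is written as a
    harmonic majorant of u because subharmonicity is defined through majorants.\<close>
  have main: "u z \<le> ereal (M + (\<eta> - g z) / \<epsilon>)" if \<epsilon>: "\<epsilon> > 0" and \<eta>: "\<eta> > 0" and z: "z \<in> D - {w}" for \<epsilon> \<eta> z
  proof -
    define P where "P y \<longleftrightarrow> u y \<le> ereal (M + (\<eta> - g y) / \<epsilon>)" for y
    have Pg: "P y" if "y \<in> D" "g y \<le> \<eta>" for y
    proof -
      have "u y \<le> ereal M" using M that(1) closure_subset by blast
      also have "M \<le> M + (\<eta> - g y) / \<epsilon>" using that \<epsilon> by simp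
      finally show ?thesis by (simp add: P_def)
    qed
    have "\<exists>\<rho>>0. \<forall>y\<in>D - {w}. y \<in> ball \<zeta> \<rho> \<longrightarrow> P y" if \<zeta>: "\<zeta> \<in> frontier D" for \<zeta>
    proof (cases "\<zeta> \<in> N")
      case True
      then have "u \<zeta> < ereal (M + (\<eta> - Bg) / \<epsilon>)" using u(3) by auto
      from usc(2)[OF this] obtain \<rho> where \<rho>: "\<rho> > 0" "\<And>y. dist y \<zeta> < \<rho> \<Longrightarrow> u y < ereal (M + (\<eta> - Bg) / \<epsilon>)"
        unfolding eventually_nhds_metric by auto
      have "P y" if "y \<in> D - {w}" "y \<in> ball \<zeta> \<rho>" for y
      proof -
        have "u y \<le> ereal (M + (\<eta> - Bg) / \<epsilon>)" using \<rho>(2)[of y] that(2) by (simp add: dist_commute less_imp_le)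
        also have "M + (\<eta> - Bg) / \<epsilon> \<le> M + (\<eta> - g y) / \<epsilon>"
          using Bg[OF that(1)] \<epsilon> by (simp add: divide_right_mono)
        finally show ?thesis by (simp add: P_def)
      qed
      then show ?thesis using \<rho>(1) by blast
    next
      case False
      then have "(g \<longlongrightarrow> 0) (at \<zeta> within D)" using N(2) \<zeta> by auto
      then have "\<forall>\<^sub>F y in at \<zeta> within D. g y < \<eta>" using \<eta> by (rule order_tendstoD)
      then obtain \<rho> where \<rho>: "\<rho> > 0" "\<And>y. y \<in> D \<Longrightarrow> y \<noteq> \<zeta> \<Longrightarrow> dist y \<zeta> < \<rho> \<Longrightarrow> g y < \<eta>"
        unfolding eventually_at by auto
      have "\<zeta> \<notin> D" using \<zeta> assms(1) by (simp add: frontier_def interior_open)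
      have "P y" if "y \<in> D - {w}" "y \<in> ball \<zeta> \<rho>" for y
      proof (rule Pg)
        have "y \<noteq> \<zeta>" using \<open>\<zeta> \<notin> D\<close> that(1) by auto
        then show "g y \<le> \<eta>" using \<rho>(2)[of y] that by (simp add: dist_commute less_imp_le)
      qed (use that in auto)
      then show ?thesis using \<rho>(1) by blast
    qed
    then have "\<forall>\<zeta>\<in>frontier D. \<exists>\<rho>. \<rho> > 0 \<and> (\<forall>y\<in>D - {w}. y \<in> ball \<zeta> \<rho> \<longrightarrow> P y)" by blast
    from bchoice[OF this] obtain \<rho>
      where "\<forall>\<zeta>\<in>frontier D. \<rho> \<zeta> > 0 \<and> (\<forall>y\<in>D - {w}. y \<in> ball \<zeta> (\<rho> \<zeta>) \<longrightarrow> P y)" ..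
    then have \<rho>: "\<And>\<zeta>. \<zeta> \<in> frontier D \<Longrightarrow> \<rho> \<zeta> > 0"
      "\<And>\<zeta> y. \<zeta> \<in> frontier D \<Longrightarrow> y \<in> D - {w} \<Longrightarrow> y \<in> ball \<zeta> (\<rho> \<zeta>) \<Longrightarrow> P y"
      by blast+
    \<comment> \<open>On this disc ln |y - w| \<le> - B, so the bound on H gives g \<le> 0 <
      \<eta>.\<close>
    define \<rho>w where "\<rho>w = exp (- B)"
    have \<rho>w: "\<rho>w > 0" by (simp add: \<rho>w_def)
    have Pw: "P y" if "y \<in> D - {w}" "y \<in> ball w \<rho>w" for y
    proof (rule Pg)
      have "ln (cmod (y - w)) \<le> - B"
        using that by (subst ln_le_cancel_iff[of _ "exp (- B)", simplified])
          (auto simp: \<rho>w_def dist_norm norm_minus_commute)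
      then show "g y \<le> \<eta>" using B[of y] g[OF that(1)] that(1) \<eta> by auto
    qed (use that in auto)
    have "compact (frontier D)" using assms(2) by (simp add: compact_frontier_bounded)
    then obtain C where C: "C \<subseteq> frontier D" "finite C" "frontier D \<subseteq> (\<Union>\<zeta>\<in>C. ball \<zeta> (\<rho> \<zeta> / 2))"
      by (rule compactE_image[of "frontier D" "frontier D" "\<lambda>\<zeta>. ball \<zeta> (\<rho> \<zeta> / 2)"]) (use \<rho>(1) in auto)
    \<comment> \<open>Halved radii, so that even the closure of \<open>U\<close> stays inside the
      discs where \<open>P\<close> is known; the frontier of closure D - U lies in that
      closure.\<close>
    define U where "U = (\<Union>\<zeta>\<in>C. ball \<zeta> (\<rho> \<zeta> / 2)) \<union> ball w (\<rho>w / 2)"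
    have openU: "open U" unfolding U_def by auto
    have closU: "closure U \<subseteq> (\<Union>\<zeta>\<in>C. ball \<zeta> (\<rho> \<zeta>)) \<union> ball w \<rho>w"
    proof -
      have "U \<subseteq> (\<Union>\<zeta>\<in>C. cball \<zeta> (\<rho> \<zeta> / 2)) \<union> cball w (\<rho>w / 2)"
        unfolding U_def by (intro Un_mono UN_mono ball_subset_cball) simp
      moreover have "closed ((\<Union>\<zeta>\<in>C. cball \<zeta> (\<rho> \<zeta> / 2)) \<union> cball w (\<rho>w / 2))"
        using C(2) by (intro closed_Un closed_UN) auto
      ultimately have "closure U \<subseteq> (\<Union>\<zeta>\<in>C. cball \<zeta> (\<rho> \<zeta> / 2)) \<union> cball w (\<rho>w / 2)"
        by (rule closure_minimal)
      also have "\<dots> \<subseteq> (\<Union>\<zeta>\<in>C. ball \<zeta> (\<rho> \<zeta>)) \<union> ball w \<rho>w"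
      proof (intro Un_mono UN_mono)
        show "cball \<zeta> (\<rho> \<zeta> / 2) \<subseteq> ball \<zeta> (\<rho> \<zeta>)" if "\<zeta> \<in> C" for \<zeta>
          using \<rho>(1)[of \<zeta>] C(1) that by (auto intro: le_less_trans)
        show "cball w (\<rho>w / 2) \<subseteq> ball w \<rho>w" using \<rho>w by (auto intro: le_less_trans)
      qed simp
      finally show ?thesis .
    qed
    have PclosU: "P y" if "y \<in> closure U" "y \<in> D - {w}" for y
      using closU that \<rho>(2) C(1) Pw by blast
    show ?thesis
    proof (cases "z \<in> U")
      case True
      then show ?thesis using PclosU[of z] z closure_subset by (auto simp: P_def)
    next
      case False
      define K where "K = closure D - U"
      have K: "compact K" unfolding K_def by (intro compact_diff compD openU)
      have KD: "K \<subseteq> D - {w}"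
      proof
        fix y assume y: "y \<in> K"
        then have "y \<notin> frontier D" using C(3) by (auto simp: K_def U_def)
        then have "y \<in> interior D" using y by (auto simp: K_def frontier_def)
        moreover have "w \<in> U" using \<rho>w by (simp add: U_def)
        ultimately show "y \<in> D - {w}" using y interior_subset by (auto simp: K_def)
      qed
      have dh: "((\<lambda>y. M + (\<eta> - g y) / \<epsilon>) has_derivative
          (\<lambda>v. Re (- (p y + 1 / (y - w)) / of_real \<epsilon> * v))) (at y)" if "y \<in> D - {w}" for y
      proof -
        have "((\<lambda>y. M + (\<eta> - g y) / \<epsilon>) has_derivative (\<lambda>v. 0 + (0 - Re ((p y + 1 / (y - w)) * v)) / \<epsilon>)) (at y)"
          by (intro has_derivative_add[OF has_derivative_const] has_derivative_diff[OF has_derivative_const]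
              bounded_linear.has_derivative[OF bounded_linear_divide] dg[OF that])
        moreover have "0 + (0 - Re (q * v)) / \<epsilon> = Re (- q / of_real \<epsilon> * v)" for q v :: complex
        proof -
          have "- q / of_real \<epsilon> * v = (- 1 / \<epsilon>) *\<^sub>R (q * v)" by (simp add: scaleR_conv_of_real)
          then show ?thesis by (simp only: scaleR_complex.sel) (simp add: diff_divide_distrib)
        qed
        ultimately show ?thesis by (simp only:)
      qed
      have "u z \<le> ereal (M + (\<eta> - g z) / \<epsilon>)"
      proof -
        have "continuous_on K (\<lambda>y. M + (\<eta> - g y) / \<epsilon>)"
          by (intro continuous_at_imp_continuous_on ballI has_derivative_continuous[OF dh]) (use KD in auto)
        moreover have "harmonic_on (interior K) (\<lambda>y. M + (\<eta> - g y) / \<epsilon>)"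
        proof (rule harmonic_onI[OF open_interior])
          have sub: "interior K \<subseteq> D - {w}" using KD interior_subset by blast
          then show "((\<lambda>y. M + (\<eta> - g y) / \<epsilon>) has_derivative
            (\<lambda>v. Re (- (p y + 1 / (y - w)) / of_real \<epsilon> * v))) (at y)" if "y \<in> interior K" for y
            using that by (intro dh) auto
          show "(\<lambda>y. - (p y + 1 / (y - w)) / of_real \<epsilon>) holomorphic_on interior K"
            using sub \<epsilon> by (intro holomorphic_intros holomorphic_on_subset[OF p]) auto
        qed
        moreover have "u y \<le> ereal (M + (\<eta> - g y) / \<epsilon>)" if "y \<in> frontier K" for y
        proof -
          have yK: "y \<in> K" using that K by (meson compact_imp_closed frontier_subset_closed subsetD)
          have "y \<in> closure U"
          proof (rule ccontr)
            assume "y \<notin> closure U"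
            then have "y \<in> D - closure U" using yK KD by auto
            then have "y \<in> interior K"
              by (intro interiorI[of "D - closure U"])
                (use assms(1) closure_subset[of D] closure_subset[of U] in \<open>auto simp: K_def intro: open_Diff\<close>)
            then show False using that by (simp add: frontier_def)
          qed
          then show ?thesis using PclosU yK KD by (auto simp: P_def)
        qed
        moreover have "z \<in> K" using False z closure_subset by (auto simp: K_def)
        ultimately show ?thesis by (rule subharmonic_on_le[where H="\<lambda>y. M + (\<eta> - g y) / \<epsilon>", OF u(1) K])
      qed
      then show ?thesis .
    qed
  qed
  have le: "g z \<le> 0" if z: "z \<in> D - {w}" and uz: "u z \<noteq> -\<infinity>" for z
  proof -
    obtain c where c: "u z = ereal c" using usc(1)[of z] uz by (cases "u z") auto
    have "g z \<le> 0 + e" if "e > 0" for e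
    proof -
      \<comment> \<open>With c the finite value u z, the choice \<epsilon> = e / (2 d) makes
        \<epsilon> (M - c) at most e / 2.\<close>
      define d where "d = 1 + \<bar>M - c\<bar>"
      have d: "d > 0" "M - c \<le> d" by (auto simp: d_def)
      define \<epsilon> where "\<epsilon> = e / 2 / d"
      have \<epsilon>: "\<epsilon> > 0" using that d by (simp add: \<epsilon>_def)
      have "c \<le> M + (e / 2 - g z) / \<epsilon>" using main[OF \<epsilon> _ z, of "e / 2"] that by (simp add: c)
      then have "g z \<le> e / 2 + \<epsilon> * (M - c)" using \<epsilon> by (simp add: field_simps)
      also have "\<epsilon> * (M - c) \<le> \<epsilon> * d" using \<epsilon> d by (intro mult_left_mono) auto
      also have "\<dots> = e / 2" using d by (simp add: \<epsilon>_def)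
      finally show ?thesis by simp
    qed
    then show ?thesis by (rule field_le_epsilon)
  qed
  show "g z0 \<le> 0"
  proof (rule ccontr)
    assume "\<not> g z0 \<le> 0"
    then have pos: "g z0 > 0" by simp
    have "continuous_on (D - {w}) g"
      by (intro continuous_at_imp_continuous_on ballI has_derivative_continuous[OF dg])
    then have "open ((D - {w}) \<inter> g -` {0<..})"
      using assms(1) by (intro continuous_open_preimage) auto
    moreover have "z0 \<in> (D - {w}) \<inter> g -` {0<..}" using z0 pos by simp
    ultimately obtain r where r: "r > 0" "ball z0 r \<subseteq> (D - {w}) \<inter> g -` {0<..}"
      unfolding open_contains_ball by blast
    have "u z = -\<infinity>" if "z \<in> ball z0 r" for z
      using le[of z] r(2) that by force
    from subharmonic_minus_infinity[OF u(1) r(1) this] u(2) show False by blast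
  qed
qed

text \<open>\<open>log_capacity\<close> is evaluated on the Green function selected by
  \<open>SOME\<close>, so all facts are extracted for that one. Continuity of H turns the limit at
  \<open>w\<close> into the value H w.\<close>

lemma green_function_logarithmic_capacity:
  assumes "open D" "bounded D" "w \<in> D" "\<exists>g. green_function D w g"
  obtains H p B where "p holomorphic_on D"
    "\<And>z. z \<in> D \<Longrightarrow> (H has_derivative (\<lambda>v. Re (p z * v))) (at z)"
    "\<And>z. z \<in> D \<Longrightarrow> \<bar>H z\<bar> \<le> B" "\<And>z. z \<in> D - {w} \<Longrightarrow> H z + ln (cmod (z - w)) \<le> 0"
    "log_capacity D w = exp (H w)"
proof -
  define g where "g = (SOME g. green_function D w g)"
  have "green_function D w g" unfolding g_def using assms(4) by (rule someI_ex)
  then obtain H N where H: "harmonic_on D H" "bounded (H ` D)"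
    "\<And>z. z \<in> D - {w} \<Longrightarrow> g z - ln (cmod (z - w)) = H z"
    and N: "polar N" "\<And>\<zeta>. \<zeta> \<in> frontier D - N \<Longrightarrow> (g \<longlongrightarrow> 0) (at \<zeta> within D)"
    unfolding green_function_def by blast
  obtain p where p: "p holomorphic_on D" "\<And>z. z \<in> D \<Longrightarrow> (H has_derivative (\<lambda>v. Re (p z * v))) (at z)"
    using harmonic_on_gradient[OF assms(1) H(1)] by blast
  obtain B where B: "\<And>z. z \<in> D \<Longrightarrow> \<bar>H z\<bar> \<le> B" using H(2) unfolding bounded_iff by auto
  have g_eq: "g z = H z + ln (cmod (z - w))" if "z \<in> D - {w}" for z using H(3)[OF that] by simp
  have "isCont H w" using p(2)[OF assms(3)] by (rule has_derivative_continuous)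
  then have "(H \<longlongrightarrow> H w) (at w)" by (simp add: isCont_def)
  then have "((\<lambda>z. g z - ln (cmod (z - w))) \<longlongrightarrow> H w) (at w)"
  proof (rule Lim_transform_within_open[OF _ assms(1,3)])
    show "H z = g z - ln (cmod (z - w))" if "z \<in> D" "z \<noteq> w" for z using H(3)[of z] that by simp
  qed
  then have "Lim (at w) (\<lambda>z. g z - ln (cmod (z - w))) = H w" by (intro tendsto_Lim) auto
  then have cap: "log_capacity D w = exp (H w)" by (simp add: log_capacity_def Let_def g_def)
  have nonpos: "H z + ln (cmod (z - w)) \<le> 0" if "z \<in> D - {w}" for z
    using green_function_nonpos[OF assms(1-3) p B g_eq N that] g_eq[OF that] by simp
  show ?thesis by (rule that[OF p B nonpos cap])
qed

section \<open>The weighted estimate\<close>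

text \<open>T is \<phi>_z, and \<phi>_zbar is its conjugate because \<phi> is real; so the mixed
  derivative is the conjugate of the zbar-derivative B of T.\<close>

lemma levi_eqI:
  assumes "open D" "z \<in> D"
    and \<phi>: "\<And>z. z \<in> D \<Longrightarrow> (\<phi> has_derivative (\<lambda>v. 2 * Re (T z * v))) (at z)"
    and T: "(T has_derivative (\<lambda>v. A * v + B * cnj v)) (at z)"
  shows "levi \<phi> z = Re B"
proof -
  have dbar: "d_zbar (\<lambda>x. of_real (\<phi> x)) y = cnj (T y)" if "y \<in> D" for y
  proof (rule wirtinger_eqI(2))
    have "((\<lambda>x. complex_of_real (\<phi> x)) has_derivative (\<lambda>v. of_real (2 * Re (T y * v)))) (at y)"
      by (intro has_derivative_of_real \<phi> that)
    moreover have "complex_of_real (2 * Re (T y * v)) = T y * v + cnj (T y) * cnj v" for v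
      by (simp add: complex_eq_iff)
    ultimately show "((\<lambda>x. complex_of_real (\<phi> x)) has_derivative (\<lambda>v. T y * v + cnj (T y) * cnj v)) (at y)"
      by (simp only:)
  qed
  have "((\<lambda>y. cnj (T y)) has_derivative (\<lambda>v. cnj B * v + cnj A * cnj v)) (at z)"
    by (rule has_derivative_eq_rhs[OF has_derivative_cnj[OF T]]) (simp add: fun_eq_iff add.commute)
  then have "(d_zbar (\<lambda>x. of_real (\<phi> x)) has_derivative (\<lambda>v. cnj B * v + cnj A * cnj v)) (at z)"
    by (rule has_derivative_transform_within_open[OF _ assms(1,2)]) (simp add: dbar)
  from wirtinger_eqI(1)[OF this] show ?thesis by (simp add: levi_def)
qed

lemma has_derivative_cnj_scale:
  assumes "(L has_derivative (\<lambda>v. 2 * Re (G * v))) (at z)"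
  shows "((\<lambda>z. cnj (z - w) * complex_of_real (L z)) has_derivative
    (\<lambda>v. (cnj (z - w) * G) * v + (of_real (L z) + cnj (z - w) * cnj G) * cnj v)) (at z)"
proof -
  have 1: "((\<lambda>z. cnj (z - w)) has_derivative (\<lambda>v. 0 * v + 1 * cnj v)) (at z)"
    by (auto intro!: derivative_eq_intros)
  have "((\<lambda>z. complex_of_real (L z)) has_derivative (\<lambda>v. of_real (2 * Re (G * v)))) (at z)"
    by (intro has_derivative_of_real assms)
  moreover have "complex_of_real (2 * Re (G * v)) = G * v + cnj G * cnj v" for v
    by (simp add: complex_eq_iff)
  ultimately have 2: "((\<lambda>z. complex_of_real (L z)) has_derivative (\<lambda>v. G * v + cnj G * cnj v)) (at z)"
    by (simp only:)
  from has_derivative_wirtinger_mult[OF 1 2] show ?thesis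
    by (simp add: algebra_simps)
qed

lemma cnj_times_self: "cnj y * y = complex_of_real ((cmod y)\<^sup>2)"
  by (simp only: complex_norm_square mult.commute)

lemma has_derivative_cmod_sq:
  "((\<lambda>z. (cmod (z - w))\<^sup>2) has_derivative (\<lambda>v. 2 * Re (cnj (z - w) * v))) (at z)"
proof -
  have "((\<lambda>z. (z - w) \<bullet> (z - w)) has_derivative (\<lambda>v. 2 * ((z - w) \<bullet> v))) (at z)"
    by (auto intro!: derivative_eq_intros simp: inner_commute)
  moreover have "2 * ((z - w) \<bullet> v) = 2 * Re (cnj (z - w) * v)" for v
    by (simp add: inner_complex_def algebra_simps)
  ultimately show ?thesis by (simp only: power2_norm_eq_inner)
qed

lemma has_derivative_real_compose:
  assumes "(f has_real_derivative f') (at (u z))" "(u has_derivative (\<lambda>v. 2 * Re (G * v))) (at z)"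
  shows "((\<lambda>z. f (u z)) has_derivative (\<lambda>v. 2 * Re (of_real f' * G * v))) (at z)"
proof -
  have "((\<lambda>z. f (u z)) has_derivative (\<lambda>v. f' * (2 * Re (G * v)))) (at z)"
    using has_derivative_compose[OF assms(2) assms(1)[unfolded has_field_derivative_def]] .
  moreover have "f' * (2 * Re (G * v)) = 2 * Re (of_real f' * G * v)" for v
    by (simp add: mult.assoc)
  ultimately show ?thesis by (simp only:)
qed

lemma wnorm_finite_mono:
  fixes h :: "complex \<Rightarrow> complex^'r^'r"
  assumes "open D" and h: "continuous_hermitian_metric D h"
    and V: "continuous_on D V" "\<And>z. z \<in> D \<Longrightarrow> 0 \<le> V z"
    and W: "continuous_on D W" "\<And>z. z \<in> D \<Longrightarrow> 0 \<le> W z"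
    and F: "continuous_on D F" and G: "continuous_on D G"
    and le: "\<And>z. z \<in> D \<Longrightarrow> hnorm_sq (h z) (G z) * W z \<le> C * (hnorm_sq (h z) (F z) * V z)"
    and fin: "wnorm D h V F < \<infinity>"
  shows "wnorm D h W G < \<infinity>"
proof -
  have conth: "continuous_on D h" and pd: "\<And>z. z \<in> D \<Longrightarrow> pos_def_hermitian (h z)"
    using h by (auto simp: continuous_hermitian_metric_def)
  have "integrable (lebesgue_on D) (\<lambda>z. hnorm_sq (h z) (G z) * W z)"
  proof (rule Bochner_Integration.integrable_bound)
    show "integrable (lebesgue_on D) (\<lambda>z. C * (hnorm_sq (h z) (F z) * V z))"
      using wnorm_integrable(1)[OF assms(1) h V F] fin by simp
    show "(\<lambda>z. hnorm_sq (h z) (G z) * W z) \<in> borel_measurable (lebesgue_on D)"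
      by (intro borel_measurable_lebesgue_on_continuous assms(1) continuous_intros conth G W)
    show "AE z in lebesgue_on D. norm (hnorm_sq (h z) (G z) * W z) \<le> norm (C * (hnorm_sq (h z) (F z) * V z))"
    proof (rule AE_I2)
      fix z assume "z \<in> space (lebesgue_on D)"
      then have z: "z \<in> D" by simp
      have "0 \<le> hnorm_sq (h z) (G z) * W z" using hnorm_sq_nonneg[OF pd[OF z]] W(2)[OF z] by simp
      then show "norm (hnorm_sq (h z) (G z) * W z) \<le> norm (C * (hnorm_sq (h z) (F z) * V z))"
        using le[OF z] unfolding real_norm_def by linarith
    qed
  qed
  then show ?thesis using wnorm_integrable(1)[OF assms(1) h W G] by simp
qed

text \<open>The upper bound is ln (1 / x) \<le> 1 / x - 1; the lower one is strict because ln x = x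
  - 1 only at x = 1.\<close>

lemma minus_ln_bounds:
  fixes x :: real
  assumes "0 < x" "x < 1"
  shows "0 < x - 1 - ln x" "x - 1 - ln x \<le> (1 - x)\<^sup>2 / x"
proof -
  have "ln x \<le> x - 1" "ln x \<noteq> x - 1"
    using assms ln_le_minus_one[of x] ln_eq_minus_one[of x] by auto
  then show "0 < x - 1 - ln x" by linarith
  have "ln (1 / x) \<le> 1 / x - 1" using assms by (intro ln_le_minus_one) auto
  then have "x - 1 - ln x \<le> x - 1 + (1 / x - 1)" using assms by (simp add: ln_div)
  also have "\<dots> = (1 - x)\<^sup>2 / x" using assms by (simp add: field_simps power2_eq_square)
  finally show "x - 1 - ln x \<le> (1 - x)\<^sup>2 / x" .
qed

text \<open>With \<open>Q = x - 1 - log x\<close> this says that \<open>- log Q\<close> is a convex function of \<open>log (x - a)\<close>.\<close>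

lemma minus_ln_log_concave:
  fixes a x :: real
  assumes "0 < a" "a \<le> x" "x < 1"
  shows "(x - 1 - ln x) * (1 - a / x\<^sup>2) \<le> (x - a) * (1 / x - 1)\<^sup>2"
proof (cases "1 - a / x\<^sup>2 \<le> 0")
  case True
  have "0 < x - 1 - ln x" using assms by (intro minus_ln_bounds) auto
  then have "(x - 1 - ln x) * (1 - a / x\<^sup>2) \<le> 0" using True by (simp add: mult_nonneg_nonpos)
  also have "0 \<le> (x - a) * (1 / x - 1)\<^sup>2" using assms by simp
  finally show ?thesis .
next
  case False
  have x: "0 < x" using assms by simp
  \<comment> \<open>Once Q is replaced by its bound (1 - x)^2 / x, what remains is x - a / x \<le> x
    - a, which holds because x < 1.\<close>
  have "(x - 1 - ln x) * (1 - a / x\<^sup>2) \<le> (1 - x)\<^sup>2 / x * (1 - a / x\<^sup>2)"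
    using False assms by (intro mult_right_mono minus_ln_bounds) auto
  also have "\<dots> = (1 - x)\<^sup>2 / x\<^sup>2 * (x - a / x)"
    using x by (simp add: field_simps power2_eq_square)
  also have "\<dots> \<le> (1 - x)\<^sup>2 / x\<^sup>2 * (x - a)"
    using assms x by (intro mult_left_mono) (auto simp: field_simps)
  also have "\<dots> = (x - a) * (1 / x - 1)\<^sup>2"
    using x by (simp add: field_simps power2_eq_square)
  finally show ?thesis .
qed

lemma continuous_Icc_bounded:
  fixes f :: "real \<Rightarrow> real"
  assumes "continuous_on {a..b} f"
  obtains C where "C > 0" "\<And>x. x \<in> {a..b} \<Longrightarrow> \<bar>f x\<bar> \<le> C"
proof -
  have "bounded (f ` {a..b})" using assms by (intro compact_imp_bounded compact_continuous_image) auto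
  then show ?thesis using that unfolding bounded_pos by auto
qed

text \<open>Hypothesis \<open>sub\<close> confines x to the compact interval [a, 1 - a], where
  \<omega> and q are positive and \<sigma> and 1 / q are bounded; this makes all norms that occur
  finite. The chain behind the conclusion: the norm of \<open>v\<close> is at most that of v + k by
  orthogonality, and this is at most the Hoermander bound; both ends are then integrals of |F|^2
  against explicit weights.\<close>

lemma weighted_estimate:
  fixes h :: "complex \<Rightarrow> complex^'r^'r"
  assumes D: "open D" "bounded D" and h: "continuous_hermitian_metric D h" and opt: "L2_optimal D h"
    and w: "w \<in> D" and p: "p holomorphic_on D"
    and H: "\<And>z. z \<in> D \<Longrightarrow> (H has_derivative (\<lambda>v. Re (p z * v))) (at z)"
    and BH: "\<And>z. z \<in> D \<Longrightarrow> \<bar>H z\<bar> \<le> BH"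
    and a: "0 < a" and sub: "\<And>z. z \<in> D \<Longrightarrow> (cmod (z - w))\<^sup>2 * exp (2 * H z) + a \<le> 1 - a"
    and eps: "0 < \<epsilon>"
    and F0: "hol_section D F0" "F0 w = s" "wnorm D h (\<lambda>_. 1) F0 < \<infinity>"
  obtains F where "hol_section D F" "F w = s" "wnorm D h (\<lambda>_. 1) F < \<infinity>"
    "(\<integral>z. hnorm_sq (h z) (F z) * ((1 - a / ((cmod (z - w))\<^sup>2 * exp (2 * H z) + a)\<^sup>2)
        * exp (- \<epsilon> * (cmod (z - w))\<^sup>2)) \<partial>lebesgue_on D) \<le> 0"
proof -
  have conth: "continuous_on D h" and pd: "\<And>z. z \<in> D \<Longrightarrow> pos_def_hermitian (h z)"
    using h by (auto simp: continuous_hermitian_metric_def)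
  obtain R where R: "R > 0" "\<And>z. z \<in> D \<Longrightarrow> cmod (z - w) \<le> R"
  proof -
    have "bounded ((\<lambda>z. z - w) ` D)" using D(2) by (rule bounded_translation_minus)
    then show ?thesis using that unfolding bounded_pos by auto
  qed
  define E where "E z = exp (2 * H z)" for z
  define x where "x z = (cmod (z - w))\<^sup>2 * E z + a" for z
  define e where "e z = exp (- \<epsilon> * (cmod (z - w))\<^sup>2)" for z
  \<comment> \<open>m is z - w times the z-derivative of 2 G = 2 H + ln |z - w|^2; it is holomorphic
    across w, with value 1 there.\<close>
  define m where "m z = 1 + (z - w) * p z" for z
  define q where "q t = t - 1 - ln t" for t :: real
  \<comment> \<open>\<omega> = - q'. The function (t - a) \<sigma> t, with \<sigma> defined next, is
    the second derivative of - ln q with respect to ln (t - a), so \<sigma> \<ge> 0 is the convexity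
    in \<open>minus_ln_log_concave\<close>.\<close>
  define \<omega> where "\<omega> t = 1 / t - 1" for t :: real
  define \<sigma> where "\<sigma> t = ((t - a) * (\<omega> t)\<^sup>2 - q t * (1 - a / t\<^sup>2)) / (q t)\<^sup>2" for t :: real
  have contH: "continuous_on D H"
    by (intro continuous_at_imp_continuous_on ballI has_derivative_continuous[OF H])
  have contp: "continuous_on D p" using p by (rule holomorphic_on_imp_continuous_on)
  have E0: "E z > 0" for z by (simp add: E_def)
  have contE: "continuous_on D E" unfolding E_def by (intro continuous_intros contH)
  have contx: "continuous_on D x" unfolding x_def by (intro continuous_intros contE)
  have conte: "continuous_on D e" unfolding e_def by (intro continuous_intros)
  have contm: "continuous_on D m" unfolding m_def by (intro continuous_intros contp)
  have xI: "x z \<in> {a..1 - a}" if "z \<in> D" for z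
    using sub[OF that] E0[of z] by (simp add: x_def E_def)
  have I: "0 < t" "t < 1" if "t \<in> {a..1 - a}" for t using that a by auto
  have x0: "0 < x z" "x z < 1" if "z \<in> D" for z using I[OF xI[OF that]] by auto
  have q0: "q t > 0" if "t \<in> {a..1 - a}" for t unfolding q_def by (rule minus_ln_bounds(1)[OF I[OF that]])
  have \<omega>0: "\<omega> t > 0" if "t \<in> {a..1 - a}" for t using I[OF that] by (simp add: \<omega>_def)
  have \<sigma>0: "\<sigma> t \<ge> 0" if "t \<in> {a..1 - a}" for t
    unfolding \<sigma>_def q_def \<omega>_def using minus_ln_log_concave[OF a, of t] that I[OF that]
    by (intro divide_nonneg_nonneg) auto
  have tne: "t \<noteq> 0" if "t \<in> {a..1 - a}" for t using I(1)[OF that] by simp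
  have qne: "q t \<noteq> 0" if "t \<in> {a..1 - a}" for t using q0[OF that] by simp
  have contq: "continuous_on {a..1 - a} q"
    unfolding q_def using tne by (intro continuous_intros) auto
  have cont\<omega>: "continuous_on {a..1 - a} \<omega>"
    unfolding \<omega>_def using tne by (intro continuous_intros) auto
  have cont\<sigma>: "continuous_on {a..1 - a} \<sigma>"
    unfolding \<sigma>_def using tne qne by (intro continuous_intros contq cont\<omega>) auto
  have comp: "continuous_on D (\<lambda>z. f (x z))" if "continuous_on {a..1 - a} f" for f :: "real \<Rightarrow> real"
    by (rule continuous_on_compose2[OF that contx]) (use xI in auto)
  note cq = comp[OF contq] and c\<omega> = comp[OF cont\<omega>] and c\<sigma> = comp[OF cont\<sigma>]
  have qx: "q (x z) > 0" and \<omega>x: "\<omega> (x z) > 0" and \<sigma>x: "\<sigma> (x z) \<ge> 0" if "z \<in> D" for z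
    using q0[OF xI[OF that]] \<omega>0[OF xI[OF that]] \<sigma>0[OF xI[OF that]] by auto
  have qxne: "q (x z) \<noteq> 0" if "z \<in> D" for z using qx[OF that] by simp
  have e0: "0 < e z" "e z \<le> 1" for z using eps by (auto simp: e_def)

  \<comment> \<open>The weights: \<open>W1\<close> of the minimum problem, \<open>W2\<close> of the
    Hoermander bound, \<open>W3\<close> of the norm of \<open>v\<close>, and \<open>W\<phi>\<close>
    = exp (- \<phi>)\<close>
  define W1 where "W1 z = \<omega> (x z) * e z" for z
  define W2 where "W2 z = \<sigma> (x z) * q (x z) * e z" for z
  define W3 where "W3 z = (x z - a) * (\<omega> (x z))\<^sup>2 / q (x z) * e z" for z
  define W\<phi> where "W\<phi> z = q (x z) / E z * e z" for z
  have cW1: "continuous_on D W1" unfolding W1_def by (intro continuous_intros c\<omega> conte)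
  have cW2: "continuous_on D W2" unfolding W2_def by (intro continuous_intros c\<sigma> cq conte)
  have cW3: "continuous_on D W3" unfolding W3_def using qxne by (intro continuous_intros c\<omega> cq contx conte) auto
  have cW\<phi>: "continuous_on D W\<phi>" unfolding W\<phi>_def using E0 by (intro continuous_intros cq contE conte) (auto simp: less_le)
  have W1: "0 < W1 z" if "z \<in> D" for z using \<omega>x[OF that] e0 by (simp add: W1_def)
  have W2: "0 \<le> W2 z" if "z \<in> D" for z using \<sigma>x[OF that] qx[OF that] e0[of z] by (simp add: W2_def)
  have W3: "0 \<le> W3 z" if "z \<in> D" for z using xI[OF that] qx[OF that] e0[of z] by (simp add: W3_def)
  have W\<phi>: "0 < W\<phi> z" if "z \<in> D" for z using E0 qx[OF that] e0 by (simp add: W\<phi>_def)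
  \<comment> \<open>The cancellation behind the choice of q: the terms (x - a) \<omega>^2 / q drop
    out.\<close>
  have W32: "W3 z - W2 z = (1 - a / (x z)\<^sup>2) * e z" if "z \<in> D" for z
  proof -
    have "\<sigma> (x z) * q (x z) = (x z - a) * (\<omega> (x z))\<^sup>2 / q (x z) - (1 - a / (x z)\<^sup>2)"
    proof -
      have "\<sigma> (x z) * q (x z) = ((x z - a) * (\<omega> (x z))\<^sup>2 - q (x z) * (1 - a / (x z)\<^sup>2)) / q (x z)"
        unfolding \<sigma>_def power2_eq_square[of "q (x z)"] using qxne[OF that] by simp
      then show ?thesis
        using qxne[OF that] by (simp add: diff_divide_distrib[of "(x z - a) * (\<omega> (x z))\<^sup>2"])
    qed
    then show ?thesis by (simp add: W3_def W2_def left_diff_distrib)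
  qed

  \<comment> \<open>Comparison of the weights with constants\<close>
  have eR: "exp (- \<epsilon> * R\<^sup>2) \<le> e z" if "z \<in> D" for z
    using R(2)[OF that] R(1) eps by (auto simp: e_def intro!: mult_left_mono power_mono)
  \<comment> \<open>(1 - t) / t \<ge> a / t \<ge> a, because t \<le> 1 - a.\<close>
  have \<omega>low: "a \<le> \<omega> t" if "t \<in> {a..1 - a}" for t
  proof -
    have "a * t \<le> a" using I[OF that] a by (simp add: mult_left_le)
    then show ?thesis using I[OF that] that by (simp add: \<omega>_def field_simps)
  qed
  obtain C\<omega> where C\<omega>: "C\<omega> > 0" "\<And>t. t \<in> {a..1 - a} \<Longrightarrow> \<bar>\<omega> t\<bar> \<le> C\<omega>"
    using continuous_Icc_bounded[OF cont\<omega>] by metis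
  have cont2: "continuous_on {a..1 - a} (\<lambda>t. \<sigma> t * q t)" by (intro continuous_intros cont\<sigma> contq)
  obtain C2 where C2: "C2 > 0" "\<And>t. t \<in> {a..1 - a} \<Longrightarrow> \<bar>\<sigma> t * q t\<bar> \<le> C2"
    using continuous_Icc_bounded[OF cont2] by metis
  have cont3: "continuous_on {a..1 - a} (\<lambda>t. (t - a) * (\<omega> t)\<^sup>2 / q t)"
    using qne by (intro continuous_intros cont\<omega> contq) auto
  obtain C3 where C3: "C3 > 0" "\<And>t. t \<in> {a..1 - a} \<Longrightarrow> \<bar>(t - a) * (\<omega> t)\<^sup>2 / q t\<bar> \<le> C3"
    using continuous_Icc_bounded[OF cont3] by metis
  have cont4: "continuous_on {a..1 - a} (\<lambda>t. 1 / q t)"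
    using qne by (intro continuous_intros contq) auto
  obtain C4 where C4: "C4 > 0" "\<And>t. t \<in> {a..1 - a} \<Longrightarrow> \<bar>1 / q t\<bar> \<le> C4"
    using continuous_Icc_bounded[OF cont4] by metis

  have one: "continuous_on D (\<lambda>_. 1 :: real)" "\<And>z. z \<in> D \<Longrightarrow> 0 \<le> (1 :: real)" by auto
  have bnd1: "W1 z \<le> C\<omega>" if "z \<in> D" for z
  proof -
    have "\<omega> (x z) * e z \<le> C\<omega> * 1"
      using C\<omega>(2)[OF xI[OF that]] \<omega>x[OF that] e0[of z] C\<omega>(1) by (intro mult_mono) auto
    then show ?thesis by (simp add: W1_def)
  qed
  have bnd1': "1 \<le> 1 / (a * exp (- \<epsilon> * R\<^sup>2)) * W1 z" if "z \<in> D" for z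
  proof -
    have "a * exp (- \<epsilon> * R\<^sup>2) \<le> \<omega> (x z) * e z"
      using \<omega>low[OF xI[OF that]] eR[OF that] a by (intro mult_mono) auto
    then show ?thesis using a by (simp add: W1_def field_simps)
  qed
  have bnd2: "W2 z \<le> C2" if "z \<in> D" for z
  proof -
    have "(\<sigma> (x z) * q (x z)) * e z \<le> C2 * 1"
      using C2(2)[OF xI[OF that]] \<sigma>x[OF that] qx[OF that] e0[of z] C2(1) by (intro mult_mono) auto
    then show ?thesis by (simp add: W2_def)
  qed
  have bnd3: "W3 z \<le> C3" if "z \<in> D" for z
  proof -
    have "((x z - a) * (\<omega> (x z))\<^sup>2 / q (x z)) * e z \<le> C3 * 1"
      using abs_le_D1[OF C3(2)[OF xI[OF that]]] e0[of z] C3(1) by (intro mult_mono) auto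
    then show ?thesis by (simp add: W3_def)
  qed
  define C\<phi> where "C\<phi> = C4 * exp (2 * BH) / exp (- \<epsilon> * R\<^sup>2)"
  have C\<phi>: "C\<phi> > 0" using C4(1) by (simp add: C\<phi>_def)
  have bnd\<phi>: "1 \<le> C\<phi> * W\<phi> z" if "z \<in> D" for z
  proof -
    have "1 \<le> C4 * q (x z)" using C4(2)[OF xI[OF that]] qx[OF that] by (simp add: field_simps)
    moreover have "E z \<le> exp (2 * BH)" using BH[OF that] by (simp add: E_def)
    moreover have "exp (- \<epsilon> * R\<^sup>2) \<le> e z" by (rule eR[OF that])
    ultimately have "E z * exp (- \<epsilon> * R\<^sup>2) * 1 \<le> exp (2 * BH) * e z * (C4 * q (x z))"
      using E0[of z] e0[of z] by (intro mult_mono) auto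
    then show ?thesis using E0[of z] by (simp add: C\<phi>_def W\<phi>_def field_simps)
  qed

  \<comment> \<open>The minimal section and the finiteness of its norms\<close>
  have "wnorm D h W1 F0 < \<infinity>"
  proof (rule wnorm_finite_mono[OF D(1) h one cW1 less_imp_le[OF W1] hol_section_continuous[OF F0(1)] hol_section_continuous[OF F0(1)] _ F0(3)])
    show "hnorm_sq (h z) (F0 z) * W1 z \<le> C\<omega> * (hnorm_sq (h z) (F0 z) * 1)" if "z \<in> D" for z
      using mult_left_mono[OF bnd1[OF that] hnorm_sq_nonneg[OF pd[OF that], of "F0 z"]] by (simp add: mult.commute)
  qed auto
  from wnorm_minimizer[OF D(1) h cW1 W1 w F0(1,2) this]
  obtain F where F: "hol_section D F" "F w = s"
    and min: "\<And>G. hol_section D G \<Longrightarrow> G w = s \<Longrightarrow> wnorm D h W1 F \<le> wnorm D h W1 G"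
    by blast
  have F1: "wnorm D h W1 F < \<infinity>" using min[OF F0(1,2)] \<open>wnorm D h W1 F0 < \<infinity>\<close> by (rule le_less_trans)
  have contF: "continuous_on D F" by (rule hol_section_continuous[OF F(1)])
  have nF: "0 \<le> hnorm_sq (h z) b" if "z \<in> D" for z b by (rule hnorm_sq_nonneg[OF pd[OF that]])
  have fin0: "wnorm D h (\<lambda>_. 1) F < \<infinity>"
  proof (rule wnorm_finite_mono[OF D(1) h cW1 less_imp_le[OF W1] one contF contF _ F1])
    show "hnorm_sq (h z) (F z) * 1 \<le> 1 / (a * exp (- \<epsilon> * R\<^sup>2)) * (hnorm_sq (h z) (F z) * W1 z)" if "z \<in> D" for z
      using mult_left_mono[OF bnd1'[OF that] nF[OF that, of "F z"]] by (simp add: mult_ac)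
  qed auto
  have fin2: "wnorm D h W2 F < \<infinity>"
  proof (rule wnorm_finite_mono[OF D(1) h one cW2 W2 contF contF _ fin0])
    show "hnorm_sq (h z) (F z) * W2 z \<le> C2 * (hnorm_sq (h z) (F z) * 1)" if "z \<in> D" for z
      using mult_left_mono[OF bnd2[OF that] nF[OF that, of "F z"]] by (simp add: mult.commute)
  qed auto
  have fin3: "wnorm D h W3 F < \<infinity>"
  proof (rule wnorm_finite_mono[OF D(1) h one cW3 W3 contF contF _ fin0])
    show "hnorm_sq (h z) (F z) * W3 z \<le> C3 * (hnorm_sq (h z) (F z) * 1)" if "z \<in> D" for z
      using mult_left_mono[OF bnd3[OF that] nF[OF that, of "F z"]] by (simp add: mult.commute)
  qed auto

  \<comment> \<open>The scalar factor \<open>v0\<close> of \<open>v\<close> and its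
    derivatives\<close>
  define \<rho>g where "\<rho>g z = cnj (z - w) * of_real (E z) * m z" for z
  have dH: "((\<lambda>z. 2 * H z) has_derivative (\<lambda>v. 2 * Re (p z * v))) (at z)" if "z \<in> D" for z
    by (intro derivative_intros H that)
  have dE: "(E has_derivative (\<lambda>v. 2 * Re (of_real (E z) * p z * v))) (at z)" if "z \<in> D" for z
    unfolding E_def by (rule has_derivative_real_compose[OF DERIV_exp dH[OF that]])
  have dx: "(x has_derivative (\<lambda>v. 2 * Re (\<rho>g z * v))) (at z)" if "z \<in> D" for z
  proof -
    have "(x has_derivative (\<lambda>v. ((cmod (z - w))\<^sup>2 * (2 * Re (of_real (E z) * p z * v)) + 2 * Re (cnj (z - w) * v) * E z) + 0)) (at z)"
      unfolding x_def by (intro has_derivative_add has_derivative_mult has_derivative_cmod_sq dE that has_derivative_const)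
    moreover have "((cmod (z - w))\<^sup>2 * (2 * Re (of_real (E z) * p z * v)) + 2 * Re (cnj (z - w) * v) * E z) + 0
        = 2 * Re (\<rho>g z * v)" for v
    proof -
      have "\<rho>g z * v = of_real (E z) * (cnj (z - w) * v) + of_real ((cmod (z - w))\<^sup>2) * (of_real (E z) * p z * v)"
        unfolding \<rho>g_def m_def complex_norm_square by (simp add: algebra_simps)
      then show ?thesis by (simp only: plus_complex.sel Re_complex_of_real Im_complex_of_real times_complex.sel) (simp add: algebra_simps)
    qed
    ultimately show ?thesis by (simp only:)
  qed
  \<comment> \<open>\<open>k0\<close> is the derivative of - ln q, and \<open>k1\<close> is that of
    \<open>k0\<close>; together with \<open>\<rho>g\<close>, the z-derivative of x, they
    differentiate both \<open>v0\<close> and \<phi>.\<close>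
  define k0 where "k0 t = \<omega> t / q t" for t
  define k1 where "k1 t = ((\<omega> t)\<^sup>2 - q t / t\<^sup>2) / (q t)\<^sup>2" for t
  have dq: "(q has_real_derivative - \<omega> t) (at t)" if "t \<in> {a..1 - a}" for t
    unfolding q_def using I[OF that] by (auto intro!: derivative_eq_intros simp: \<omega>_def)
  have d\<omega>: "(\<omega> has_real_derivative - (1 / t\<^sup>2)) (at t)" if "t \<in> {a..1 - a}" for t
    unfolding \<omega>_def using I[OF that] by (auto intro!: derivative_eq_intros simp: power2_eq_square)
  have dk: "(k0 has_real_derivative k1 t) (at t)" if "t \<in> {a..1 - a}" for t
  proof -
    have "(k0 has_real_derivative (- (1 / t\<^sup>2) * q t - \<omega> t * - \<omega> t) / (q t * q t)) (at t)"
      unfolding k0_def using qne[OF that] by (intro DERIV_divide d\<omega> dq that)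
    then show ?thesis by (simp add: k1_def power2_eq_square)
  qed
  have dlnq: "((\<lambda>t. - ln (q t)) has_real_derivative k0 t) (at t)" if "t \<in> {a..1 - a}" for t
    using q0[OF that] by (auto intro!: derivative_eq_intros dq[OF that] simp: k0_def)
  have ck0: "continuous_on {a..1 - a} k0" and ck1: "continuous_on {a..1 - a} k1"
    unfolding k0_def k1_def using qne tne by (intro continuous_intros contq cont\<omega>; auto)+
  define L where "L z = E z * k0 (x z)" for z
  define Lg where "Lg z = of_real (E z) * (of_real (k0 (x z)) * p z + of_real (k1 (x z)) * \<rho>g z)" for z
  have dL: "(L has_derivative (\<lambda>v. 2 * Re (Lg z * v))) (at z)" if "z \<in> D" for z
  proof -
    have "(L has_derivative (\<lambda>v. E z * (2 * Re (of_real (k1 (x z)) * \<rho>g z * v)) + 2 * Re (of_real (E z) * p z * v) * k0 (x z))) (at z)"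
      unfolding L_def
      by (intro has_derivative_mult dE that has_derivative_real_compose[OF dk[OF xI[OF that]] dx[OF that]])
    moreover have "E z * (2 * Re (of_real (k1 (x z)) * \<rho>g z * v)) + 2 * Re (of_real (E z) * p z * v) * k0 (x z) = 2 * Re (Lg z * v)" for v
      by (simp add: Lg_def algebra_simps)
    ultimately show ?thesis by (simp only:)
  qed
  define v0 where "v0 z = cnj (z - w) * complex_of_real (L z)" for z
  define A0 where "A0 z = cnj (z - w) * Lg z" for z
  define B0 where "B0 z = of_real (\<sigma> (x z) * E z) * cnj (m z)" for z
  \<comment> \<open>The zbar-derivative of conj (z - w) L. Since conj (z - w) x_zbar = (x - a) conj
    m, the coefficients collect to k0 + (x - a) k1 = \<sigma>.\<close>
  have B0_eq: "of_real (L z) + cnj (z - w) * cnj (Lg z) = B0 z" if "z \<in> D" for z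
  proof -
    let ?t = "x z"
    have t: "?t \<in> {a..1 - a}" by (rule xI[OF that])
    have \<sigma>k: "\<sigma> ?t = k0 ?t + (?t - a) * k1 ?t"
      using qne[OF t] tne[OF t] unfolding \<sigma>_def k0_def k1_def \<omega>_def
      by (simp add: divide_simps power2_eq_square) (simp add: algebra_simps)
    have X: "cnj (z - w) * cnj (\<rho>g z) = of_real (?t - a) * cnj (m z)"
    proof -
      have "cnj (z - w) * cnj (\<rho>g z) = (cnj (z - w) * (z - w)) * of_real (E z) * cnj (m z)"
        unfolding \<rho>g_def by simp
      then show ?thesis unfolding cnj_times_self x_def by simp
    qed
    have "of_real (L z) + cnj (z - w) * cnj (Lg z)
      = of_real (E z) * (of_real (k0 ?t) * (1 + cnj (z - w) * cnj (p z)) + of_real (k1 ?t) * (cnj (z - w) * cnj (\<rho>g z)))"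
      unfolding L_def Lg_def by (simp add: algebra_simps del: complex_cnj_diff)
    also note X
    also have "1 + cnj (z - w) * cnj (p z) = cnj (m z)" by (simp add: m_def)
    also have "of_real (E z) * (of_real (k0 ?t) * cnj (m z) + of_real (k1 ?t) * (of_real (?t - a) * cnj (m z))) = B0 z"
      unfolding B0_def \<sigma>k by (simp add: algebra_simps)
    finally show ?thesis .
  qed
  have dv0: "(v0 has_derivative (\<lambda>v. A0 z * v + B0 z * cnj v)) (at z)" if "z \<in> D" for z
    using has_derivative_cnj_scale[OF dL[OF that], of w] unfolding v0_def A0_def B0_eq[OF that] .

  \<comment> \<open>The weight \<phi> and its Levi form\<close>
  define l where "l z = \<sigma> (x z) * E z * (cmod (m z))\<^sup>2 + \<epsilon>" for z
  define \<phi> where "\<phi> z = 2 * H z + - ln (q (x z)) + \<epsilon> * (cmod (z - w))\<^sup>2" for z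
  \<comment> \<open>T = \<phi>_z. Here v0 m is the z-derivative of - ln (q x), so B0 m is the Levi
    form of that term, while B0 is the datum of the equation for v0. The quotient of |B0|^2 by B0 m,
    where it is defined, is just \<sigma> E.\<close>
  define T where "T z = p z + v0 z * m z + \<epsilon> * cnj (z - w)" for z
  have k\<rho>: "of_real (k0 (x z)) * \<rho>g z = v0 z * m z" for z
    by (simp add: \<rho>g_def v0_def L_def mult_ac)
  have d\<phi>: "(\<phi> has_derivative (\<lambda>v. 2 * Re (T z * v))) (at z)" if "z \<in> D" for z
  proof -
    have "(\<phi> has_derivative (\<lambda>v. 2 * Re (p z * v) + 2 * Re (of_real (k0 (x z)) * \<rho>g z * v) + \<epsilon> * (2 * Re (cnj (z - w) * v)))) (at z)"
      unfolding \<phi>_def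
      by (intro has_derivative_add dH that has_derivative_real_compose[OF dlnq[OF xI[OF that]] dx[OF that]]
          has_derivative_mult_right has_derivative_cmod_sq)
    moreover have "2 * Re (p z * v) + 2 * Re (of_real (k0 (x z)) * \<rho>g z * v) + \<epsilon> * (2 * Re (cnj (z - w) * v)) = 2 * Re (T z * v)" for v
      unfolding k\<rho> T_def by (simp add: algebra_simps)
    ultimately show ?thesis by (simp only:)
  qed
  have levi: "levi \<phi> z = l z" if "z \<in> D" for z
  proof -
    have hol: "(f has_derivative (\<lambda>v. deriv f z * v + 0 * cnj v)) (at z)" if "f holomorphic_on D" for f
      using holomorphic_derivI[OF that D(1) \<open>z \<in> D\<close>] by (simp add: has_field_derivative_def)
    have "m holomorphic_on D" unfolding m_def by (intro holomorphic_intros p)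
    from has_derivative_wirtinger_mult[OF dv0[OF that] hol[OF this]]
    have 1: "((\<lambda>z. v0 z * m z) has_derivative (\<lambda>v. (v0 z * deriv m z + A0 z * m z) * v + (v0 z * 0 + B0 z * m z) * cnj v)) (at z)" .
    have 2: "((\<lambda>z. \<epsilon> * cnj (z - w)) has_derivative (\<lambda>v. \<epsilon> * cnj v)) (at z)"
      by (auto intro!: derivative_eq_intros)
    have "(T has_derivative (\<lambda>v. (deriv p z * v + 0 * cnj v) + ((v0 z * deriv m z + A0 z * m z) * v + (v0 z * 0 + B0 z * m z) * cnj v) + \<epsilon> * cnj v)) (at z)"
      unfolding T_def by (intro has_derivative_add hol[OF p] 1 2)
    then have "(T has_derivative (\<lambda>v. (deriv p z + (v0 z * deriv m z + A0 z * m z)) * v + (B0 z * m z + \<epsilon>) * cnj v)) (at z)"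
      by (rule has_derivative_eq_rhs) (simp add: fun_eq_iff algebra_simps)
    from levi_eqI[OF D(1) that d\<phi> this] have "levi \<phi> z = Re (B0 z * m z + \<epsilon>)" .
    also have "B0 z * m z = of_real (\<sigma> (x z) * E z * (cmod (m z))\<^sup>2)"
    proof -
      have "B0 z * m z = of_real (\<sigma> (x z) * E z) * (cnj (m z) * m z)" by (simp add: B0_def)
      then show ?thesis unfolding cnj_times_self by simp
    qed
    finally show ?thesis by (simp add: l_def)
  qed
  have l0: "0 < l z" if "z \<in> D" for z
    using \<sigma>x[OF that] E0[of z] eps by (simp add: l_def add_nonneg_pos)
  have cl: "continuous_on D l" unfolding l_def by (intro continuous_intros c\<sigma> contE contm)
  have exp\<phi>: "exp (- \<phi> z) = W\<phi> z" if "z \<in> D" for z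
    using qx[OF that] by (simp add: \<phi>_def W\<phi>_def E_def e_def exp_diff exp_add exp_minus exp_ln divide_simps)
  have smooth: "smooth_on D \<phi>"
    unfolding smooth_on_def
  proof
    fix k
    have cH: "Ck_on k D H" by (rule Ck_on_harmonic[OF D(1) p H])
    have c2H: "Ck_on k D (\<lambda>z. 2 * H z)" by (intro Ck_on_mult Ck_on_const D(1) cH)
    have cx: "Ck_on k D x"
      unfolding x_def E_def by (intro Ck_on_add Ck_on_mult Ck_on_cmod_sq Ck_on_exp Ck_on_const D(1) c2H)
    have "Ck_on k D (\<lambda>z. (x z + - 1) + - 1 * ln (x z))"
      using x0 by (intro Ck_on_add Ck_on_mult Ck_on_const Ck_on_ln D(1) cx)
    then have "Ck_on k D (\<lambda>z. q (x z))" by (simp add: q_def)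
    then have "Ck_on k D (\<lambda>z. 2 * H z + - 1 * ln (q (x z)) + \<epsilon> * (cmod (z - w))\<^sup>2)"
      using qx by (intro Ck_on_add Ck_on_mult Ck_on_const Ck_on_ln Ck_on_cmod_sq D(1) c2H)
    then show "Ck_on k D \<phi>" by (simp add: \<phi>_def[abs_def])
  qed

  \<comment> \<open>The solution provided by optimality and its norm\<close>
  define v where "v z = v0 z *s F z" for z
  define \<beta> where "\<beta> z = B0 z *s F z" for z
  define A where "A z = (\<chi> i. v0 z * deriv (\<lambda>z. F z $ i) z + A0 z * F z $ i)" for z
  have cv0: "continuous_on D v0"
    by (intro continuous_at_imp_continuous_on ballI has_derivative_continuous[OF dv0])
  have cA0: "continuous_on D A0"
    unfolding A0_def Lg_def \<rho>g_def
    by (intro continuous_intros contE contp contm comp[OF ck0] comp[OF ck1])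
  have cB0: "continuous_on D B0" unfolding B0_def by (intro continuous_intros c\<sigma> contE contm)
  have cA: "continuous_on D A"
    unfolding A_def
  proof (intro continuous_on_vec_lambda continuous_on_add continuous_on_mult cv0 cA0 continuous_on_component contF)
    fix i
    have "(\<lambda>z. F z $ i) holomorphic_on D" using F(1) by (simp add: hol_section_def)
    then show "continuous_on D (\<lambda>z. deriv (\<lambda>z. F z $ i) z)"
      by (intro holomorphic_on_imp_continuous_on holomorphic_deriv D(1))
  qed
  have c\<beta>: "continuous_on D \<beta>" unfolding \<beta>_def by (intro continuous_intros cB0 contF)
  have cv: "continuous_on D v" unfolding v_def by (intro continuous_intros cv0 contF)
  have dv: "((\<lambda>z. v z $ i) has_derivative (\<lambda>y. A z $ i * y + \<beta> z $ i * cnj y)) (at z)" if "z \<in> D" for z i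
  proof -
    have "(\<lambda>z. F z $ i) holomorphic_on D" using F(1) by (simp add: hol_section_def)
    then have "((\<lambda>z. F z $ i) has_derivative (\<lambda>y. deriv (\<lambda>z. F z $ i) z * y + 0 * cnj y)) (at z)"
      using holomorphic_derivI[OF _ D(1) that] by (simp add: has_field_derivative_def)
    from has_derivative_wirtinger_mult[OF dv0[OF that] this] show ?thesis
      by (simp add: v_def A_def \<beta>_def)
  qed
  \<comment> \<open>|B0|^2 / l equals \<sigma> E times X / (X + \<epsilon>) \<le> 1; the \<epsilon>
    in \<open>l\<close> takes care of the zeros of m and \<sigma>.\<close>
  have \<beta>le: "hnorm_sq (h z) (\<beta> z) / l z * exp (- \<phi> z) \<le> hnorm_sq (h z) (F z) * W2 z" if "z \<in> D" for z
  proof -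
    define X where "X = \<sigma> (x z) * E z * (cmod (m z))\<^sup>2"
    have X: "X \<ge> 0" using \<sigma>x[OF that] E0[of z] by (simp add: X_def)
    have B: "(cmod (B0 z))\<^sup>2 = \<sigma> (x z) * E z * X"
      using \<sigma>x[OF that] E0[of z] by (simp add: B0_def X_def norm_mult power_mult_distrib power2_eq_square)
    have "hnorm_sq (h z) (\<beta> z) / l z * exp (- \<phi> z) = (X / (X + \<epsilon>)) * (hnorm_sq (h z) (F z) * (\<sigma> (x z) * E z * W\<phi> z))"
    proof -
      have lz: "l z = X + \<epsilon>" by (simp add: l_def X_def)
      show ?thesis unfolding \<beta>_def hnorm_sq_scale exp\<phi>[OF that] lz B
        by (simp add: mult_ac)
    qed
    also have "\<sigma> (x z) * E z * W\<phi> z = W2 z" using E0[of z] by (simp add: W\<phi>_def W2_def)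
    also have "(X / (X + \<epsilon>)) * (hnorm_sq (h z) (F z) * W2 z) \<le> 1 * (hnorm_sq (h z) (F z) * W2 z)"
      using X eps nF[OF that] W2[OF that] by (intro mult_right_mono) (auto simp: divide_le_eq)
    finally show ?thesis by simp
  qed
  have rhs_le: "(\<integral>\<^sup>+z. ennreal (hnorm_sq (h z) (\<beta> z) / l z * exp (- \<phi> z)) \<partial>lebesgue_on D) \<le> wnorm D h W2 F"
    unfolding wnorm_def by (rule nn_integral_mono, rule ennreal_leI, rule \<beta>le) simp
  obtain k where k: "hol_section D k"
    "(\<integral>\<^sup>+z. ennreal (hnorm_sq (h z) (v z + k z) * exp (- \<phi> z)) \<partial>lebesgue_on D) \<le> wnorm D h W2 F"
  proof (rule L2_optimal_estimate[OF D(1) h opt smooth cl levi l0 dv cA c\<beta>])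
    show "(\<integral>\<^sup>+z. ennreal (hnorm_sq (h z) (\<beta> z) / l z * exp (- \<phi> z)) \<partial>lebesgue_on D) < \<infinity>"
      using rhs_le fin2 by (rule le_less_trans)
    fix k :: "complex \<Rightarrow> complex^'r"
    assume "\<And>i. (\<lambda>z. k z $ i) holomorphic_on D"
      "(\<integral>\<^sup>+z. ennreal (hnorm_sq (h z) (v z + k z) * exp (- \<phi> z)) \<partial>lebesgue_on D)
        \<le> (\<integral>\<^sup>+z. ennreal (hnorm_sq (h z) (\<beta> z) / l z * exp (- \<phi> z)) \<partial>lebesgue_on D)"
    then show thesis using rhs_le that[of k] by (auto simp: hol_section_def intro: order_trans)
  qed
  have contk: "continuous_on D k" by (rule hol_section_continuous[OF k(1)])
  have "wnorm D h W\<phi> (\<lambda>z. v z + k z) = (\<integral>\<^sup>+z. ennreal (hnorm_sq (h z) (v z + k z) * exp (- \<phi> z)) \<partial>lebesgue_on D)"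
    unfolding wnorm_def by (rule nn_integral_cong) (simp add: exp\<phi>)
  then have vk: "wnorm D h W\<phi> (\<lambda>z. v z + k z) \<le> wnorm D h W2 F" using k(2) by simp
  note W\<phi>' = less_imp_le[OF W\<phi>]
  have vk_fin: "wnorm D h W\<phi> (\<lambda>z. v z + k z) < \<infinity>" using vk fin2 by (rule le_less_trans)
  have vW: "hnorm_sq (h z) (v z) * W\<phi> z = hnorm_sq (h z) (F z) * W3 z" if "z \<in> D" for z
  proof -
    have "(cmod (v0 z))\<^sup>2 * W\<phi> z = W3 z"
    proof -
      have "(cmod (v0 z))\<^sup>2 = (cmod (z - w))\<^sup>2 * (L z)\<^sup>2"
        unfolding v0_def norm_mult complex_mod_cnj norm_of_real power_mult_distrib power2_abs ..
      moreover have "(L z)\<^sup>2 * W\<phi> z = E z * ((\<omega> (x z))\<^sup>2 / q (x z) * e z)"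
        unfolding L_def k0_def W\<phi>_def using qx[OF that] E0[of z] by (simp add: power2_eq_square)
      moreover have "x z - a = (cmod (z - w))\<^sup>2 * E z" by (simp add: x_def)
      ultimately show ?thesis by (simp add: W3_def mult.assoc)
    qed
    then show ?thesis by (simp add: v_def hnorm_sq_scale mult_ac)
  qed
  have v_fin: "wnorm D h W\<phi> v < \<infinity>"
  proof -
    have "wnorm D h W\<phi> v = wnorm D h W3 F"
      unfolding wnorm_def by (rule nn_integral_cong) (simp add: vW)
    then show ?thesis using fin3 by simp
  qed
  have k_fin: "wnorm D h W\<phi> k < \<infinity>"
  proof -
    have cmv: "continuous_on D (\<lambda>z. (- 1) *s v z)" by (intro continuous_intros cv)
    have "wnorm D h W\<phi> (\<lambda>z. (- 1) *s v z) < \<infinity>"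
      using v_fin unfolding wnorm_def hnorm_sq_scale by simp
    from integral_hnorm_sq_add(1)[OF D(1) h cW\<phi> W\<phi>' continuous_on_add[OF cv contk] vk_fin cmv this]
    have "wnorm D h W\<phi> (\<lambda>z. v z + k z + (- 1) *s v z) < \<infinity>" .
    moreover have "(\<lambda>z. v z + k z + (- 1) *s v z) = k" by (simp add: fun_eq_iff vec_eq_iff)
    ultimately show ?thesis by (simp only:)
  qed

  \<comment> \<open>Orthogonality of \<open>v\<close> to the correction \<open>k\<close>\<close>
  define kw where "kw z = (z - w) *s k z" for z
  have kw: "hol_section D kw" "kw w = 0"
    unfolding kw_def by (intro hol_section_scale k holomorphic_intros) (simp add: vec_eq_iff)
  have contkw: "continuous_on D kw" by (rule hol_section_continuous[OF kw(1)])
  have kw_fin: "wnorm D h W1 kw < \<infinity>"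
  proof (rule wnorm_finite_mono[OF D(1) h cW\<phi> W\<phi>' cW1 less_imp_le[OF W1] contk contkw _ k_fin])
    fix z assume z: "z \<in> D"
    have "(cmod (z - w))\<^sup>2 * W1 z * 1 \<le> R\<^sup>2 * C\<omega> * (C\<phi> * W\<phi> z)"
      using R(2)[OF z] bnd1[OF z] bnd\<phi>[OF z] W1[OF z] C\<omega>(1) R(1)
      by (intro mult_mono power_mono) auto
    from mult_left_mono[OF this nF[OF z, of "k z"]]
    show "hnorm_sq (h z) (kw z) * W1 z \<le> (R\<^sup>2 * C\<omega> * C\<phi>) * (hnorm_sq (h z) (k z) * W\<phi> z)"
      unfolding kw_def hnorm_sq_scale by (simp only: mult_ac)
  qed auto
  have "(\<integral>z. Re (hprod (h z) (F z) (kw z)) * W1 z \<partial>lebesgue_on D) = 0"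
    by (rule minimizer_orthogonal[OF D(1) h cW1 less_imp_le[OF W1] F F1 min kw kw_fin])
  moreover have "(\<integral>z. Re (hprod (h z) (F z) (kw z)) * W1 z \<partial>lebesgue_on D)
    = (\<integral>z. Re (hprod (h z) (v z) (k z)) * W\<phi> z \<partial>lebesgue_on D)"
  proof (rule Bochner_Integration.integral_cong[OF refl])
    fix z assume "z \<in> space (lebesgue_on D)"
    then have z: "z \<in> D" by simp
    \<comment> \<open>This identity turns minimality of F into minimality of v: the factor conj (z -
      w) of v is exactly what the factor z - w of \<open>kw\<close> contributes in the antilinear
      slot.\<close>
    have LW: "L z * W\<phi> z = W1 z"
      using qx[OF z] E0[of z] by (simp add: L_def k0_def W\<phi>_def W1_def)
    have "Re (hprod (h z) (v z) (k z)) = L z * Re (cnj (z - w) * hprod (h z) (F z) (k z))"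
      unfolding v_def v0_def hprod_scale by (simp add: algebra_simps)
    then show "Re (hprod (h z) (F z) (kw z)) * W1 z = Re (hprod (h z) (v z) (k z)) * W\<phi> z"
      unfolding kw_def hprod_scale LW[symmetric] by simp
  qed
  ultimately have orth: "(\<integral>z. Re (hprod (h z) (v z) (k z)) * W\<phi> z \<partial>lebesgue_on D) = 0" by simp
  have vnn: "0 \<le> (\<integral>z. hnorm_sq (h z) (b z) * V z \<partial>lebesgue_on D)" if "\<And>z. z \<in> D \<Longrightarrow> 0 \<le> V z" for b V
    by (intro integral_nonneg_AE AE_I2) (auto intro!: mult_nonneg_nonneg nF that)
  have "(\<integral>z. hnorm_sq (h z) (F z) * W3 z \<partial>lebesgue_on D) = (\<integral>z. hnorm_sq (h z) (v z) * W\<phi> z \<partial>lebesgue_on D)"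
    by (rule Bochner_Integration.integral_cong[OF refl]) (simp add: vW)
  \<comment> \<open>Pythagoras: the mixed term vanishes by \<open>orth\<close>.\<close>
  also have "\<dots> \<le> (\<integral>z. hnorm_sq (h z) (v z + k z) * W\<phi> z \<partial>lebesgue_on D)"
  proof -
    have "(\<integral>z. hnorm_sq (h z) (v z + k z) * W\<phi> z \<partial>lebesgue_on D) = (\<integral>z. hnorm_sq (h z) (v z) * W\<phi> z \<partial>lebesgue_on D)
      + (\<integral>z. hnorm_sq (h z) (k z) * W\<phi> z \<partial>lebesgue_on D) + 2 * (\<integral>z. Re (hprod (h z) (v z) (k z)) * W\<phi> z \<partial>lebesgue_on D)"
      by (rule integral_hnorm_sq_add(2)[OF D(1) h cW\<phi> W\<phi>' cv v_fin contk k_fin])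
    then show ?thesis using orth vnn[of W\<phi> k] W\<phi>' by simp
  qed
  also have "\<dots> \<le> (\<integral>z. hnorm_sq (h z) (F z) * W2 z \<partial>lebesgue_on D)"
  proof -
    have "ennreal (\<integral>z. hnorm_sq (h z) (v z + k z) * W\<phi> z \<partial>lebesgue_on D) \<le> ennreal (\<integral>z. hnorm_sq (h z) (F z) * W2 z \<partial>lebesgue_on D)"
      using vk wnorm_integrable(2)[OF D(1) h cW\<phi> W\<phi>' continuous_on_add[OF cv contk] vk_fin]
        wnorm_integrable(2)[OF D(1) h cW2 W2 contF fin2] by simp
    then show ?thesis by (subst (asm) ennreal_le_iff) (use vnn[of W2 F] W2 in auto)
  qed
  finally have le: "(\<integral>z. hnorm_sq (h z) (F z) * W3 z \<partial>lebesgue_on D) \<le> (\<integral>z. hnorm_sq (h z) (F z) * W2 z \<partial>lebesgue_on D)" .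
  have "(\<integral>z. hnorm_sq (h z) (F z) * ((1 - a / (x z)\<^sup>2) * e z) \<partial>lebesgue_on D)
    = (\<integral>z. hnorm_sq (h z) (F z) * W3 z - hnorm_sq (h z) (F z) * W2 z \<partial>lebesgue_on D)"
    by (rule Bochner_Integration.integral_cong[OF refl]) (simp add: W32[symmetric] right_diff_distrib)
  also have "\<dots> = (\<integral>z. hnorm_sq (h z) (F z) * W3 z \<partial>lebesgue_on D) - (\<integral>z. hnorm_sq (h z) (F z) * W2 z \<partial>lebesgue_on D)"
    using wnorm_integrable(1)[OF D(1) h cW3 W3 contF] fin3 wnorm_integrable(1)[OF D(1) h cW2 W2 contF] fin2
    by simp
  finally have "(\<integral>z. hnorm_sq (h z) (F z) * ((1 - a / (x z)\<^sup>2) * e z) \<partial>lebesgue_on D) \<le> 0" using le by simp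
  then show ?thesis using that[OF F fin0] by (simp add: x_def E_def e_def)
qed

lemma flat_0_pos: "x > 0 \<Longrightarrow> flat 0 x > 0"
  by (simp add: flat_def flat_poly_def)

lemma flat_0_nonneg: "flat 0 x \<ge> 0"
  using flat_0_pos[of x] flat_eq_0[of x 0] by fastforce

text \<open>A competitor of finite norm. For v = s / (z - w), smoothed near \<open>w\<close>, the
  datum \<beta> has compact support, and optimality with the weight |z - w|^2 makes v + k square
  integrable. Then F = s + (z - w) k has the value s at w, and it is the sum of s - (z - w) v, which
  has compact support, and (z - w) (v + k), which is square integrable because \<open>D\<close> is
  bounded.\<close>

lemma finite_norm_section:
  fixes h :: "complex \<Rightarrow> complex^'r^'r"
  assumes D: "open D" "bounded D" and h: "continuous_hermitian_metric D h" and opt: "L2_optimal D h"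
    and w: "w \<in> D"
  obtains F where "hol_section D F" "F w = s" "wnorm D h (\<lambda>_. 1) F < \<infinity>"
proof -
  have conth: "continuous_on D h" and pd: "\<And>z. z \<in> D \<Longrightarrow> pos_def_hermitian (h z)"
    using h by (auto simp: continuous_hermitian_metric_def)
  obtain r where r: "r > 0" "cball w r \<subseteq> D" using D(1) w open_contains_cball by blast
  obtain R where R: "R > 0" "\<And>z. z \<in> D \<Longrightarrow> cmod (z - w) \<le> R"
  proof -
    have "bounded ((\<lambda>z. z - w) ` D)" using D(2) by (rule bounded_translation_minus)
    then show ?thesis using that unfolding bounded_pos by auto
  qed
  define u where "u z = (cmod (z - w))\<^sup>2" for z
  \<comment> \<open>Positive on [0, \<infinity>) and equal to t for t \<ge> r^2; so conj (z - w) /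
    den (|z - w|^2) has no singularity and equals 1 / (z - w) off the disc of radius r.\<close>
  define den where "den t = t + flat 0 (r\<^sup>2 - t)" for t
  define f where "f t = 1 / den t" for t
  define f' where "f' t = - (1 - flat 1 (r\<^sup>2 - t)) / (den t)\<^sup>2" for t
  have den: "den t > 0" if "t \<ge> 0" for t
    using that flat_0_pos[of "r\<^sup>2 - t"] flat_0_nonneg[of "r\<^sup>2 - t"] r(1)
    by (cases "t = 0") (auto simp: den_def add_pos_nonneg)
  have u0: "u z \<ge> 0" for z by (simp add: u_def)
  have df: "(f has_real_derivative f' t) (at t)" if "t \<ge> 0" for t
  proof -
    have "((\<lambda>t. flat 0 (r\<^sup>2 - t)) has_real_derivative flat (Suc 0) (r\<^sup>2 - t) * (0 - 1)) (at t)"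
      by (rule DERIV_chain2[OF DERIV_flat]) (auto intro!: derivative_eq_intros)
    then have "(den has_real_derivative 1 + flat (Suc 0) (r\<^sup>2 - t) * (0 - 1)) (at t)"
      unfolding den_def by (intro DERIV_add DERIV_ident)
    from DERIV_divide[OF DERIV_const[of 1] this] den[OF that]
    show ?thesis unfolding f_def f'_def by (simp add: power2_eq_square)
  qed
  have cu: "continuous_on S u" for S unfolding u_def by (intro continuous_intros)
  have cden: "continuous_on S (\<lambda>z. den (u z))" for S unfolding den_def by (intro continuous_intros cu)
  have denne: "den (u z) \<noteq> 0" for z using den[OF u0[of z]] by simp
  have cf: "continuous_on S (\<lambda>z. f (u z))" for S unfolding f_def using denne by (intro continuous_intros cden) auto
  have cf': "continuous_on S (\<lambda>z. f' (u z))" for S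
    unfolding f'_def using denne by (intro continuous_intros cden cu) auto
  define L where "L z = f (u z)" for z
  define Lg where "Lg z = of_real (f' (u z)) * cnj (z - w)" for z
  have dL: "(L has_derivative (\<lambda>v. 2 * Re (Lg z * v))) (at z)" for z
    unfolding L_def Lg_def u_def
    by (rule has_derivative_real_compose[OF df has_derivative_cmod_sq]) simp
  define v0 where "v0 z = cnj (z - w) * complex_of_real (L z)" for z
  define A0 where "A0 z = cnj (z - w) * Lg z" for z
  define B0 where "B0 z = of_real (L z) + cnj (z - w) * cnj (Lg z)" for z
  have dv0: "(v0 has_derivative (\<lambda>v. A0 z * v + B0 z * cnj v)) (at z)" for z
    using has_derivative_cnj_scale[OF dL, of w z] unfolding v0_def A0_def B0_def .
  have out: "B0 z = 0" "1 - u z * L z = 0" if "z \<notin> cball w r" for z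
  proof -
    have "r\<^sup>2 \<le> u z" unfolding u_def using that r(1)
      by (intro power_mono) (auto simp: dist_norm norm_minus_commute)
    then have fl: "flat n (r\<^sup>2 - u z) = 0" for n by (intro flat_eq_0) auto
    have "u z > 0" using \<open>r\<^sup>2 \<le> u z\<close> r(1) by (meson less_le_trans zero_less_power)
    have "cnj (z - w) * cnj (Lg z) = of_real (u z * f' (u z))"
    proof -
      have "cnj (z - w) * cnj (Lg z) = (cnj (z - w) * (z - w)) * of_real (f' (u z))" by (simp add: Lg_def)
      then show ?thesis unfolding cnj_times_self u_def by simp
    qed
    then have "B0 z = of_real (f (u z) + u z * f' (u z))" by (simp add: B0_def L_def)
    also have "f (u z) + u z * f' (u z) = 0"
    proof -
      have "den (u z) = u z" by (simp add: den_def fl)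
      then show ?thesis unfolding f_def f'_def fl using \<open>u z > 0\<close> by (simp add: power2_eq_square)
    qed
    finally show "B0 z = 0" by simp
    show "1 - u z * L z = 0" using \<open>u z > 0\<close> by (simp add: L_def f_def den_def fl)
  qed
  have cL: "continuous_on S L" for S unfolding L_def by (rule cf)
  have cLg: "continuous_on S Lg" for S unfolding Lg_def by (intro continuous_intros cf')
  have cv0: "continuous_on S v0" and cA0: "continuous_on S A0" and cB0: "continuous_on S B0" for S
    unfolding v0_def A0_def B0_def by (intro continuous_intros cL cLg)+

  define v where "v z = v0 z *s s" for z
  define A where "A z = A0 z *s s" for z
  define \<beta> where "\<beta> z = B0 z *s s" for z
  define \<phi> where "\<phi> z = (cmod (z - w))\<^sup>2" for z
  define W where "W z = exp (- \<phi> z)" for z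
  have cv: "continuous_on D v" and cA: "continuous_on D A" and c\<beta>: "continuous_on D \<beta>"
    unfolding v_def A_def \<beta>_def by (intro continuous_intros cv0 cA0 cB0)+
  have cW: "continuous_on D W" unfolding W_def \<phi>_def by (intro continuous_intros)
  have W0: "0 \<le> W z" for z by (simp add: W_def)
  have dv: "((\<lambda>z. v z $ i) has_derivative (\<lambda>x. A z $ i * x + \<beta> z $ i * cnj x)) (at z)" for z i
  proof -
    have "((\<lambda>z. v0 z * s $ i) has_derivative (\<lambda>x. (A0 z * x + B0 z * cnj x) * s $ i)) (at z)"
      by (rule has_derivative_mult_left[OF dv0])
    then show ?thesis by (simp add: v_def A_def \<beta>_def algebra_simps)
  qed
  have smooth: "smooth_on D \<phi>" unfolding smooth_on_def \<phi>_def by (intro allI Ck_on_cmod_sq D(1))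
  have levi: "levi \<phi> z = 1" if "z \<in> D" for z
  proof -
    have "((\<lambda>z. cnj (z - w)) has_derivative (\<lambda>v. 0 * v + 1 * cnj v)) (at z)"
      by (auto intro!: derivative_eq_intros)
    from levi_eqI[OF D(1) that _ this, of \<phi>] show ?thesis
      unfolding \<phi>_def using has_derivative_cmod_sq by simp
  qed
  have fin: "(\<integral>\<^sup>+z. ennreal (hnorm_sq (h z) (\<beta> z) / 1 * exp (- \<phi> z)) \<partial>lebesgue_on D) < \<infinity>"
  proof -
    have "continuous_on D (\<lambda>z. hnorm_sq (h z) (\<beta> z) * W z)" by (intro continuous_intros conth c\<beta> cW)
    moreover have "hnorm_sq (h z) (\<beta> z) * W z = 0" if "z \<notin> cball w r" for z
      using out(1)[OF that] by (simp add: \<beta>_def hnorm_sq_scale)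
    ultimately have "integrable (lebesgue_on D) (\<lambda>z. hnorm_sq (h z) (\<beta> z) * W z)"
      by (intro compact_support_lebesgue_on(2)[OF D(1) compact_cball r(2)]) auto
    then have "wnorm D h W \<beta> < \<infinity>" using wnorm_integrable(1)[OF D(1) h cW W0 c\<beta>] by simp
    then show ?thesis by (simp add: wnorm_def W_def)
  qed
  obtain k where k: "hol_section D k" "wnorm D h W (\<lambda>z. v z + k z) < \<infinity>"
  proof (rule L2_optimal_estimate[OF D(1) h opt smooth continuous_on_const[of D 1] levi _ dv cA c\<beta> fin])
    fix k :: "complex \<Rightarrow> complex^'r"
    assume "\<And>i. (\<lambda>z. k z $ i) holomorphic_on D"
      "(\<integral>\<^sup>+z. ennreal (hnorm_sq (h z) (v z + k z) * exp (- \<phi> z)) \<partial>lebesgue_on D)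
        \<le> (\<integral>\<^sup>+z. ennreal (hnorm_sq (h z) (\<beta> z) / 1 * exp (- \<phi> z)) \<partial>lebesgue_on D)"
    then show thesis using fin that[of k] by (auto simp: hol_section_def wnorm_def W_def intro: le_less_trans)
  qed auto
  have ck: "continuous_on D k" by (rule hol_section_continuous[OF k(1)])
  define F where "F z = s + (z - w) *s k z" for z
  have "hol_section D (\<lambda>_. s)" by (simp add: hol_section_def)
  then have F: "hol_section D F" unfolding F_def
    by (intro hol_section_add hol_section_scale k holomorphic_intros)
  have Fw: "F w = s" by (simp add: F_def vec_eq_iff)
  have one: "continuous_on D (\<lambda>_. 1 :: real)" "\<And>z. z \<in> D \<Longrightarrow> 0 \<le> (1 :: real)" by auto
  define F1 where "F1 z = complex_of_real (1 - u z * L z) *s s" for z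
  define F2 where "F2 z = (z - w) *s (v z + k z)" for z
  have FF: "F z = F1 z + F2 z" for z
  proof -
    have "(z - w) * v0 z = of_real (u z * L z)"
    proof -
      have "(z - w) * v0 z = (cnj (z - w) * (z - w)) * of_real (L z)" by (simp add: v0_def)
      then show ?thesis unfolding cnj_times_self u_def by simp
    qed
    then show ?thesis unfolding F_def F1_def F2_def v_def
      by (simp add: vec_eq_iff algebra_simps)
  qed
  have cF1: "continuous_on D F1" unfolding F1_def by (intro continuous_intros cu cL)
  have cvk: "continuous_on D (\<lambda>z. v z + k z)" by (intro continuous_intros cv ck)
  have cF2: "continuous_on D F2" unfolding F2_def by (intro continuous_intros cv ck)
  have "integrable (lebesgue_on D) (\<lambda>z. hnorm_sq (h z) (F1 z) * 1)"
  proof (rule compact_support_lebesgue_on(2)[OF D(1) compact_cball r(2)])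
    show "continuous_on D (\<lambda>z. hnorm_sq (h z) (F1 z) * 1)" by (intro continuous_intros conth cF1)
    show "hnorm_sq (h z) (F1 z) * 1 = 0" if "z \<notin> cball w r" for z
      unfolding F1_def out(2)[OF that] by (simp add: hnorm_sq_scale)
  qed
  then have fin1: "wnorm D h (\<lambda>_. 1) F1 < \<infinity>" using wnorm_integrable(1)[OF D(1) h one cF1] by simp
  have fin2: "wnorm D h (\<lambda>_. 1) F2 < \<infinity>"
  proof (rule wnorm_finite_mono[OF D(1) h cW W0 one cvk cF2 _ k(2)])
    fix z assume z: "z \<in> D"
    have "(cmod (z - w))\<^sup>2 * 1 \<le> R\<^sup>2 * (exp (R\<^sup>2) * W z)"
    proof (rule mult_mono)
      show le: "(cmod (z - w))\<^sup>2 \<le> R\<^sup>2" using R(2)[OF z] by (intro power_mono) auto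
      have "1 \<le> exp (R\<^sup>2 - (cmod (z - w))\<^sup>2)" using le by simp
      then show "1 \<le> exp (R\<^sup>2) * W z" by (simp add: W_def \<phi>_def exp_diff exp_minus divide_inverse)
    qed auto
    from mult_left_mono[OF this hnorm_sq_nonneg[OF pd[OF z], of "v z + k z"]]
    show "hnorm_sq (h z) (F2 z) * 1 \<le> (R\<^sup>2 * exp (R\<^sup>2)) * (hnorm_sq (h z) (v z + k z) * W z)"
      unfolding F2_def hnorm_sq_scale by (simp only: mult_ac mult_1_right)
  qed auto
  have "wnorm D h (\<lambda>_. 1) F < \<infinity>"
    using integral_hnorm_sq_add(1)[OF D(1) h one cF1 fin1 cF2 fin2] unfolding FF[abs_def] by simp
  then show ?thesis using that F Fw by blast
qed

section \<open>The mass of the concentrating kernel\<close>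

text \<open>Layer cake in place of polar coordinates: the kernel is the integral of \<open>f\<close>
  over [|y - w|^2, \<infinity>), and Fubini leaves f u times the area pi u of a disc. The mass does
  not depend on a, so it survives the limit a \<rightarrow> 0.\<close>

lemma nn_integral_concentrating_kernel:
  fixes w :: complex
  assumes a: "a > 0" and c: "c > 0"
  shows "(\<integral>\<^sup>+y. ennreal (a / (c * (cmod (y - w))\<^sup>2 + a)\<^sup>2) \<partial>lborel) = ennreal (pi / c)"
proof -
  \<comment> \<open>The derivative of - a / (c u + a)^2.\<close>
  define f where "f u = 2 * a * c / (c * u + a) ^ 3" for u :: real
  have [measurable]: "f \<in> borel_measurable borel" unfolding f_def by measurable
  have pos: "c * u + a > 0" if "u \<ge> 0" for u using that a c by (simp add: add_nonneg_pos)
  have tail: "(\<integral>\<^sup>+u. ennreal (f u) * indicator {b..} u \<partial>lborel) = ennreal (a / (c * b + a)\<^sup>2)" if b: "b \<ge> 0" for b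
  proof -
    have "(\<integral>\<^sup>+u. ennreal (f u) * indicator {b..} u \<partial>lborel) = ennreal (0 - (- a / (c * b + a)\<^sup>2))"
    proof (rule nn_integral_FTC_atLeast)
      fix u assume u: "b \<le> u"
      have p: "c * u + a > 0" using u b by (intro pos) auto
      show "((\<lambda>u. - a / (c * u + a)\<^sup>2) has_real_derivative f u) (at u)"
        using p by (auto intro!: derivative_eq_intros simp: f_def divide_simps power2_eq_square power3_eq_cube)
      show "0 \<le> f u" using p a c by (simp add: f_def)
    next
      show "((\<lambda>u. - a / (c * u + a)\<^sup>2) \<longlongrightarrow> 0) at_top"
        using c by real_asymp
    qed simp
    then show ?thesis by simp
  qed
  have "(\<integral>\<^sup>+y. ennreal (a / (c * (cmod (y - w))\<^sup>2 + a)\<^sup>2) \<partial>lborel)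
    = (\<integral>\<^sup>+y. (\<integral>\<^sup>+u. ennreal (f u) * indicator {(cmod (y - w))\<^sup>2..} u \<partial>lborel) \<partial>lborel)"
    by (rule nn_integral_cong) (simp add: tail)
  also have "\<dots> = (\<integral>\<^sup>+u. (\<integral>\<^sup>+y. ennreal (f u) * indicator {(cmod (y - w))\<^sup>2..} u \<partial>lborel) \<partial>lborel)"
  proof (rule lborel_pair.Fubini'[symmetric])
    have "(\<lambda>(y, u). ennreal (f u) * indicator {p. (cmod (fst p - w))\<^sup>2 \<le> snd p} (y, u))
        \<in> borel_measurable (lborel \<Otimes>\<^sub>M lborel)"
      by measurable
    moreover have "(\<lambda>(y, u). ennreal (f u) * indicator {p. (cmod (fst p - w))\<^sup>2 \<le> snd p} (y, u))
       = (\<lambda>(y, u). ennreal (f u) * indicator {(cmod (y - w))\<^sup>2..} u)"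
      by (auto simp: indicator_def fun_eq_iff)
    ultimately show "(\<lambda>(y, u). ennreal (f u) * indicator {(cmod (y - w))\<^sup>2..} u) \<in> borel_measurable (lborel \<Otimes>\<^sub>M lborel)"
      by simp
  qed
  also have "\<dots> = (\<integral>\<^sup>+u. ennreal (pi * u * f u) * indicator {0..} u \<partial>lborel)"
  proof (rule nn_integral_cong)
    fix u :: real
    show "(\<integral>\<^sup>+y. ennreal (f u) * indicator {(cmod (y - w))\<^sup>2..} u \<partial>lborel) = ennreal (pi * u * f u) * indicator {0..} u"
    proof (cases "u \<ge> 0")
      case True
      have "(cmod (y - w))\<^sup>2 \<le> u \<longleftrightarrow> y \<in> cball w (sqrt u)" for y
        by (metis True dist_norm dist_commute mem_cball norm_ge_zero real_le_rsqrt real_sqrt_le_iff real_sqrt_pow2 real_sqrt_abs abs_norm_cancel power_mono)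
      then have "(\<integral>\<^sup>+y. ennreal (f u) * indicator {(cmod (y - w))\<^sup>2..} u \<partial>lborel)
        = (\<integral>\<^sup>+y. ennreal (f u) * indicator (cball w (sqrt u)) y \<partial>lborel)"
        by (intro nn_integral_cong) (auto simp: indicator_def)
      also have "\<dots> = ennreal (f u) * emeasure lborel (cball w (sqrt u))"
        by (simp add: nn_integral_cmult_indicator)
      also have "emeasure lborel (cball w (sqrt u)) = ennreal (pi * u)"
        using True by (subst emeasure_cball) (auto simp: unit_ball_vol_2 DIM_complex)
      also have "ennreal (f u) * ennreal (pi * u) = ennreal (pi * u * f u)"
        using True pos[OF True] a c by (subst ennreal_mult[symmetric]) (auto simp: f_def mult_ac)
      finally show ?thesis using True by simp
    next
      case False
      then have "\<not> (cmod (y - w))\<^sup>2 \<le> u" for y by (meson dual_order.trans zero_le_power2)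
      then show ?thesis using False by simp
    qed
  qed
  also have "\<dots> = ennreal (pi / c - pi * c * 0\<^sup>2 / (c * 0 + a)\<^sup>2)"
  proof (rule nn_integral_FTC_atLeast)
    fix u :: real assume u: "0 \<le> u"
    have p: "c * u + a > 0" using pos u by auto
    \<comment> \<open>A primitive of pi u f u that vanishes at 0 and tends to pi / c at
      infinity.\<close>
    have "((\<lambda>u. pi * c * u\<^sup>2 / (c * u + a)\<^sup>2) has_real_derivative
      (pi * c * (2 * u) * (c * u + a)\<^sup>2 - pi * c * u\<^sup>2 * (2 * (c * u + a) * c)) / ((c * u + a)\<^sup>2 * (c * u + a)\<^sup>2)) (at u)"
      using p by (auto intro!: derivative_eq_intros simp: power2_eq_square)
    also have "(pi * c * (2 * u) * (c * u + a)\<^sup>2 - pi * c * u\<^sup>2 * (2 * (c * u + a) * c)) / ((c * u + a)\<^sup>2 * (c * u + a)\<^sup>2)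
      = (c * u + a) * (pi * u * (2 * a * c)) / ((c * u + a) * (c * u + a) ^ 3)"
      by (intro arg_cong2[of _ _ _ _ "(/)"]) (simp_all add: power2_eq_square power3_eq_cube algebra_simps)
    also have "\<dots> = pi * u * f u" using p by (simp add: f_def)
    finally show "((\<lambda>u. pi * c * u\<^sup>2 / (c * u + a)\<^sup>2) has_real_derivative pi * u * f u) (at u)" .
    show "0 \<le> pi * u * f u" using p u a c by (simp add: f_def)
  next
    have "((\<lambda>u. pi * c * u\<^sup>2 / (c * u + a)\<^sup>2) \<longlongrightarrow> pi * c * inverse (c\<^sup>2)) at_top"
      using c by real_asymp
    moreover have "pi * c * inverse (c\<^sup>2) = pi / c"
      using c by (simp add: power2_eq_square field_simps)
    ultimately show "((\<lambda>u. pi * c * u\<^sup>2 / (c * u + a)\<^sup>2) \<longlongrightarrow> pi / c) at_top"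
      by (simp only:)
  qed measurable
  finally show ?thesis by simp
qed

section \<open>Concentration at the pole\<close>

text \<open>The section from \<open>weighted_estimate\<close> changes with a, so its variation near
  \<open>w\<close> has to be bounded by its norm alone. The norm bounds F on the disc of radius r,
  Cauchy's inequality on discs of radius r / 2 bounds the derivatives (whence 4 / r^2), and
  \<open>CARD('r)\<close> comes from the sum over components.\<close>

lemma hol_section_lipschitz:
  fixes h :: "complex \<Rightarrow> complex^'r^'r"
  assumes "open D" and h: "continuous_hermitian_metric D h" and r: "r > 0" "cball w r \<subseteq> D"
  obtains C where "C > 0" "\<And>F N z. hol_section D F \<Longrightarrow> wnorm D h (\<lambda>_. 1) F = ennreal N \<Longrightarrow> 0 \<le> N \<Longrightarrow>
    z \<in> cball w (r / 2) \<Longrightarrow> (norm (F z - F w))\<^sup>2 \<le> C * N * (cmod (z - w))\<^sup>2"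
proof -
  obtain C where C: "C > 0" "\<And>F z. hol_section D F \<Longrightarrow> z \<in> cball w r \<Longrightarrow>
    ennreal ((norm (F z))\<^sup>2) \<le> ennreal C * wnorm D h (\<lambda>_. 1) F"
    using hol_section_bound[OF assms(1) h _ _ compact_cball r(2), of "\<lambda>_. 1"] by auto
  define C' where "C' = real CARD('r) * (4 / r\<^sup>2 * C)"
  show ?thesis
  proof (rule that)
    show "C' > 0" using C(1) r(1) by (simp add: C'_def)
    fix F :: "complex \<Rightarrow> complex^'r" and N z
    assume F: "hol_section D F" and N: "wnorm D h (\<lambda>_. 1) F = ennreal N" "0 \<le> N" and z: "z \<in> cball w (r / 2)"
    have bd: "norm (F y) \<le> sqrt (C * N)" if "y \<in> cball w r" for y
    proof (rule real_le_rsqrt)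
      have "ennreal ((norm (F y))\<^sup>2) \<le> ennreal (C * N)"
        using C(2)[OF F that] N C(1) by (simp add: ennreal_mult)
      then show "(norm (F y))\<^sup>2 \<le> C * N" using C(1) N(2) by (simp add: ennreal_le_iff)
    qed
    have comp: "cmod (F z $ i - F w $ i) \<le> 2 / r * sqrt (C * N) * cmod (z - w)" for i
    proof -
      have hol: "(\<lambda>y. F y $ i) holomorphic_on D" using F by (simp add: hol_section_def)
      have der: "cmod (deriv (\<lambda>y. F y $ i) y) \<le> 2 / r * sqrt (C * N)" if y: "y \<in> cball w (r / 2)" for y
      proof -
        have sub: "cball y (r / 2) \<subseteq> cball w r"
        proof
          fix x assume "x \<in> cball y (r / 2)"
          then show "x \<in> cball w r" using y dist_triangle[of w x y] by simp
        qed
        have "cmod ((deriv ^^ 1) (\<lambda>y. F y $ i) y) \<le> fact 1 * sqrt (C * N) / (r / 2) ^ 1"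
        proof (rule Cauchy_inequality)
          show "(\<lambda>y. F y $ i) holomorphic_on ball y (r / 2)"
            by (rule holomorphic_on_subset[OF hol]) (use sub r(2) ball_subset_cball in blast)
          show "continuous_on (cball y (r / 2)) (\<lambda>y. F y $ i)"
            by (rule continuous_on_subset[OF holomorphic_on_imp_continuous_on[OF hol]]) (use sub r(2) in blast)
          fix x assume "cmod (y - x) = r / 2"
          then have "x \<in> cball w r" using sub by (auto simp: dist_norm)
          then show "cmod (F x $ i) \<le> sqrt (C * N)"
            using bd[of x] Finite_Cartesian_Product.norm_nth_le[of "F x" i] by linarith
        qed (use r in auto)
        then show ?thesis by (simp add: field_simps)
      qed
      have "cmod ((\<lambda>y. F y $ i) z - (\<lambda>y. F y $ i) w) \<le> 2 / r * sqrt (C * N) * cmod (z - w)"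
      proof (rule field_differentiable_bound[OF convex_cball[of w "r / 2"] _ der])
        fix y assume y: "y \<in> cball w (r / 2)"
        have "cball w (r / 2) \<subseteq> D" using r by (intro order_trans[OF _ r(2)]) auto
        then have "((\<lambda>y. F y $ i) has_field_derivative deriv (\<lambda>y. F y $ i) y) (at y)"
          using y by (intro holomorphic_derivI[OF hol assms(1)]) auto
        then show "((\<lambda>y. F y $ i) has_field_derivative deriv (\<lambda>y. F y $ i) y) (at y within cball w (r / 2))"
          by (rule has_field_derivative_at_within)
      qed (use z r in auto)
      then show ?thesis by simp
    qed
    have "(norm (F z - F w))\<^sup>2 = (\<Sum>i\<in>UNIV. (cmod (F z $ i - F w $ i))\<^sup>2)"
      by (simp add: norm_vec_def L2_set_def sum_nonneg)
    also have "\<dots> \<le> (\<Sum>i\<in>(UNIV :: 'r set). (2 / r * sqrt (C * N) * cmod (z - w))\<^sup>2)"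
      by (intro sum_mono power_mono comp) auto
    also have "(2 / r * sqrt (C * N) * cmod (z - w))\<^sup>2 = 4 / r\<^sup>2 * C * N * (cmod (z - w))\<^sup>2"
      using C(1) N(2) by (simp add: power_mult_distrib power_divide)
    finally show "(norm (F z - F w))\<^sup>2 \<le> C' * N * (cmod (z - w))\<^sup>2"
      by (simp add: C'_def mult_ac)
  qed
qed

text \<open>The limit a \<rightarrow> 0 with relative errors controlled by t. The factor (1 + t)^2
  pays for the variation of h and for the splitting F = s + (F - F w); (1 - t)^2 for replacing exp
  (2 H') by a constant near w; 1 - 2 t absorbs two terms t N, one from F - F w and one from exp (- a
  |z - w|^2) together with the region away from w. The radius r is fixed before a.\<close>

lemma almost_optimal_extension:
  fixes h :: "complex \<Rightarrow> complex^'r^'r"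
  assumes D: "open D" "bounded D" and h: "continuous_hermitian_metric D h" and opt: "L2_optimal D h"
    and w: "w \<in> D" and p: "p holomorphic_on D"
    and H: "\<And>z. z \<in> D \<Longrightarrow> (H has_derivative (\<lambda>v. Re (p z * v))) (at z)"
    and BH: "\<And>z. z \<in> D \<Longrightarrow> \<bar>H z\<bar> \<le> BH"
    and neg: "\<And>z. z \<in> D - {w} \<Longrightarrow> H z + ln (cmod (z - w)) \<le> 0"
    and t: "0 < t" "t < 1 / 4"
  obtains F where "hol_section D F" "F w = s"
    "wnorm D h (\<lambda>_. 1) F \<le> ennreal (pi * hnorm_sq (h w) s / exp (2 * H w) * (1 + t)\<^sup>2 / ((1 - t)\<^sup>2 * (1 - 2 * t)))"
proof -
  have conth: "continuous_on D h" and pd: "\<And>z. z \<in> D \<Longrightarrow> pos_def_hermitian (h z)"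
    using h by (auto simp: continuous_hermitian_metric_def)
  have nn: "0 \<le> hnorm_sq (h z) b" if "z \<in> D" for z b by (rule hnorm_sq_nonneg[OF pd[OF that]])
  obtain R where R: "R > 0" "\<And>z. z \<in> D \<Longrightarrow> cmod (z - w) \<le> R"
  proof -
    have "bounded ((\<lambda>z. z - w) ` D)" using D(2) by (rule bounded_translation_minus)
    then show ?thesis using that unfolding bounded_pos by auto
  qed
  define S where "S = hnorm_sq (h w) s"
  define c where "c = exp (2 * H w)"
  have S0: "S \<ge> 0" unfolding S_def by (rule nn[OF w])
  have c0: "c > 0" by (simp add: c_def)
  have \<rho>1: "(cmod (z - w))\<^sup>2 * exp (2 * H z) \<le> 1" if "z \<in> D" for z
  proof (cases "z = w")
    case False
    then have "exp (H z + ln (cmod (z - w))) \<le> 1" using neg[of z] that by simp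
    then have "(exp (H z) * cmod (z - w))\<^sup>2 \<le> 1" using False by (simp add: exp_add power_le_one)
    moreover have "(exp (H z) * cmod (z - w))\<^sup>2 = (cmod (z - w))\<^sup>2 * exp (2 * H z)"
      unfolding power_mult_distrib exp_double by (rule mult.commute)
    ultimately show ?thesis by (simp only:)
  qed simp
  obtain r1 where r1: "r1 > 0" "cball w r1 \<subseteq> D"
    "\<And>z b. z \<in> cball w r1 \<Longrightarrow> hnorm_sq (h z) b \<le> (1 + t) * hnorm_sq (h w) b"
    by (rule hnorm_sq_le_near[OF D(1) h w t(1)]) blast
  have "isCont (\<lambda>z. exp (2 * H z)) w"
    by (intro continuous_intros has_derivative_continuous[OF H[OF w]])
  then have "((\<lambda>z. exp (2 * H z)) \<longlongrightarrow> c) (nhds w)"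
    using tendsto_at_iff_tendsto_nhds[of "\<lambda>z. exp (2 * H z)" w] unfolding isCont_def c_def by blast
  moreover have "(1 - t) * c < c" using t c0 by simp
  ultimately have "\<forall>\<^sub>F z in nhds w. (1 - t) * c < exp (2 * H z)" by (rule order_tendstoD)
  then obtain r2 where r2: "r2 > 0" "\<And>z. dist z w < r2 \<Longrightarrow> (1 - t) * c < exp (2 * H z)"
    unfolding eventually_nhds_metric by auto
  obtain \<Lambda> where \<Lambda>: "\<Lambda> > 0" "\<And>b. hnorm_sq (h w) b \<le> \<Lambda> * (norm b)\<^sup>2"
  proof (rule hnorm_sq_bounds_compact[of "{w}" h])
    fix c C :: real
    assume "C > 0" "\<And>z a. z \<in> {w} \<Longrightarrow> hnorm_sq (h z) a \<le> C * (norm a)\<^sup>2"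
    then show thesis using that by blast
  qed (use pd[OF w] in auto)
  obtain C where C: "C > 0" "\<And>F N z. hol_section D F \<Longrightarrow> wnorm D h (\<lambda>_. 1) F = ennreal N \<Longrightarrow> 0 \<le> N \<Longrightarrow>
    z \<in> cball w (r1 / 2) \<Longrightarrow> (norm (F z - F w))\<^sup>2 \<le> C * N * (cmod (z - w))\<^sup>2"
    by (rule hol_section_lipschitz[OF D(1) h r1(1,2)]) blast
  \<comment> \<open>One factor 1 - t for the continuity of exp (2 H) at w, one for b \<ge> 1 -
    t.\<close>
  define c1 where "c1 = (1 - t)\<^sup>2 * c"
  have c1: "c1 > 0" using c0 t by (simp add: c1_def)
  \<comment> \<open>K r^2 N will be the contribution of F - F w to the concentrated integral, that
    is, of the last summand of \<open>P\<close>.\<close>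
  define K where "K = pi / c1 * ((1 + t) * ((1 + 1 / t) * (\<Lambda> * C)))"
  have K: "K > 0" unfolding K_def
    using c1 t \<Lambda>(1) C(1) by (intro mult_pos_pos divide_pos_pos add_pos_pos) auto
  \<comment> \<open>r1 / 2 serves the Lipschitz bound and the comparison of metrics, r2 / 2 the
    continuity of exp (2 H), and sqrt (t / K) gives K r^2 \<le> t.\<close>
  define r where "r = min (min (r1 / 2) (r2 / 2)) (sqrt (t / K))"
  have r: "r > 0" using r1(1) r2(1) t K by (simp add: r_def)
  have "r\<^sup>2 \<le> (sqrt (t / K))\<^sup>2" by (rule power_mono) (use r in \<open>auto simp: r_def\<close>)
  then have "r\<^sup>2 \<le> t / K" using K t by simp
  then have rK: "K * r\<^sup>2 \<le> t" using K by (simp add: pos_le_divide_eq mult.commute)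
  \<comment> \<open>A lower bound for |z - w|^2 exp (2 H) outside the disc of radius r.\<close>
  define \<mu> where "\<mu> = r\<^sup>2 * exp (- 2 * BH)"
  have \<mu>: "\<mu> > 0" using r by (simp add: \<mu>_def)
  \<comment> \<open>The bound t / 2 gives b \<ge> 1 - t. The other makes a R^2 + 4 a / \<mu>^2 at
    most t: the loss from exp (- a |z - w|^2) and from the region where x \<ge> \<mu> / 2.\<close>
  define a where "a = min (t / 2) (t / (R\<^sup>2 + 4 / \<mu>\<^sup>2))"
  have den: "R\<^sup>2 + 4 / \<mu>\<^sup>2 > 0" using R(1) \<mu> by (simp add: add_pos_pos)
  have a: "0 < a" using t den by (simp add: a_def)
  have a_t: "a \<le> t / 2" unfolding a_def by (rule min.cobounded1)
  have a_den: "a * (R\<^sup>2 + 4 / \<mu>\<^sup>2) \<le> t"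
  proof -
    have "a \<le> t / (R\<^sup>2 + 4 / \<mu>\<^sup>2)" unfolding a_def by (rule min.cobounded2)
    then show ?thesis using den by (simp add: pos_le_divide_eq)
  qed
  define b where "b = 1 - 2 * a"
  have b: "1 - t \<le> b" "1 / 2 < b" "0 < b" "b < 1" using a_t a t by (auto simp: b_def)
  \<comment> \<open>Adding this constant multiplies |z - w|^2 exp (2 H), which is at most 1, by b =
    1 - 2 a; this creates the margin x \<le> 1 - a.\<close>
  define H' where "H' z = H z + ln b / 2" for z
  have exp_H': "exp (2 * H' z) = b * exp (2 * H z)" for z
    using b by (simp add: H'_def exp_add distrib_left)
  have dH': "(H' has_derivative (\<lambda>v. Re (p z * v))) (at z)" if "z \<in> D" for z
    unfolding H'_def using has_derivative_add[OF H[OF that] has_derivative_const] by simp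
  have BH': "\<bar>H' z\<bar> \<le> BH + \<bar>ln b / 2\<bar>" if "z \<in> D" for z
    using BH[OF that] unfolding H'_def by linarith
  define x where "x z = (cmod (z - w))\<^sup>2 * exp (2 * H' z) + a" for z
  have sub: "(cmod (z - w))\<^sup>2 * exp (2 * H' z) + a \<le> 1 - a" if "z \<in> D" for z
  proof -
    have "b * ((cmod (z - w))\<^sup>2 * exp (2 * H z)) \<le> b * 1" using \<rho>1[OF that] b by (intro mult_left_mono) auto
    moreover have "b * 1 = 1 - 2 * a" by (simp add: b_def)
    moreover have "(cmod (z - w))\<^sup>2 * exp (2 * H' z) = b * ((cmod (z - w))\<^sup>2 * exp (2 * H z))"
      unfolding exp_H' by (rule mult.left_commute)
    ultimately show ?thesis by linarith
  qed
  have x_eq: "x z = b * ((cmod (z - w))\<^sup>2 * exp (2 * H z)) + a" for z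
    unfolding x_def exp_H' by (subst mult.left_commute) (rule refl)
  have xa: "a \<le> x z" for z by (simp add: x_def)
  obtain F0 where F0: "hol_section D F0" "F0 w = s" "wnorm D h (\<lambda>_. 1) F0 < \<infinity>"
    by (rule finite_norm_section[OF D h opt w, of s]) blast
  \<comment> \<open>The parameter \<epsilon> of \<open>weighted_estimate\<close> is taken equal to
    a.\<close>
  obtain F where F: "hol_section D F" "F w = s" "wnorm D h (\<lambda>_. 1) F < \<infinity>"
    and est: "(\<integral>z. hnorm_sq (h z) (F z) * ((1 - a / (x z)\<^sup>2) * exp (- a * (cmod (z - w))\<^sup>2)) \<partial>lebesgue_on D) \<le> 0"
    by (rule weighted_estimate[OF D h opt w p dH' BH' a sub a F0]) (simp_all add: x_def[symmetric])
  have contF: "continuous_on D F" by (rule hol_section_continuous[OF F(1)])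
  have contH: "continuous_on D H'"
    by (intro continuous_at_imp_continuous_on ballI has_derivative_continuous[OF dH'])
  have contx: "continuous_on D x" unfolding x_def by (intro continuous_intros contH)

  \<comment> \<open>From the weighted inequality to a bound on the norm\<close>
  define f where "f z = hnorm_sq (h z) (F z)" for z
  define e where "e z = exp (- a * (cmod (z - w))\<^sup>2)" for z
  define \<kappa> where "\<kappa> z = a / (c1 * (cmod (z - w))\<^sup>2 + a)\<^sup>2" for z
  define N where "N = (\<integral>z. f z \<partial>lebesgue_on D)"
  have one: "continuous_on D (\<lambda>_. 1 :: real)" "\<And>z. z \<in> D \<Longrightarrow> 0 \<le> (1 :: real)" by auto
  have f0: "0 \<le> f z" if "z \<in> D" for z using nn[OF that] by (simp add: f_def)
  have int_f: "integrable (lebesgue_on D) f"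
    using wnorm_integrable(1)[OF D(1) h one contF] F(3) by (simp add: f_def[abs_def])
  have N: "wnorm D h (\<lambda>_. 1) F = ennreal N"
    using wnorm_integrable(2)[OF D(1) h one contF F(3)] by (simp add: N_def f_def[abs_def])
  have N0: "0 \<le> N" unfolding N_def by (intro integral_nonneg_AE AE_I2) (auto simp: f0)
  have contf: "continuous_on D f" unfolding f_def by (intro continuous_intros conth contF)
  have e: "0 < e z" "e z \<le> 1" for z using a by (auto simp: e_def)
  have xne: "x z \<noteq> 0" for z using xa[of z] a by auto
  have bounded_mult: "integrable (lebesgue_on D) (\<lambda>z. f z * g z)"
    if "continuous_on D g" "\<And>z. z \<in> D \<Longrightarrow> \<bar>g z\<bar> \<le> B" for g B
  proof (rule Bochner_Integration.integrable_bound)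
    show "integrable (lebesgue_on D) (\<lambda>z. B * f z)" using int_f by simp
    show "(\<lambda>z. f z * g z) \<in> borel_measurable (lebesgue_on D)"
      by (intro borel_measurable_lebesgue_on_continuous D(1) continuous_intros contf that)
    show "AE z in lebesgue_on D. norm (f z * g z) \<le> norm (B * f z)"
    proof (rule AE_I2)
      fix z assume "z \<in> space (lebesgue_on D)"
      then have z: "z \<in> D" by simp
      have "f z * \<bar>g z\<bar> \<le> f z * B" using that(2)[OF z] f0[OF z] by (rule mult_left_mono)
      moreover have "0 \<le> B" using that(2)[OF z] by linarith
      ultimately show "norm (f z * g z) \<le> norm (B * f z)" using f0[OF z] by (simp add: abs_mult mult.commute)
    qed
  qed
  have conte: "continuous_on D e" unfolding e_def by (intro continuous_intros)
  have int_fe: "integrable (lebesgue_on D) (\<lambda>z. f z * e z)"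
    by (rule bounded_mult[OF conte, of 1]) (use e in \<open>auto simp: less_imp_le\<close>)
  have ax: "0 \<le> a / (x z)\<^sup>2" "a / (x z)\<^sup>2 \<le> 1 / a" for z
  proof -
    show "0 \<le> a / (x z)\<^sup>2" using a by simp
    have "a\<^sup>2 \<le> (x z)\<^sup>2" using xa[of z] a by (intro power_mono) auto
    then have "a / (x z)\<^sup>2 \<le> a / a\<^sup>2" using a xa[of z] by (intro divide_left_mono) auto
    then show "a / (x z)\<^sup>2 \<le> 1 / a" using a by (simp add: power2_eq_square)
  qed
  have contax: "continuous_on D (\<lambda>z. a / (x z)\<^sup>2)" using xne by (intro continuous_intros contx) auto
  have int_fax: "integrable (lebesgue_on D) (\<lambda>z. f z * (a / (x z)\<^sup>2))"
  proof (rule bounded_mult[OF contax])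
    show "\<bar>a / (x z)\<^sup>2\<bar> \<le> 1 / a" for z using ax(2)[of z] unfolding abs_of_nonneg[OF ax(1)] .
  qed
  have int_faxe: "integrable (lebesgue_on D) (\<lambda>z. f z * (a / (x z)\<^sup>2 * e z))"
  proof (rule bounded_mult[where B="1 / a"])
    show "continuous_on D (\<lambda>z. a / (x z)\<^sup>2 * e z)" by (intro continuous_on_mult contax conte)
    show "\<bar>a / (x z)\<^sup>2 * e z\<bar> \<le> 1 / a" for z
    proof -
      have "a / (x z)\<^sup>2 * e z \<le> 1 / a * 1"
        using ax[of z] e[of z] a by (intro mult_mono) (auto simp: less_imp_le)
      moreover have "0 \<le> a / (x z)\<^sup>2 * e z" using ax(1)[of z] e(1)[of z] by (intro mult_nonneg_nonneg) auto
      ultimately show ?thesis by simp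
    qed
  qed
  have "f z * e z - f z * (a / (x z)\<^sup>2 * e z) = f z * ((1 - a / (x z)\<^sup>2) * e z)" for z
    by (simp only: left_diff_distrib right_diff_distrib mult_1_left)
  then have "(\<integral>z. f z * e z - f z * (a / (x z)\<^sup>2 * e z) \<partial>lebesgue_on D) \<le> 0"
    using est unfolding f_def e_def by (simp only:)
  then have le1: "(\<integral>z. f z * e z \<partial>lebesgue_on D) \<le> (\<integral>z. f z * (a / (x z)\<^sup>2 * e z) \<partial>lebesgue_on D)"
    using int_fe int_faxe by simp
  \<comment> \<open>On \<open>D\<close> the factor e is at least 1 - a R^2.\<close>
  have "(1 - a * R\<^sup>2) * N \<le> (\<integral>z. f z * e z \<partial>lebesgue_on D)"
  proof -
    have "(1 - a * R\<^sup>2) * N = (\<integral>z. f z * (1 - a * R\<^sup>2) \<partial>lebesgue_on D)" by (simp add: N_def mult.commute)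
    also have "\<dots> \<le> (\<integral>z. f z * e z \<partial>lebesgue_on D)"
    proof (rule integral_mono)
      show "f z * (1 - a * R\<^sup>2) \<le> f z * e z" if "z \<in> space (lebesgue_on D)" for z
      proof (rule mult_left_mono)
        have z: "z \<in> D" using that by simp
        have "(cmod (z - w))\<^sup>2 \<le> R\<^sup>2" using R(2)[OF z] by (intro power_mono) auto
        then have "1 - a * R\<^sup>2 \<le> 1 + - a * (cmod (z - w))\<^sup>2" using a by simp
        also have "\<dots> \<le> e z" unfolding e_def by (rule exp_ge_add_one_self)
        finally show "1 - a * R\<^sup>2 \<le> e z" .
      qed (use f0 that in auto)
    qed (use int_f int_fe in auto)
    finally show ?thesis .
  qed
  also note le1
  also have "(\<integral>z. f z * (a / (x z)\<^sup>2 * e z) \<partial>lebesgue_on D) \<le> (\<integral>z. f z * (a / (x z)\<^sup>2) \<partial>lebesgue_on D)"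
  proof (rule integral_mono[OF int_faxe int_fax])
    fix z assume "z \<in> space (lebesgue_on D)"
    then show "f z * (a / (x z)\<^sup>2 * e z) \<le> f z * (a / (x z)\<^sup>2)"
      using f0[of z] ax(1)[of z] e(1,2)[of z] by (intro mult_left_mono mult_left_le) (auto simp: less_imp_le)
  qed
  finally have step1: "(1 - a * R\<^sup>2) * N \<le> (\<integral>z. f z * (a / (x z)\<^sup>2) \<partial>lebesgue_on D)" .

  \<comment> \<open>The kernel a / x^2 near \<open>w\<close> and away from it\<close>
  define P where "P = (1 + t) * ((1 + t) * S + (1 + 1 / t) * (\<Lambda> * C * r\<^sup>2 * N))"
  have P0: "0 \<le> P" using t S0 \<Lambda>(1) C(1) N0 by (simp add: P_def)
  have \<kappa>0: "0 \<le> \<kappa> z" for z using a by (simp add: \<kappa>_def)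
  \<comment> \<open>Inside the disc f is at most P and the kernel at most the explicit \<kappa>;
    outside, the kernel is uniformly of order a.\<close>
  have pt: "f z * (a / (x z)\<^sup>2) \<le> 4 * a / \<mu>\<^sup>2 * f z + P * \<kappa> z" if z: "z \<in> D" for z
  proof (cases "z \<in> cball w r")
    case True
    then have zr: "cmod (z - w) \<le> r" by (simp add: dist_norm norm_minus_commute)
    have z1: "z \<in> cball w (r1 / 2)" "z \<in> cball w r1" "dist z w < r2"
      using True r1(1) r2(1) by (auto simp: r_def dist_commute)
    have "f z \<le> (1 + t) * hnorm_sq (h w) (F z)" unfolding f_def by (rule r1(3)[OF z1(2)])
    moreover have "hnorm_sq (h w) (F z) = hnorm_sq (h w) (s + (F z - F w))" by (simp add: F(2))
    moreover have "hnorm_sq (h w) (s + (F z - F w)) \<le> (1 + t) * S + (1 + 1 / t) * hnorm_sq (h w) (F z - F w)"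
      unfolding S_def by (rule hnorm_sq_add_le[OF pd[OF w] t(1)])
    moreover have "hnorm_sq (h w) (F z - F w) \<le> \<Lambda> * C * r\<^sup>2 * N"
    proof -
      have "(norm (F z - F w))\<^sup>2 \<le> C * N * (cmod (z - w))\<^sup>2" by (rule C(2)[OF F(1) N N0 z1(1)])
      also have "\<dots> \<le> C * N * r\<^sup>2" using C(1) N0 zr by (intro mult_left_mono power_mono) auto
      finally have "\<Lambda> * (norm (F z - F w))\<^sup>2 \<le> \<Lambda> * (C * N * r\<^sup>2)" using \<Lambda>(1) by simp
      with \<Lambda>(2)[of "F z - F w"] have "hnorm_sq (h w) (F z - F w) \<le> \<Lambda> * (C * N * r\<^sup>2)" by (rule order_trans)
      also have "\<dots> = \<Lambda> * C * r\<^sup>2 * N" by (simp only: mult_ac)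
      finally show ?thesis .
    qed
    then have "(1 + 1 / t) * hnorm_sq (h w) (F z - F w) \<le> (1 + 1 / t) * (\<Lambda> * C * r\<^sup>2 * N)"
      using t by (intro mult_left_mono) auto
    ultimately have "hnorm_sq (h w) (F z) \<le> (1 + t) * S + (1 + 1 / t) * (\<Lambda> * C * r\<^sup>2 * N)" by linarith
    then have "(1 + t) * hnorm_sq (h w) (F z) \<le> P" unfolding P_def using t by (intro mult_left_mono) auto
    with \<open>f z \<le> _\<close> have fP: "f z \<le> P" by linarith
    have "c1 * (cmod (z - w))\<^sup>2 \<le> (cmod (z - w))\<^sup>2 * exp (2 * H' z)"
    proof -
      have "(1 - t) * ((1 - t) * c) \<le> b * exp (2 * H z)"
        using r2(2)[OF z1(3)] b t c0 by (intro mult_mono) auto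
      then have "c1 \<le> exp (2 * H' z)" by (simp add: c1_def exp_H' power2_eq_square mult.assoc)
      then show ?thesis by (subst mult.commute) (intro mult_left_mono, auto)
    qed
    then have xk: "c1 * (cmod (z - w))\<^sup>2 + a \<le> x z" by (simp add: x_def)
    have pos: "0 < c1 * (cmod (z - w))\<^sup>2 + a" using c1 a by (simp add: add_nonneg_pos)
    have "a / (x z)\<^sup>2 \<le> \<kappa> z" unfolding \<kappa>_def
      using xk pos a xne[of z] by (intro divide_left_mono power_mono) (auto simp: zero_less_mult_iff)
    then have "f z * (a / (x z)\<^sup>2) \<le> P * \<kappa> z" using fP f0[OF z] P0 ax(1)[of z] by (intro mult_mono) auto
    moreover have "0 \<le> 4 * a / \<mu>\<^sup>2 * f z" using a f0[OF z] by simp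
    ultimately show ?thesis by linarith
  next
    case False
    then have zr: "r \<le> cmod (z - w)" by (simp add: dist_norm norm_minus_commute)
    \<comment> \<open>The factor 1 / 2 comes from b > 1 / 2.\<close>
    have "\<mu> / 2 \<le> x z"
    proof -
      have "exp (- 2 * BH) \<le> exp (2 * H z)" using BH[OF z] by simp
      then have "\<mu> \<le> (cmod (z - w))\<^sup>2 * exp (2 * H z)"
        unfolding \<mu>_def using zr r by (intro mult_mono power_mono) auto
      then have "1 / 2 * \<mu> \<le> b * ((cmod (z - w))\<^sup>2 * exp (2 * H z))"
        using b \<mu> by (intro mult_mono) auto
      then show ?thesis using a unfolding x_eq by simp
    qed
    then have "(\<mu> / 2)\<^sup>2 \<le> (x z)\<^sup>2" using \<mu> by (intro power_mono) auto
    then have "a / (x z)\<^sup>2 \<le> a / (\<mu> / 2)\<^sup>2" using a \<mu> xne[of z] by (intro divide_left_mono) auto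
    also have "a / (\<mu> / 2)\<^sup>2 = 4 * a / \<mu>\<^sup>2" by (simp add: power2_eq_square)
    finally have "f z * (a / (x z)\<^sup>2) \<le> f z * (4 * a / \<mu>\<^sup>2)" using f0[OF z] by (rule mult_left_mono)
    moreover have "0 \<le> P * \<kappa> z" using P0 \<kappa>0 by simp
    ultimately show ?thesis by (simp add: mult.commute)
  qed
  have "continuous_on UNIV \<kappa>"
  proof -
    have "0 < c1 * (cmod (z - w))\<^sup>2 + a" for z using c1 a by (intro add_nonneg_pos) auto
    then have "c1 * (cmod (z - w))\<^sup>2 + a \<noteq> 0" for z by (simp add: less_le)
    then show ?thesis unfolding \<kappa>_def by (intro continuous_intros) auto
  qed
  then have m\<kappa>: "\<kappa> \<in> borel_measurable (lebesgue_on D)"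
    using D(1) by (intro borel_measurable_lebesgue_on_continuous) (auto intro: continuous_on_subset)
  have nn\<kappa>: "(\<integral>\<^sup>+z. ennreal (\<kappa> z) \<partial>lebesgue_on D) \<le> ennreal (pi / c1)"
  proof -
    have "(\<integral>\<^sup>+z. ennreal (\<kappa> z) \<partial>lebesgue_on D) = (\<integral>\<^sup>+z. ennreal (\<kappa> z) * indicator D z \<partial>lebesgue)"
      using D(1) by (intro nn_integral_restrict_space) auto
    also have "\<dots> \<le> (\<integral>\<^sup>+z. ennreal (\<kappa> z) \<partial>lebesgue)"
      by (intro nn_integral_mono) (auto simp: indicator_def)
    also have "\<dots> = ennreal (pi / c1)"
      unfolding nn_integral_completion \<kappa>_def by (rule nn_integral_concentrating_kernel[OF a c1])
    finally show ?thesis .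
  qed
  have int\<kappa>: "integrable (lebesgue_on D) \<kappa>"
    using m\<kappa> \<kappa>0 nn\<kappa> by (intro integrableI_nonneg) (auto intro: le_less_trans)
  have I\<kappa>: "(\<integral>z. \<kappa> z \<partial>lebesgue_on D) \<le> pi / c1"
    using nn\<kappa> nn_integral_eq_integral[OF int\<kappa>] \<kappa>0 c1 by (simp add: ennreal_le_iff)
  have "(\<integral>z. f z * (a / (x z)\<^sup>2) \<partial>lebesgue_on D) \<le> (\<integral>z. 4 * a / \<mu>\<^sup>2 * f z + P * \<kappa> z \<partial>lebesgue_on D)"
  proof (rule integral_mono[OF int_fax])
    show "integrable (lebesgue_on D) (\<lambda>z. 4 * a / \<mu>\<^sup>2 * f z + P * \<kappa> z)" using int_f int\<kappa> by simp
    show "f z * (a / (x z)\<^sup>2) \<le> 4 * a / \<mu>\<^sup>2 * f z + P * \<kappa> z" if "z \<in> space (lebesgue_on D)" for z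
      by (rule pt) (use that in simp)
  qed
  also have "\<dots> = 4 * a / \<mu>\<^sup>2 * N + P * (\<integral>z. \<kappa> z \<partial>lebesgue_on D)"
    using int_f int\<kappa> by (simp add: N_def)
  also have "\<dots> \<le> 4 * a / \<mu>\<^sup>2 * N + P * (pi / c1)"
    using I\<kappa> P0 by (intro add_left_mono mult_left_mono)
  finally have "(1 - a * R\<^sup>2) * N \<le> 4 * a / \<mu>\<^sup>2 * N + P * (pi / c1)" using step1 by simp
  moreover have "P * (pi / c1) = (1 + t)\<^sup>2 * (pi * S / c1) + K * r\<^sup>2 * N"
  proof -
    have gen: "(1 + t) * ((1 + t) * S + u * (\<Lambda> * C * q * N)) * X = (1 + t)\<^sup>2 * (S * X) + X * ((1 + t) * (u * (\<Lambda> * C))) * q * N"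
      for u X q :: real by (simp add: power2_eq_square algebra_simps)
    have "pi * S / c1 = S * (pi / c1)" by simp
    then show ?thesis unfolding P_def K_def gen by (simp only:)
  qed
  moreover have "K * r\<^sup>2 * N \<le> t * N" using rK N0 by (rule mult_right_mono)
  moreover have "(a * (R\<^sup>2 + 4 / \<mu>\<^sup>2)) * N \<le> t * N" using a_den N0 by (rule mult_right_mono)
  moreover have "(a * (R\<^sup>2 + 4 / \<mu>\<^sup>2)) * N = a * R\<^sup>2 * N + 4 * a / \<mu>\<^sup>2 * N" by (simp add: algebra_simps)
  \<comment> \<open>The two error terms t N are moved to the left; this works because N is
    finite.\<close>
  ultimately have "(1 - 2 * t) * N \<le> (1 + t)\<^sup>2 * (pi * S / c1)" by (simp add: left_diff_distrib)
  then have "N * (1 - 2 * t) \<le> (1 + t)\<^sup>2 * (pi * S / c1)" by (subst mult.commute)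
  then have "N \<le> (1 + t)\<^sup>2 * (pi * S / c1) / (1 - 2 * t)"
    using t by (intro mult_imp_le_div_pos) auto
  also have "\<dots> = pi * S / c * (1 + t)\<^sup>2 / ((1 - t)\<^sup>2 * (1 - 2 * t))"
    by (simp add: c1_def mult_ac)
  finally show ?thesis
    using that[OF F(1,2)] N by (simp add: S_def c_def ennreal_leI)
qed

theorem theorem1p4:
  fixes D :: "complex set" and h :: "complex \<Rightarrow> complex^'r^'r"
    and w :: complex and s :: "complex^'r"
  assumes "open D" and "connected D" and "bounded D"
    and "continuous_hermitian_metric D h"
    and "L2_optimal D h"
    and "w \<in> D"
    and "\<exists>g. green_function D w g"
  shows "\<exists>f :: complex \<Rightarrow> complex^'r. (\<forall>i. (\<lambda>z. f z $ i) holomorphic_on D) \<and> f w = s \<and>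
    (\<integral>\<^sup>+z. ennreal (hnorm_sq (h z) (f z)) \<partial>lebesgue_on D)
      \<le> ennreal (pi * hnorm_sq (h w) s / (log_capacity D w)\<^sup>2)"
proof -
  note h = assms(4) and opt = assms(5) and w = assms(6)
  obtain H p B where p: "p holomorphic_on D"
    and H: "\<And>z. z \<in> D \<Longrightarrow> (H has_derivative (\<lambda>v. Re (p z * v))) (at z)"
    and B: "\<And>z. z \<in> D \<Longrightarrow> \<bar>H z\<bar> \<le> B"
    and neg: "\<And>z. z \<in> D - {w} \<Longrightarrow> H z + ln (cmod (z - w)) \<le> 0"
    and cap: "log_capacity D w = exp (H w)"
    by (rule green_function_logarithmic_capacity[OF assms(1,3,6,7)]) (rule that; assumption)
  obtain F0 where F0: "hol_section D F0" "F0 w = s" "wnorm D h (\<lambda>_. 1) F0 < \<infinity>"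
    by (rule finite_norm_section[OF assms(1,3) h opt w, of s]) (rule that; assumption)
  \<comment> \<open>The sections from \<open>almost_optimal_extension\<close> vary with t. The
    minimizer of the unweighted norm lies below all of them, so the limit t \<rightarrow> 0 is a
    limit of numbers and not of sections.\<close>
  obtain F where F: "hol_section D F" "F w = s"
    and min: "\<And>G. hol_section D G \<Longrightarrow> G w = s \<Longrightarrow> wnorm D h (\<lambda>_. 1) F \<le> wnorm D h (\<lambda>_. 1) G"
    by (rule wnorm_minimizer[OF assms(1) h continuous_on_const zero_less_one w F0]) (rule that; assumption)
  define A where "A = pi * hnorm_sq (h w) s / exp (2 * H w)"
  have pd: "pos_def_hermitian (h w)" using h w by (simp add: continuous_hermitian_metric_def)
  have A: "A \<ge> 0" unfolding A_def by (simp add: hnorm_sq_nonneg[OF pd])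
  define g where "g t = A * (1 + t)\<^sup>2 / ((1 - t)\<^sup>2 * (1 - 2 * t))" for t
  have le: "wnorm D h (\<lambda>_. 1) F \<le> ennreal (g t)" if t: "0 < t" "t < 1 / 4" for t
  proof -
    obtain G where "hol_section D G" "G w = s" "wnorm D h (\<lambda>_. 1) G \<le> ennreal (g t)"
      by (rule almost_optimal_extension[OF assms(1,3) h opt w p H B neg t, of s]) (auto simp: g_def A_def)
    then show ?thesis using order_trans[OF min[of G]] by simp
  qed
  have "isCont g 0" unfolding g_def by (intro continuous_intros) auto
  then have "(g \<longlongrightarrow> g 0) (at_right 0)"
    unfolding isCont_def by (rule tendsto_mono[OF at_le[OF subset_UNIV]])
  moreover have "g 0 = A" by (simp add: g_def)
  ultimately have "((\<lambda>t. ennreal (g t)) \<longlongrightarrow> ennreal A) (at_right 0)"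
    by (intro tendsto_ennrealI) simp
  moreover have "\<forall>\<^sub>F t in at_right 0. wnorm D h (\<lambda>_. 1) F \<le> ennreal (g t)"
    unfolding eventually_at_right_field using le by (intro exI[of _ "1 / 4"]) auto
  ultimately have "wnorm D h (\<lambda>_. 1) F \<le> ennreal A"
    by (rule tendsto_lowerbound) simp
  moreover have "A = pi * hnorm_sq (h w) s / (log_capacity D w)\<^sup>2"
    by (simp add: A_def cap exp_double)
  ultimately have "(\<integral>\<^sup>+z. ennreal (hnorm_sq (h z) (F z)) \<partial>lebesgue_on D)
      \<le> ennreal (pi * hnorm_sq (h w) s / (log_capacity D w)\<^sup>2)"
    by (simp add: wnorm_def)
  with F show ?thesis unfolding hol_section_def by (intro exI[of _ F] conjI)
qed

end
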